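(* Let $M$ be a (finite-dimensional) $L$-weight $U_{v,1}$-module. For homogeneous $\varphi_{-\lambda}\in(M^* )_{-\lambda}$ put $$D_M:\Phi_t(M^* )\to\Phi_t(M)^*,\qquad D_M(\varphi_{-\lambda})=t^{-\langle\lambda,\lambda\rangle}\varphi_{-\lambda}.$$ Then $D_M$ is a $U_{v,t}$-module isomorphism. Under this identification, the evaluation and coevaluation maps obey $$\mathrm{ev}_t\,(D_M\otimes\mathrm{id}_M)=\mathrm{ev}_1\,J_{M^*,M},\qquad \mathrm{qtr}_t\,(\mathrm{id}_M\otimes D_M)=\mathrm{qtr}_1\,J_{M,M^*},$$ $$\mathrm{coev}_t=(D_M\otimes\mathrm{id}_M)\,J_{M^*,M}^{-1}\,\mathrm{coev}_1,\qquad \mathrm{coqtr}_t=(\mathrm{id}_M\otimes D_M)\,J_{M,M^*}^{-1}\,\mathrm{coqtr}_1,$$ where the maps with subscript $t$ are those of the $U_{v,t}$-module $\Phi_t(M)$ and the maps with subscript $1$ are those of the $U_{v,1}$-module $M$, extended from $\mathbb Q(v^{1/D})$ to $\mathbb K_D$.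
   Context: **Cartan data.** $I$ is a nonempty finite set and $\Omega=(\Omega_{ij})_{i,j\in I}$ an integer matrix with $\Omega_{ii}>0$; for $i\neq j$, $\Omega_{ij}\le 0$ and $(\Omega_{ij}+\Omega_{ji})/\Omega_{ii}\in\mathbb Z_{\le 0}$; and $\gcd_{i}\Omega_{ii}=1$. $Q=\mathbb Z[I]$ is the root lattice (free abelian on $I$). Bilinear forms on $Q$: $\langle i,j\rangle=\Omega_{ij}$ and $i\cdot j=\Omega_{ij}+\Omega_{ji}$. Put $d_i=\Omega_{ii}=(i\cdot i)/2$, $a_{ij}=(i\cdot j)/d_i$. Finite type is assumed: $\cdot$ is positive definite on $Q\otimes_{\mathbb Z}\mathbb Q$. An admissible lattice is a free abelian group $L$ with $Q\subseteq L\subseteq Q\otimes_{\mathbb Z}\mathbb Q$, $[L:Q]<\infty$ (fixed throughout); both forms extend $\mathbb Q$-bilinearly. For $\lambda=\sum_i\lambda_ii\in L$, $\mathrm{ht}_d(\lambda)=\sum_id_i\lambda_i$. $D$ is a positive integer with $\lambda\cdot\mu,\langle\lambda,\mu\rangle,\mathrm{ht}_d(\lambda)\in D^{-1}\mathbb Z$ for all $\lambda,\mu\in L$; $v,t$ are algebraically independent variables and $\mathbb K_D=\mathbb Q(v^{1/D},t^{1/D})$. $v_\lambda=v^{\mathrm{ht}_d(\lambda)}$, $v_i=v^{d_i}$, $t_i=t^{d_i}$. **The algebra.** $[p]_{v_i,t_i}=\frac{(v_it_i)^p-(v_it_i^{-1})^{-p}}{v_it_i-(v_it_i^{-1})^{-1}}$,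 $[p]_{v_i,t_i}!=\prod_{r=1}^p[r]_{v_i,t_i}$. $U_{v,t}$ is the $\mathbb K_D$-algebra generated by $E_i,F_i,K_i^{\pm1},(K_i')^{\pm1}$ ($i\in I$), all $K_i,K_i'$ commuting and invertible, with relations $K_iE_jK_i^{-1}=v^{i\cdot j}t^{\langle j,i\rangle-\langle i,j\rangle}E_j$, $K_i'E_jK_i'^{-1}=v^{-i\cdot j}t^{\langle j,i\rangle-\langle i,j\rangle}E_j$, $K_iF_jK_i^{-1}=v^{-i\cdot j}t^{\langle i,j\rangle-\langle j,i\rangle}F_j$, $K_i'F_jK_i'^{-1}=v^{i\cdot j}t^{\langle i,j\rangle-\langle j,i\rangle}F_j$, $E_iF_j-F_jE_i=\delta_{ij}\frac{K_i-K_i'}{v_i-v_i^{-1}}$, and for $i\ne j$, $N_{ij}=1-a_{ij}$, with $E_i^{(p)}=E_i^p/[p]_{v_i,t_i}!$, $F_i^{(p)}=F_i^p/[p]_{v_i,t_i}!$, $\kappa_{ij}(p,p')=(-1)^pt^{-d_ipp'+p\langle i,j\rangle-p\langle j,i\rangle}$: $\sum_{p+p'=N_{ij}}\kappa_{ij}(p,p')E_i^{(p)}E_jE_i^{(p')}=0$, $\sum_{p+p'=N_{ij}}\kappa_{ij}(p,p')F_i^{(p')}F_jF_i^{(p)}=0$. Hopf structure: $\Delta(K_i)=K_i\otimes K_i$, $\Delta(K_i')=K_i'\otimes K_i'$, $\Delta(E_i)=E_i\otimes1+K_i\otimes E_i$, $\Delta(F_i)=1\otimes F_i+F_i\otimes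 K_i'$; $S(E_i)=-K_i^{-1}E_i$, $S(F_i)=-F_i(K_i')^{-1}$, $S(K_i)=K_i^{-1}$, $S(K_i')=K_i'^{-1}$; $\varepsilon(K_i)=\varepsilon(K_i')=1$, $\varepsilon(E_i)=\varepsilon(F_i)=0$. $U_{v,1}$ is obtained by evaluating all coefficients at $t=1$ and extending scalars from $\mathbb Q(v^{1/D})$ to $\mathbb K_D$. **Modules and transport.** An $L$-weight $U_{v,t}$-module is a finite-dimensional module $M=\bigoplus_{\lambda\in L}M_\lambda$ with $E_iM_\lambda\subseteq M_{\lambda+i}$, $F_iM_\lambda\subseteq M_{\lambda-i}$, and $K_i=v^{i\cdot\lambda}t^{\langle\lambda,i\rangle-\langle i,\lambda\rangle}$, $K_i'=v^{-i\cdot\lambda}t^{\langle\lambda,i\rangle-\langle i,\lambda\rangle}$ on $M_\lambda$; for $U_{v,1}$ put $t=1$. The dual $M^*=\mathrm{Hom}_{\mathbb K_D}(M,\mathbb K_D)$ has action $(u\varphi)(m)=\varphi(S(u)m)$, with weight spaces $(M^* )_{-\lambda}=\{\varphi:\varphi(M_\mu)=0\text{ for }\mu\ne\lambda\}$. For an $L$-weight $U_{v,1}$-module $M$ (action denoted by superscript $(1)$), $\Phi_t(M)$ is the same weight-graded vector space with $U_{v,t}$-action, on $m_\lambda\in M_\lambda$: $K_i^{(t)}m_\lambda=v^{i\cdot\lambda}t^{\langle\lambda,i\rangle-\langle i,\lambda\rangle}m_\lambda$, $(K_i')^{(t)}m_\lambda=v^{-i\cdot\lambda}t^{\langle\lambda,i\rangle-\langle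 i,\lambda\rangle}m_\lambda$, $E_i^{(t)}m_\lambda=t^{\langle\lambda,i\rangle}E_i^{(1)}m_\lambda$, $F_i^{(t)}m_\lambda=t^{d_i-\langle i,\lambda\rangle}F_i^{(1)}m_\lambda$. Tensor comparison: $J_{M,N}:\Phi_t(M)\otimes_{\Delta_t}\Phi_t(N)\to\Phi_t(M\otimes_{\Delta_1}N)$, $J_{M,N}(m_\lambda\otimes n_\mu)=t^{\langle\mu,\lambda\rangle}m_\lambda\otimes n_\mu$. Maps of $U_{v,1}$-modules are viewed as maps of the underlying spaces of their transports. **Cup-cap maps.** For an $L$-weight module $M$ with weight basis $\mathcal E$ and ordinary dual basis $\{b^*\}$: $\mathrm{ev}:M^*\otimes M\to\mathbb K_D$, $\mathrm{ev}(\varphi\otimes m)=\varphi(m)$; $\mathrm{qtr}:M\otimes M^*\to\mathbb K_D$, $\mathrm{qtr}(m_\lambda\otimes\varphi)=v_{-\lambda}^2\varphi(m_\lambda)$; $\mathrm{coev}:\mathbb K_D\to M^*\otimes M$, $\mathrm{coev}(1)=\sum_{b\in\mathcal E}v_{\mathrm{wt}(b)}^2\,b^*\otimes b$; $\mathrm{coqtr}:\mathbb K_D\to M\otimes M^*$, $\mathrm{coqtr}(1)=\sum_{b\in\mathcal E}b\otimes b^*$. *)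

theory Defs
  imports
    "HOL-Library.Poly_Mapping"
    "HOL-Library.Function_Algebras"
    "HOL-Computational_Algebra.Polynomial"
    "HOL-Computational_Algebra.Fraction_Field"
    "HOL-Algebra.QuotRing"
begin

section \<open>Cartan data and admissible lattices\<close>

text \<open>
  The index set is a type \<open>'i\<close> of class \<^class>\<open>finite\<close>.  Elements of \<open>Q \<otimes> \<rat>\<close> are functions
  \<open>'i \<Rightarrow> rat\<close> (coefficients with respect to the simple roots, with pointwise addition); the
  root lattice consists of the integer-valued ones.
\<close>

record 'i qdatum =
  Om :: "'i \<Rightarrow> 'i \<Rightarrow> int"
  Lat :: "('i \<Rightarrow> rat) set"
  Den :: nat

definition simple_root :: "'i \<Rightarrow> 'i \<Rightarrow> rat" where
  "simple_root i = (\<lambda>k. if k = i then 1 else 0)"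

definition root_lattice :: "('i \<Rightarrow> rat) set" where
  "root_lattice = {\<nu>. \<forall>i. \<nu> i \<in> \<int>}"

definition pairing :: "('i::finite) qdatum \<Rightarrow> ('i \<Rightarrow> rat) \<Rightarrow> ('i \<Rightarrow> rat) \<Rightarrow> rat" where
  "pairing C \<nu> \<mu> = (\<Sum>i\<in>UNIV. \<Sum>j\<in>UNIV. \<nu> i * \<mu> j * of_int (Om C i j))"

definition dotp :: "('i::finite) qdatum \<Rightarrow> ('i \<Rightarrow> rat) \<Rightarrow> ('i \<Rightarrow> rat) \<Rightarrow> rat" where
  "dotp C \<nu> \<mu> = pairing C \<nu> \<mu> + pairing C \<mu> \<nu>"

definition ht_d :: "('i::finite) qdatum \<Rightarrow> ('i \<Rightarrow> rat) \<Rightarrow> rat" where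
  "ht_d C \<nu> = (\<Sum>i\<in>UNIV. of_int (Om C i i) * \<nu> i)"

definition cartan_datum :: "('i::finite) qdatum \<Rightarrow> bool" where
  "cartan_datum C \<longleftrightarrow>
     (\<forall>i. Om C i i > 0) \<and>
     (\<forall>i j. i \<noteq> j \<longrightarrow> Om C i j \<le> 0 \<and> (\<exists>k\<le>0. Om C i j + Om C j i = k * Om C i i)) \<and>
     Gcd (range (\<lambda>i. Om C i i)) = 1 \<and>
     (\<forall>\<nu>. \<nu> \<noteq> 0 \<longrightarrow> dotp C \<nu> \<nu> > 0)"

text \<open>
  Freeness of \<open>L\<close> need not be demanded: an overgroup of finite index of \<open>Q\<close> inside a rational
  vector space is finitely generated and torsion free.
\<close>

definition admissible_lattice :: "('i::finite) qdatum \<Rightarrow> bool" where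
  "admissible_lattice C \<longleftrightarrow>
     root_lattice \<subseteq> Lat C \<and>
     (\<forall>\<nu>\<in>Lat C. \<forall>\<mu>\<in>Lat C. \<nu> - \<mu> \<in> Lat C) \<and>
     finite (Lat C // {(\<nu>, \<mu>). \<nu> \<in> Lat C \<and> \<mu> \<in> Lat C \<and> \<nu> - \<mu> \<in> root_lattice})"

definition common_denominator :: "('i::finite) qdatum \<Rightarrow> bool" where
  "common_denominator C \<longleftrightarrow> Den C > 0 \<and>
     (\<forall>\<nu>\<in>Lat C. \<forall>\<mu>\<in>Lat C.
        of_nat (Den C) * dotp C \<nu> \<mu> \<in> \<int> \<and>
        of_nat (Den C) * pairing C \<nu> \<mu> \<in> \<int> \<and>
        of_nat (Den C) * ht_d C \<nu> \<in> \<int>)"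


section \<open>The ground field\<close>

text \<open>
  \<open>\<rat>(v\<^sup>1\<^sup>/\<^sup>D, t\<^sup>1\<^sup>/\<^sup>D)\<close> is the field of rational functions in the two variables
  \<open>vroot = v\<^sup>1\<^sup>/\<^sup>D\<close> and \<open>troot = t\<^sup>1\<^sup>/\<^sup>D\<close>.
\<close>

type_synonym kfield = "rat poly poly fract"

definition vroot :: kfield where "vroot = Fract [:[:0, 1:]:] 1"
definition troot :: kfield where "troot = Fract [:0, 1:] 1"

text \<open>
  \<open>vpow C q\<close> is \<open>v\<^sup>q\<close> and \<open>tpow C troot q\<close> is \<open>t\<^sup>q\<close>, for \<open>q \<in> D\<^sup>-\<^sup>1\<int>\<close>; the floor only serves
  to convert the integer \<open>D q\<close> to type \<^typ>\<open>int\<close>.  Every object depending on \<open>t\<close> takes as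
  parameter \<open>s\<close> the value assigned to \<open>t\<^sup>1\<^sup>/\<^sup>D\<close>: with \<open>s = troot\<close> it is the object over \<open>U\<^sub>v\<^sub>,\<^sub>t\<close>, and
  with \<open>s = 1\<close> all coefficients are evaluated at \<open>t = 1\<close>.
\<close>

definition vpow :: "'i qdatum \<Rightarrow> rat \<Rightarrow> kfield" where
  "vpow C q = vroot powi \<lfloor>of_nat (Den C) * q\<rfloor>"

definition tpow :: "'i qdatum \<Rightarrow> kfield \<Rightarrow> rat \<Rightarrow> kfield" where
  "tpow C s q = s powi \<lfloor>of_nat (Den C) * q\<rfloor>"

definition v_i :: "'i qdatum \<Rightarrow> 'i \<Rightarrow> kfield" where
  "v_i C i = vpow C (of_int (Om C i i))"

definition t_i :: "'i qdatum \<Rightarrow> kfield \<Rightarrow> 'i \<Rightarrow> kfield" where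
  "t_i C s i = tpow C s (of_int (Om C i i))"

definition v_wt :: "('i::finite) qdatum \<Rightarrow> ('i \<Rightarrow> rat) \<Rightarrow> kfield" where
  "v_wt C \<nu> = vpow C (ht_d C \<nu>)"

definition qnum :: "'i qdatum \<Rightarrow> kfield \<Rightarrow> 'i \<Rightarrow> nat \<Rightarrow> kfield" where
  "qnum C s i p =
     ((v_i C i * t_i C s i) ^ p - (v_i C i * inverse (t_i C s i)) powi (- int p)) /
     (v_i C i * t_i C s i - inverse (v_i C i * inverse (t_i C s i)))"

definition qfact :: "'i qdatum \<Rightarrow> kfield \<Rightarrow> 'i \<Rightarrow> nat \<Rightarrow> kfield" where
  "qfact C s i p = (\<Prod>r=1..p. qnum C s i r)"


section \<open>The algebra\<close>

text \<open>
  Lists form the free monoid under concatenation; hence \<open>'i gen list \<Rightarrow>\<^sub>0 kfield\<close> with the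
  convolution product is the free unital algebra on the generators.
\<close>

instantiation list :: (type) monoid_add
begin
definition zero_list :: "'a list" where "zero_list = []"
definition plus_list :: "'a list \<Rightarrow> 'a list \<Rightarrow> 'a list" where "plus_list = (@)"
instance by standard (simp_all add: zero_list_def plus_list_def)
end

text \<open>\<open>GL i\<close> stands for \<open>K'\<^sub>i\<close>; \<open>GKinv i\<close> and \<open>GLinv i\<close> for the inverses of \<open>K\<^sub>i\<close> and \<open>K'\<^sub>i\<close>.\<close>

datatype 'i gen = GE 'i | GF 'i | GK 'i | GKinv 'i | GL 'i | GLinv 'i

type_synonym 'i falg = "'i gen list \<Rightarrow>\<^sub>0 kfield"

definition fgen :: "'i gen \<Rightarrow> 'i falg" where
  "fgen g = Poly_Mapping.single [g] 1"

definition fscalar :: "kfield \<Rightarrow> 'i falg" where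
  "fscalar c = Poly_Mapping.single [] c"

definition free_algebra :: "'i falg ring" where
  "free_algebra = \<lparr>carrier = UNIV, mult = (*), one = 1, zero = 0, add = (+)\<rparr>"

text \<open>The divided powers \<open>g\<^sup>(\<^sup>p\<^sup>)\<close> for \<open>g = E\<^sub>i\<close> or \<open>g = F\<^sub>i\<close>.\<close>

definition divpow :: "'i qdatum \<Rightarrow> kfield \<Rightarrow> 'i \<Rightarrow> 'i gen \<Rightarrow> nat \<Rightarrow> 'i falg" where
  "divpow C s i g p = fscalar (inverse (qfact C s i p)) * fgen g ^ p"

definition serre_deg :: "'i qdatum \<Rightarrow> 'i \<Rightarrow> 'i \<Rightarrow> nat" where
  "serre_deg C i j = nat (1 - (Om C i j + Om C j i) div Om C i i)"

definition kappa :: "'i qdatum \<Rightarrow> kfield \<Rightarrow> 'i \<Rightarrow> 'i \<Rightarrow> nat \<Rightarrow> nat \<Rightarrow> kfield" where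
  "kappa C s i j p p' = (- 1) ^ p *
     tpow C s (of_int (- Om C i i * int p * int p' + int p * Om C i j - int p * Om C j i))"

definition cartan_gens :: "'i gen set" where
  "cartan_gens = range GK \<union> range GKinv \<union> range GL \<union> range GLinv"

text \<open>Each relation \<open>x = y\<close> is recorded as the element \<open>x - y\<close> of the free algebra.\<close>

definition relators :: "'i qdatum \<Rightarrow> kfield \<Rightarrow> 'i falg set" where
  "relators C s =
     {fgen g * fgen h - fgen h * fgen g | g h. g \<in> cartan_gens \<and> h \<in> cartan_gens} \<union>
     {fgen (GK i) * fgen (GKinv i) - 1 | i. True} \<union>
     {fgen (GL i) * fgen (GLinv i) - 1 | i. True} \<union>
     {fgen (GK i) * fgen (GE j) * fgen (GKinv i) -
        fscalar (vpow C (of_int (Om C i j + Om C j i)) * tpow C s (of_int (Om C j i - Om C i j)))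
          * fgen (GE j) | i j. True} \<union>
     {fgen (GL i) * fgen (GE j) * fgen (GLinv i) -
        fscalar (vpow C (of_int (- (Om C i j + Om C j i))) * tpow C s (of_int (Om C j i - Om C i j)))
          * fgen (GE j) | i j. True} \<union>
     {fgen (GK i) * fgen (GF j) * fgen (GKinv i) -
        fscalar (vpow C (of_int (- (Om C i j + Om C j i))) * tpow C s (of_int (Om C i j - Om C j i)))
          * fgen (GF j) | i j. True} \<union>
     {fgen (GL i) * fgen (GF j) * fgen (GLinv i) -
        fscalar (vpow C (of_int (Om C i j + Om C j i)) * tpow C s (of_int (Om C i j - Om C j i)))
          * fgen (GF j) | i j. True} \<union>
     {fgen (GE i) * fgen (GF j) - fgen (GF j) * fgen (GE i) -
        (if i = j
         then fscalar (inverse (v_i C i - inverse (v_i C i))) * (fgen (GK i) - fgen (GL i))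
         else 0) | i j. True} \<union>
     {(\<Sum>p\<le>serre_deg C i j.
         fscalar (kappa C s i j p (serre_deg C i j - p)) *
         divpow C s i (GE i) p * fgen (GE j) * divpow C s i (GE i) (serre_deg C i j - p))
       | i j. i \<noteq> j} \<union>
     {(\<Sum>p\<le>serre_deg C i j.
         fscalar (kappa C s i j p (serre_deg C i j - p)) *
         divpow C s i (GF i) (serre_deg C i j - p) * fgen (GF j) * divpow C s i (GF i) p)
       | i j. i \<noteq> j}"

definition rel_ideal :: "'i qdatum \<Rightarrow> kfield \<Rightarrow> 'i falg set" where
  "rel_ideal C s = Idl\<^bsub>free_algebra\<^esub> (relators C s)"

text \<open>
  \<open>qalg C troot\<close> is \<open>U\<^sub>v\<^sub>,\<^sub>t\<close> and \<open>qalg C 1\<close> is \<open>U\<^sub>v\<^sub>,\<^sub>1\<close>, the latter directly with scalars in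
  \<^typ>\<open>kfield\<close>: an algebra given by generators and relations keeps its presentation under
  extension of scalars.
\<close>

definition qalg :: "'i qdatum \<Rightarrow> kfield \<Rightarrow> 'i falg set ring" where
  "qalg C s = free_algebra Quot rel_ideal C s"

definition qcoset :: "'i qdatum \<Rightarrow> kfield \<Rightarrow> 'i falg \<Rightarrow> 'i falg set" where
  "qcoset C s x = rel_ideal C s +>\<^bsub>free_algebra\<^esub> x"

definition qgen :: "'i qdatum \<Rightarrow> kfield \<Rightarrow> 'i gen \<Rightarrow> 'i falg set" where
  "qgen C s g = qcoset C s (fgen g)"

definition qscalar :: "'i qdatum \<Rightarrow> kfield \<Rightarrow> kfield \<Rightarrow> 'i falg set" where
  "qscalar C s c = qcoset C s (fscalar c)"

definition qrep :: "'i falg set \<Rightarrow> 'i falg" where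
  "qrep u = (SOME x. x \<in> u)"

text \<open>
  The antipode is the antimultiplicative linear map with the given values on generators; it is
  defined on the free algebra and passes to the quotient.
\<close>

primrec antipode_gen :: "'i gen \<Rightarrow> 'i falg" where
  "antipode_gen (GE i) = - (fgen (GKinv i) * fgen (GE i))"
| "antipode_gen (GF i) = - (fgen (GF i) * fgen (GLinv i))"
| "antipode_gen (GK i) = fgen (GKinv i)"
| "antipode_gen (GKinv i) = fgen (GK i)"
| "antipode_gen (GL i) = fgen (GLinv i)"
| "antipode_gen (GLinv i) = fgen (GL i)"

primrec antipode_word :: "'i gen list \<Rightarrow> 'i falg" where
  "antipode_word [] = 1"
| "antipode_word (g # w) = antipode_word w * antipode_gen g"

definition antipode_free :: "'i falg \<Rightarrow> 'i falg" where
  "antipode_free x = (\<Sum>w\<in>Poly_Mapping.keys x. fscalar (Poly_Mapping.lookup x w) * antipode_word w)"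

definition antipode :: "'i qdatum \<Rightarrow> kfield \<Rightarrow> 'i falg set \<Rightarrow> 'i falg set" where
  "antipode C s u = qcoset C s (antipode_free (qrep u))"


section \<open>Weight modules\<close>

text \<open>
  A module lives on a subspace \<open>vcar\<close> of an ambient vector space; this is needed so that a dual
  space, which is only part of a function type, can be treated on a par with the module itself.
  \<open>act M u\<close> matters for \<open>u\<close> in the carrier of the algebra only, and \<open>wts M \<nu>\<close> for \<open>\<nu> \<in> L\<close> only.
\<close>

record ('i, 'm) wmod =
  vcar :: "'m set"
  scl :: "kfield \<Rightarrow> 'm \<Rightarrow> 'm"
  act :: "'i falg set \<Rightarrow> 'm \<Rightarrow> 'm"
  wts :: "('i \<Rightarrow> rat) \<Rightarrow> 'm set"

definition qmodule :: "'i qdatum \<Rightarrow> kfield \<Rightarrow> ('i, 'm::ab_group_add) wmod \<Rightarrow> bool" where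
  "qmodule C s M \<longleftrightarrow>
     vector_space (scl M) \<and> module.subspace (scl M) (vcar M) \<and>
     (\<forall>u\<in>carrier (qalg C s). \<forall>m\<in>vcar M. act M u m \<in> vcar M) \<and>
     (\<forall>u\<in>carrier (qalg C s). \<forall>m\<in>vcar M. \<forall>n\<in>vcar M. act M u (m + n) = act M u m + act M u n) \<and>
     (\<forall>u\<in>carrier (qalg C s). \<forall>w\<in>carrier (qalg C s). \<forall>m\<in>vcar M.
        act M (u \<oplus>\<^bsub>qalg C s\<^esub> w) m = act M u m + act M w m \<and>
        act M (u \<otimes>\<^bsub>qalg C s\<^esub> w) m = act M u (act M w m)) \<and>
     (\<forall>c. \<forall>m\<in>vcar M. act M (qscalar C s c) m = scl M c m)"

definition weight_decomp ::
    "'i qdatum \<Rightarrow> ('i, 'm::ab_group_add) wmod \<Rightarrow> 'm \<Rightarrow> (('i \<Rightarrow> rat) \<Rightarrow> 'm) \<Rightarrow> bool" where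
  "weight_decomp C M m c \<longleftrightarrow>
     (\<forall>\<nu>\<in>Lat C. c \<nu> \<in> wts M \<nu>) \<and> (\<forall>\<nu>. \<nu> \<notin> Lat C \<longrightarrow> c \<nu> = 0) \<and>
     finite {\<nu>. c \<nu> \<noteq> 0} \<and> m = (\<Sum>\<nu> | c \<nu> \<noteq> 0. c \<nu>)"

definition weight_graded :: "'i qdatum \<Rightarrow> ('i, 'm::ab_group_add) wmod \<Rightarrow> bool" where
  "weight_graded C M \<longleftrightarrow>
     (\<forall>\<nu>\<in>Lat C. module.subspace (scl M) (wts M \<nu>) \<and> wts M \<nu> \<subseteq> vcar M) \<and>
     (\<forall>m\<in>vcar M. \<exists>!c. weight_decomp C M m c)"

definition weight_module :: "('i::finite) qdatum \<Rightarrow> kfield \<Rightarrow> ('i, 'm::ab_group_add) wmod \<Rightarrow> bool" where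
  "weight_module C s M \<longleftrightarrow>
     qmodule C s M \<and>
     (\<exists>B. finite B \<and> B \<subseteq> vcar M \<and> module.span (scl M) B = vcar M) \<and>
     weight_graded C M \<and>
     (\<forall>\<nu>\<in>Lat C. \<forall>m\<in>wts M \<nu>. \<forall>i.
        act M (qgen C s (GE i)) m \<in> wts M (\<nu> + simple_root i) \<and>
        act M (qgen C s (GF i)) m \<in> wts M (\<nu> - simple_root i) \<and>
        act M (qgen C s (GK i)) m =
          scl M (vpow C (dotp C (simple_root i) \<nu>) *
                 tpow C s (pairing C \<nu> (simple_root i) - pairing C (simple_root i) \<nu>)) m \<and>
        act M (qgen C s (GL i)) m =
          scl M (vpow C (- dotp C (simple_root i) \<nu>) *
                 tpow C s (pairing C \<nu> (simple_root i) - pairing C (simple_root i) \<nu>)) m)"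

definition wcomp :: "'i qdatum \<Rightarrow> ('i, 'm::ab_group_add) wmod \<Rightarrow> ('i \<Rightarrow> rat) \<Rightarrow> 'm \<Rightarrow> 'm" where
  "wcomp C M \<nu> m = (THE c. weight_decomp C M m c) \<nu>"

definition wsupp :: "'i qdatum \<Rightarrow> ('i, 'm::ab_group_add) wmod \<Rightarrow> 'm \<Rightarrow> ('i \<Rightarrow> rat) set" where
  "wsupp C M m = {\<nu>. wcomp C M \<nu> m \<noteq> 0}"

text \<open>The linear map acting on each weight space \<open>M\<^sub>\<nu>\<close> as the scalar \<open>f \<nu>\<close>.\<close>

definition wscale ::
    "'i qdatum \<Rightarrow> ('i, 'm::ab_group_add) wmod \<Rightarrow> (('i \<Rightarrow> rat) \<Rightarrow> kfield) \<Rightarrow> 'm \<Rightarrow> 'm" where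
  "wscale C M f m = (\<Sum>\<nu>\<in>wsupp C M m. scl M (f \<nu>) (wcomp C M \<nu> m))"

text \<open>Linear forms on \<open>vcar M\<close> are extended by zero to the ambient type.\<close>

definition dual_space :: "('i, 'm::ab_group_add) wmod \<Rightarrow> ('m \<Rightarrow> kfield) set" where
  "dual_space M = {\<phi>.
     (\<forall>m\<in>vcar M. \<forall>n\<in>vcar M. \<phi> (m + n) = \<phi> m + \<phi> n) \<and>
     (\<forall>c. \<forall>m\<in>vcar M. \<phi> (scl M c m) = c * \<phi> m) \<and>
     (\<forall>m. m \<notin> vcar M \<longrightarrow> \<phi> m = 0)}"

definition dual :: "'i qdatum \<Rightarrow> kfield \<Rightarrow> ('i, 'm::ab_group_add) wmod \<Rightarrow> ('i, 'm \<Rightarrow> kfield) wmod" where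
  "dual C s M = \<lparr>
     vcar = dual_space M,
     scl = (\<lambda>c \<phi> m. c * \<phi> m),
     act = (\<lambda>u \<phi> m. if m \<in> vcar M then \<phi> (act M (antipode C s u) m) else 0),
     wts = (\<lambda>\<kappa>. {\<phi> \<in> dual_space M. \<forall>\<mu>\<in>Lat C. \<mu> \<noteq> - \<kappa> \<longrightarrow> (\<forall>m\<in>wts M \<mu>. \<phi> m = 0)})\<rparr>"


section \<open>Transport\<close>

primrec transport_gen ::
    "('i::finite) qdatum \<Rightarrow> ('i, 'm::ab_group_add) wmod \<Rightarrow> 'i gen \<Rightarrow> 'm \<Rightarrow> 'm" where
  "transport_gen C M (GE i) =
     (\<lambda>m. act M (qgen C 1 (GE i))
       (wscale C M (\<lambda>\<nu>. tpow C troot (pairing C \<nu> (simple_root i))) m))"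
| "transport_gen C M (GF i) =
     (\<lambda>m. act M (qgen C 1 (GF i))
       (wscale C M (\<lambda>\<nu>. tpow C troot (of_int (Om C i i) - pairing C (simple_root i) \<nu>)) m))"
| "transport_gen C M (GK i) =
     wscale C M (\<lambda>\<nu>. vpow C (dotp C (simple_root i) \<nu>) *
       tpow C troot (pairing C \<nu> (simple_root i) - pairing C (simple_root i) \<nu>))"
| "transport_gen C M (GKinv i) =
     wscale C M (\<lambda>\<nu>. inverse (vpow C (dotp C (simple_root i) \<nu>) *
       tpow C troot (pairing C \<nu> (simple_root i) - pairing C (simple_root i) \<nu>)))"
| "transport_gen C M (GL i) =
     wscale C M (\<lambda>\<nu>. vpow C (- dotp C (simple_root i) \<nu>) *
       tpow C troot (pairing C \<nu> (simple_root i) - pairing C (simple_root i) \<nu>))"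
| "transport_gen C M (GLinv i) =
     wscale C M (\<lambda>\<nu>. inverse (vpow C (- dotp C (simple_root i) \<nu>) *
       tpow C troot (pairing C \<nu> (simple_root i) - pairing C (simple_root i) \<nu>)))"

primrec word_action :: "('i gen \<Rightarrow> 'm \<Rightarrow> 'm) \<Rightarrow> 'i gen list \<Rightarrow> 'm \<Rightarrow> 'm" where
  "word_action \<rho> [] m = m"
| "word_action \<rho> (g # w) m = \<rho> g (word_action \<rho> w m)"

definition free_action ::
    "(kfield \<Rightarrow> 'm \<Rightarrow> 'm) \<Rightarrow> ('i gen \<Rightarrow> 'm \<Rightarrow> 'm) \<Rightarrow> 'i falg \<Rightarrow> 'm \<Rightarrow> 'm::ab_group_add" where
  "free_action sc \<rho> x m =
     (\<Sum>w\<in>Poly_Mapping.keys x. sc (Poly_Mapping.lookup x w) (word_action \<rho> w m))"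

definition transport :: "('i::finite) qdatum \<Rightarrow> ('i, 'm::ab_group_add) wmod \<Rightarrow> ('i, 'm) wmod" where
  "transport C M = M\<lparr>act := (\<lambda>u. free_action (scl M) (transport_gen C M) (qrep u))\<rparr>"


section \<open>Tensor products\<close>

text \<open>
  The tensor product of two vector spaces is realised inside the linear forms on the space of
  bilinear forms: \<open>m \<otimes> n\<close> is evaluation \<open>B \<mapsto> B m n\<close>, and \<open>M \<otimes> N\<close> is the span of these
  (for finite-dimensional spaces, all linear forms on the space of bilinear forms).  The linear
  form on \<open>M \<otimes> N\<close> induced by a bilinear form \<open>B\<close> is thus \<open>z \<mapsto> z B\<close>; the universal property for
  arbitrary bilinear maps is \<open>tensor_universal\<close> below.  As in
  \<^term>\<open>dual_space\<close>, values outside the domain, here at functions that are not bilinear, are \<open>0\<close>.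
  Only the underlying vector spaces of tensor products of modules are needed.
\<close>

type_synonym ('m, 'n) tens = "('m \<Rightarrow> 'n \<Rightarrow> kfield) \<Rightarrow> kfield"

definition bilinear_form ::
    "('i, 'm::ab_group_add) wmod \<Rightarrow> ('i, 'n::ab_group_add) wmod \<Rightarrow> ('m \<Rightarrow> 'n \<Rightarrow> kfield) \<Rightarrow> bool" where
  "bilinear_form M N B \<longleftrightarrow>
     (\<forall>m\<in>vcar M. \<forall>m'\<in>vcar M. \<forall>n\<in>vcar N. B (m + m') n = B m n + B m' n) \<and>
     (\<forall>m\<in>vcar M. \<forall>n\<in>vcar N. \<forall>n'\<in>vcar N. B m (n + n') = B m n + B m n') \<and>
     (\<forall>c. \<forall>m\<in>vcar M. \<forall>n\<in>vcar N. B (scl M c m) n = c * B m n \<and> B m (scl N c n) = c * B m n)"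

definition tscale :: "kfield \<Rightarrow> ('m, 'n) tens \<Rightarrow> ('m, 'n) tens" where
  "tscale c z = (\<lambda>B. c * z B)"

definition pure_tensor ::
    "('i, 'm::ab_group_add) wmod \<Rightarrow> ('i, 'n::ab_group_add) wmod \<Rightarrow> 'm \<Rightarrow> 'n \<Rightarrow> ('m, 'n) tens" where
  "pure_tensor M N m n = (\<lambda>B. if bilinear_form M N B then B m n else 0)"

definition tensor_space ::
    "('i, 'm::ab_group_add) wmod \<Rightarrow> ('i, 'n::ab_group_add) wmod \<Rightarrow> ('m, 'n) tens set" where
  "tensor_space M N =
     module.span tscale {pure_tensor M N m n | m n. m \<in> vcar M \<and> n \<in> vcar N}"

text \<open>\<open>f \<otimes> g\<close>, for linear maps \<open>f\<close>, \<open>g\<close> into \<open>M\<close>, \<open>N\<close>.\<close>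

definition tensor_map ::
    "('i, 'm::ab_group_add) wmod \<Rightarrow> ('i, 'n::ab_group_add) wmod \<Rightarrow>
     ('a \<Rightarrow> 'm) \<Rightarrow> ('b \<Rightarrow> 'n) \<Rightarrow> ('a, 'b) tens \<Rightarrow> ('m, 'n) tens" where
  "tensor_map M N f g z = (\<lambda>B. if bilinear_form M N B then z (\<lambda>m n. B (f m) (g n)) else 0)"

text \<open>\<open>J\<close> is given by its values on pure tensors of weight vectors, see \<open>tensor_J_homogeneous\<close> below.\<close>

definition tensor_J ::
    "('i::finite) qdatum \<Rightarrow> ('i, 'm::ab_group_add) wmod \<Rightarrow> ('i, 'n::ab_group_add) wmod \<Rightarrow>
     ('m, 'n) tens \<Rightarrow> ('m, 'n) tens" where
  "tensor_J C M N z = (\<lambda>B. if bilinear_form M N B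
     then z (\<lambda>m n. \<Sum>\<nu>\<in>wsupp C M m. \<Sum>\<mu>\<in>wsupp C N n.
       tpow C troot (pairing C \<mu> \<nu>) * B (wcomp C M \<nu> m) (wcomp C N \<mu> n))
     else 0)"

definition tensor_J_inv ::
    "('i::finite) qdatum \<Rightarrow> ('i, 'm::ab_group_add) wmod \<Rightarrow> ('i, 'n::ab_group_add) wmod \<Rightarrow>
     ('m, 'n) tens \<Rightarrow> ('m, 'n) tens" where
  "tensor_J_inv C M N = inv_into (tensor_space (transport C M) (transport C N)) (tensor_J C M N)"


section \<open>Evaluations and coevaluations\<close>

definition ev :: "('m \<Rightarrow> kfield, 'm) tens \<Rightarrow> kfield" where
  "ev z = z (\<lambda>\<phi> m. \<phi> m)"

definition qtr :: "('i::finite) qdatum \<Rightarrow> ('i, 'm::ab_group_add) wmod \<Rightarrow>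
    ('m, 'm \<Rightarrow> kfield) tens \<Rightarrow> kfield" where
  "qtr C M z = z (\<lambda>m \<phi>. \<Sum>\<nu>\<in>wsupp C M m. (v_wt C (- \<nu>))\<^sup>2 * \<phi> (wcomp C M \<nu> m))"

definition weight_basis :: "'i qdatum \<Rightarrow> ('i, 'm::ab_group_add) wmod \<Rightarrow> 'm set \<Rightarrow> bool" where
  "weight_basis C M \<E> \<longleftrightarrow>
     \<not> module.dependent (scl M) \<E> \<and> module.span (scl M) \<E> = vcar M \<and>
     (\<forall>b\<in>\<E>. \<exists>\<nu>\<in>Lat C. b \<in> wts M \<nu>)"

definition basis_wt :: "'i qdatum \<Rightarrow> ('i, 'm::ab_group_add) wmod \<Rightarrow> 'm \<Rightarrow> 'i \<Rightarrow> rat" where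
  "basis_wt C M b = (THE \<nu>. \<nu> \<in> Lat C \<and> b \<in> wts M \<nu>)"

definition dual_basis :: "('i, 'm::ab_group_add) wmod \<Rightarrow> 'm set \<Rightarrow> 'm \<Rightarrow> 'm \<Rightarrow> kfield" where
  "dual_basis M \<E> b = (\<lambda>m. module.representation (scl M) \<E> m b)"

definition coev :: "('i::finite) qdatum \<Rightarrow> kfield \<Rightarrow> ('i, 'm::ab_group_add) wmod \<Rightarrow> 'm set \<Rightarrow>
    kfield \<Rightarrow> ('m \<Rightarrow> kfield, 'm) tens" where
  "coev C s M \<E> c = tscale c (\<Sum>b\<in>\<E>. tscale ((v_wt C (basis_wt C M b))\<^sup>2)
     (pure_tensor (dual C s M) M (dual_basis M \<E> b) b))"

definition coqtr :: "'i qdatum \<Rightarrow> kfield \<Rightarrow> ('i, 'm::ab_group_add) wmod \<Rightarrow> 'm set \<Rightarrow>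
    kfield \<Rightarrow> ('m, 'm \<Rightarrow> kfield) tens" where
  "coqtr C s M \<E> c = tscale c (\<Sum>b\<in>\<E>. pure_tensor M (dual C s M) b (dual_basis M \<E> b))"


section \<open>Module isomorphisms and the duality comparison\<close>

definition qmodule_iso :: "'i qdatum \<Rightarrow> kfield \<Rightarrow> ('i, 'm::ab_group_add) wmod \<Rightarrow>
    ('i, 'n::ab_group_add) wmod \<Rightarrow> ('m \<Rightarrow> 'n) \<Rightarrow> bool" where
  "qmodule_iso C s M N f \<longleftrightarrow>
     qmodule C s M \<and> qmodule C s N \<and> bij_betw f (vcar M) (vcar N) \<and>
     (\<forall>m\<in>vcar M. \<forall>n\<in>vcar M. f (m + n) = f m + f n) \<and>
     (\<forall>c. \<forall>m\<in>vcar M. f (scl M c m) = scl N c (f m)) \<and>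
     (\<forall>u\<in>carrier (qalg C s). \<forall>m\<in>vcar M. f (act M u m) = act N u (f m))"

text \<open>On the weight space of weight \<open>\<kappa> = - \<nu>\<close> of the dual, the factor is \<open>t\<close> to the power \<open>- \<langle>\<nu>, \<nu>\<rangle>\<close>.\<close>

definition D_map :: "('i::finite) qdatum \<Rightarrow> ('i, 'm::ab_group_add) wmod \<Rightarrow>
    ('m \<Rightarrow> kfield) \<Rightarrow> 'm \<Rightarrow> kfield" where
  "D_map C M = wscale C (dual C 1 M) (\<lambda>\<kappa>. tpow C troot (- pairing C (- \<kappa>) (- \<kappa>)))"


section \<open>Values on weight vectors and pure tensors\<close>

lemma weight_decomp_homogeneous:
  assumes "vector_space (scl M)" and "weight_graded C M" and "\<nu> \<in> Lat C" and "m \<in> wts M \<nu>"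
  shows "weight_decomp C M m (\<lambda>\<mu>. if \<mu> = \<nu> then m else 0)"
proof -
  interpret vector_space "scl M" by fact
  have z: "0 \<in> wts M \<mu>" if "\<mu> \<in> Lat C" for \<mu>
    using assms(2) that subspace_0 unfolding weight_graded_def by blast
  have e: "{\<mu>. (if \<mu> = \<nu> then m else 0) \<noteq> 0} = (if m = 0 then {} else {\<nu>})" by auto
  show ?thesis unfolding weight_decomp_def e using assms(3,4) z by auto
qed

lemma wcomp_homogeneous:
  assumes "vector_space (scl M)" and "weight_graded C M" and "\<nu> \<in> Lat C" and "m \<in> wts M \<nu>"
  shows "wcomp C M \<mu> m = (if \<mu> = \<nu> then m else 0)"
proof -
  have "m \<in> vcar M" using assms(2-4) unfolding weight_graded_def by blast
  then have ex: "\<exists>!c. weight_decomp C M m c" using assms(2) unfolding weight_graded_def by blast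
  have "(THE c. weight_decomp C M m c) = (\<lambda>\<mu>. if \<mu> = \<nu> then m else 0)"
    by (rule the1_equality[OF ex]) (rule weight_decomp_homogeneous[OF assms])
  then show ?thesis unfolding wcomp_def by simp
qed

lemma wsupp_homogeneous:
  assumes "vector_space (scl M)" and "weight_graded C M" and "\<nu> \<in> Lat C" and "m \<in> wts M \<nu>"
  shows "wsupp C M m = (if m = 0 then {} else {\<nu>})"
  unfolding wsupp_def wcomp_homogeneous[OF assms] by auto

lemma wscale_homogeneous:
  assumes "vector_space (scl M)" and "weight_graded C M" and "\<nu> \<in> Lat C" and "m \<in> wts M \<nu>"
  shows "wscale C M f m = scl M (f \<nu>) m"
proof -
  interpret vector_space "scl M" by fact
  show ?thesis
    unfolding wscale_def wsupp_homogeneous[OF assms] wcomp_homogeneous[OF assms] by simp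
qed

lemma D_map_homogeneous:
  assumes "weight_graded C (dual C 1 M)" and "- \<nu> \<in> Lat C" and "\<phi> \<in> wts (dual C 1 M) (- \<nu>)"
  shows "D_map C M \<phi> = (\<lambda>m. tpow C troot (- pairing C \<nu> \<nu>) * \<phi> m)"
proof -
  have v: "vector_space (scl (dual C 1 M))"
    by unfold_locales (auto simp: dual_def fun_eq_iff algebra_simps)
  show ?thesis
    unfolding D_map_def wscale_homogeneous[OF v assms] by (simp add: dual_def)
qed

lemma vector_space_tscale: "vector_space tscale"
  by unfold_locales (auto simp: tscale_def fun_eq_iff algebra_simps)

lemma pure_tensor_bilinear:
  "m \<in> vcar M \<Longrightarrow> m' \<in> vcar M \<Longrightarrow> n \<in> vcar N \<Longrightarrow>
    pure_tensor M N (m + m') n = pure_tensor M N m n + pure_tensor M N m' n"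
  "m \<in> vcar M \<Longrightarrow> n \<in> vcar N \<Longrightarrow> n' \<in> vcar N \<Longrightarrow>
    pure_tensor M N m (n + n') = pure_tensor M N m n + pure_tensor M N m n'"
  "m \<in> vcar M \<Longrightarrow> n \<in> vcar N \<Longrightarrow>
    pure_tensor M N (scl M c m) n = tscale c (pure_tensor M N m n)"
  "m \<in> vcar M \<Longrightarrow> n \<in> vcar N \<Longrightarrow>
    pure_tensor M N m (scl N c n) = tscale c (pure_tensor M N m n)"
  by (auto simp: pure_tensor_def bilinear_form_def tscale_def fun_eq_iff)

lemma tensor_universal:
  fixes sc :: "kfield \<Rightarrow> 'x \<Rightarrow> 'x::ab_group_add"
  assumes "vector_space sc"
    and add1: "\<And>m m' n. m \<in> vcar M \<Longrightarrow> m' \<in> vcar M \<Longrightarrow> n \<in> vcar N \<Longrightarrow> \<beta> (m + m') n = \<beta> m n + \<beta> m' n"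
    and add2: "\<And>m n n'. m \<in> vcar M \<Longrightarrow> n \<in> vcar N \<Longrightarrow> n' \<in> vcar N \<Longrightarrow> \<beta> m (n + n') = \<beta> m n + \<beta> m n'"
    and sc1: "\<And>c m n. m \<in> vcar M \<Longrightarrow> n \<in> vcar N \<Longrightarrow> \<beta> (scl M c m) n = sc c (\<beta> m n)"
    and sc2: "\<And>c m n. m \<in> vcar M \<Longrightarrow> n \<in> vcar N \<Longrightarrow> \<beta> m (scl N c n) = sc c (\<beta> m n)"
  shows "\<exists>g. (\<forall>z\<in>tensor_space M N. \<forall>z'\<in>tensor_space M N. g (z + z') = g z + g z') \<and>
    (\<forall>c. \<forall>z\<in>tensor_space M N. g (tscale c z) = sc c (g z)) \<and>
    (\<forall>m\<in>vcar M. \<forall>n\<in>vcar N. g (pure_tensor M N m n) = \<beta> m n)"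
proof -
  interpret X: vector_space sc by fact
  interpret T: vector_space "tscale :: kfield \<Rightarrow> ('a,'b) tens \<Rightarrow> _" by (rule vector_space_tscale)
  interpret K: vector_space "(*) :: kfield \<Rightarrow> kfield \<Rightarrow> kfield"
    by unfold_locales (auto simp: algebra_simps)
  interpret XK: vector_space_pair sc "(*) :: kfield \<Rightarrow> kfield \<Rightarrow> kfield" ..
  let ?L = "\<lambda>l. Vector_Spaces.linear sc ((*) :: kfield \<Rightarrow> kfield \<Rightarrow> kfield) l"
  let ?P = "\<lambda>z x. \<forall>l. ?L l \<longrightarrow> z (\<lambda>m n. l (\<beta> m n)) = l x"
  have sep: "x = y" if h: "\<And>l. ?L l \<Longrightarrow> l x = l y" for x y
  proof (rule ccontr)
    assume "x \<noteq> y"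
    then have "X.independent {x - y}" by simp
    from XK.linear_independent_extend[OF this, of "\<lambda>_. 1"]
    obtain l where l: "?L l" "l (x - y) = 1" by auto
    then have "l x - l y = 1" by (simp add: XK.linear_diff)
    with h[OF l(1)] show False by simp
  qed
  have bil: "bilinear_form M N (\<lambda>m n. l (\<beta> m n))" if "?L l" for l
    using that unfolding bilinear_form_def
    by (auto simp: add1 add2 sc1 sc2 XK.linear_add XK.linear_scale)
  have pure: "?P (pure_tensor M N m n) (\<beta> m n)" for m n
    using bil by (simp add: pure_tensor_def)
  have plus: "?P (z + z') (x + x')" if "?P z x" "?P z' x'" for z z' x x'
    using that by (auto simp: XK.linear_add)
  have scale: "?P (tscale c z) (sc c x)" if "?P z x" for c z x
    using that by (auto simp: XK.linear_scale tscale_def)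
  have ex: "\<exists>x. ?P z x" if "z \<in> tensor_space M N" for z
    using that unfolding tensor_space_def
  proof (induction rule: T.span_induct_alt)
    case base
    show ?case by (rule exI[of _ 0]) (auto simp: XK.linear_0)
  next
    case (step c x y)
    then show ?case using plus[OF scale[OF pure]] by blast
  qed
  define g where "g z = (THE x. ?P z x)" for z
  have g: "g z = x" if "?P z x" for z x
    unfolding g_def using that by (intro the_equality) (auto intro: sep)
  have gP: "?P z (g z)" if "z \<in> tensor_space M N" for z
    using ex[OF that] g by blast
  show ?thesis
  proof (intro exI[of _ g] conjI ballI allI)
    fix z z' assume "z \<in> tensor_space M N" "z' \<in> tensor_space M N"
    then show "g (z + z') = g z + g z'" by (intro g plus gP)
  next
    fix c z assume "z \<in> tensor_space M N"
    then show "g (tscale c z) = sc c (g z)" by (intro g scale gP)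
  next
    fix m n show "g (pure_tensor M N m n) = \<beta> m n" by (intro g pure)
  qed
qed

lemma tensor_map_pure:
  assumes "\<And>m m'. m \<in> vcar M \<Longrightarrow> m' \<in> vcar M \<Longrightarrow> f m \<in> vcar M' \<and> f (m + m') = f m + f m'"
    and "\<And>c m. m \<in> vcar M \<Longrightarrow> f (scl M c m) = scl M' c (f m)"
    and "\<And>n n'. n \<in> vcar N \<Longrightarrow> n' \<in> vcar N \<Longrightarrow> g n \<in> vcar N' \<and> g (n + n') = g n + g n'"
    and "\<And>c n. n \<in> vcar N \<Longrightarrow> g (scl N c n) = scl N' c (g n)"
  shows "tensor_map M' N' f g (pure_tensor M N m n) = pure_tensor M' N' (f m) (g n)"
  unfolding tensor_map_def pure_tensor_def fun_eq_iff using assms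
  by (auto simp: bilinear_form_def)

lemma ev_pure:
  assumes "\<phi> \<in> dual_space M"
  shows "ev (pure_tensor (dual C s M) M \<phi> m) = \<phi> m"
proof -
  have "bilinear_form (dual C s M) M (\<lambda>\<phi> m. \<phi> m)"
    by (auto simp: bilinear_form_def dual_def dual_space_def)
  then show ?thesis by (simp add: ev_def pure_tensor_def)
qed


lemma weight_decomp_wcomp:
  assumes "weight_graded C M" and "m \<in> vcar M"
  shows "weight_decomp C M m (\<lambda>\<mu>. wcomp C M \<mu> m)"
proof -
  have "\<exists>!c. weight_decomp C M m c" using assms unfolding weight_graded_def by blast
  then show ?thesis unfolding wcomp_def by (rule theI')
qed

lemma wcomp_unique:
  assumes "weight_graded C M" and "m \<in> vcar M" and "weight_decomp C M m c"
  shows "wcomp C M \<mu> m = c \<mu>"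
  using assms weight_decomp_wcomp[OF assms(1,2)] unfolding weight_graded_def by metis

lemma finite_wsupp:
  "weight_graded C M \<Longrightarrow> m \<in> vcar M \<Longrightarrow> finite (wsupp C M m)"
  using weight_decomp_wcomp unfolding weight_decomp_def wsupp_def by blast

lemma wcomp_in_vcar:
  assumes "vector_space (scl M)" "module.subspace (scl M) (vcar M)" "weight_graded C M" and "m \<in> vcar M"
  shows "wcomp C M \<mu> m \<in> vcar M"
proof -
  interpret vector_space "scl M" by fact
  show ?thesis
    using weight_decomp_wcomp[OF assms(3,4)] assms(3) subspace_0[OF assms(2)]
    unfolding weight_decomp_def weight_graded_def by (cases "\<mu> \<in> Lat C") auto
qed

lemma wcomp_linear:
  assumes "vector_space (scl M)" "module.subspace (scl M) (vcar M)" "weight_graded C M"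
  shows "m \<in> vcar M \<Longrightarrow> n \<in> vcar M \<Longrightarrow> wcomp C M \<mu> (m + n) = wcomp C M \<mu> m + wcomp C M \<mu> n"
    and "m \<in> vcar M \<Longrightarrow> wcomp C M \<mu> (scl M c m) = scl M c (wcomp C M \<mu> m)"
proof -
  interpret vector_space "scl M" by fact
  have sub: "subspace (wts M \<nu>)" if "\<nu> \<in> Lat C" for \<nu>
    using assms(3) that unfolding weight_graded_def by blast
  { assume m: "m \<in> vcar M" and n: "n \<in> vcar M"
    let ?a = "\<lambda>\<nu>. wcomp C M \<nu> m" let ?b = "\<lambda>\<nu>. wcomp C M \<nu> n"
    note da = weight_decomp_wcomp[OF assms(3) m, unfolded weight_decomp_def]
    note db = weight_decomp_wcomp[OF assms(3) n, unfolded weight_decomp_def]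
    let ?S = "{\<nu>. ?a \<nu> \<noteq> 0} \<union> {\<nu>. ?b \<nu> \<noteq> 0}"
    have fin: "finite ?S" using da db by blast
    have "m = sum ?a ?S" by (rule trans[OF conjunct2[OF conjunct2[OF conjunct2[OF da]]] sum.mono_neutral_left[OF fin]]) auto
    moreover have "n = sum ?b ?S" by (rule trans[OF conjunct2[OF conjunct2[OF conjunct2[OF db]]] sum.mono_neutral_left[OF fin]]) auto
    ultimately have "m + n = (\<Sum>\<nu>\<in>?S. ?a \<nu> + ?b \<nu>)" by (simp only: sum.distrib)
    also have "\<dots> = (\<Sum>\<nu> | ?a \<nu> + ?b \<nu> \<noteq> 0. ?a \<nu> + ?b \<nu>)"
      by (rule sum.mono_neutral_right[OF fin]) auto
    finally have "m + n = \<dots>" .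
    moreover have "finite {\<nu>. ?a \<nu> + ?b \<nu> \<noteq> 0}" by (rule finite_subset[OF _ fin]) auto
    ultimately have "weight_decomp C M (m + n) (\<lambda>\<nu>. ?a \<nu> + ?b \<nu>)"
      using da db subspace_add[OF sub] unfolding weight_decomp_def by (intro conjI) simp_all
    then show "wcomp C M \<mu> (m + n) = wcomp C M \<mu> m + wcomp C M \<mu> n"
      by (rule wcomp_unique[OF assms(3) subspace_add[OF assms(2) m n]]) }
  { assume m: "m \<in> vcar M"
    let ?a = "\<lambda>\<nu>. wcomp C M \<nu> m"
    note da = weight_decomp_wcomp[OF assms(3) m, unfolded weight_decomp_def]
    have fin: "finite {\<nu>. ?a \<nu> \<noteq> 0}" using da by blast
    have "scl M c m = (\<Sum>\<nu> | ?a \<nu> \<noteq> 0. scl M c (?a \<nu>))"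
      by (rule trans[OF arg_cong[where f = "scl M c", OF conjunct2[OF conjunct2[OF conjunct2[OF da]]]] scale_sum_right])
    also have "\<dots> = (\<Sum>\<nu> | scl M c (?a \<nu>) \<noteq> 0. scl M c (?a \<nu>))"
      by (rule sum.mono_neutral_right[OF fin]) auto
    finally have "scl M c m = \<dots>" .
    moreover have "finite {\<nu>. scl M c (?a \<nu>) \<noteq> 0}" by (rule finite_subset[OF _ fin]) auto
    ultimately have "weight_decomp C M (scl M c m) (\<lambda>\<nu>. scl M c (?a \<nu>))"
      using da subspace_scale[OF sub] unfolding weight_decomp_def by (intro conjI) simp_all
    then show "wcomp C M \<mu> (scl M c m) = scl M c (wcomp C M \<mu> m)"
      by (rule wcomp_unique[OF assms(3) subspace_scale[OF assms(2) m]]) }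
qed

lemma tensor_J_homogeneous:
  assumes "vector_space (scl M)" "module.subspace (scl M) (vcar M)" "weight_graded C M"
    and "vector_space (scl N)" "module.subspace (scl N) (vcar N)" "weight_graded C N"
    and "\<nu> \<in> Lat C" "m \<in> wts M \<nu>" "\<mu> \<in> Lat C" "n \<in> wts N \<mu>"
  shows "tensor_J C M N (pure_tensor M N m n) =
    tscale (tpow C troot (pairing C \<mu> \<nu>)) (pure_tensor M N m n)"
proof
  fix B
  note gM = assms(1-3) and gN = assms(4-6)
  interpret M: vector_space "scl M" by fact
  interpret N: vector_space "scl N" by fact
  define G where "G m n = (\<Sum>\<nu>\<in>wsupp C M m. \<Sum>\<mu>\<in>wsupp C N n.
      tpow C troot (pairing C \<mu> \<nu>) * B (wcomp C M \<nu> m) (wcomp C N \<mu> n))" for m n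
  show "tensor_J C M N (pure_tensor M N m n) B =
    tscale (tpow C troot (pairing C \<mu> \<nu>)) (pure_tensor M N m n) B"
  proof (cases "bilinear_form M N B")
    case B: True
    have z1: "B 0 y = 0" if "y \<in> vcar N" for y
    proof -
      have "B (scl M 0 0) y = 0 * B 0 y"
        using B that M.subspace_0[OF gM(2)] unfolding bilinear_form_def by blast
      then show ?thesis by simp
    qed
    have z2: "B x 0 = 0" if "x \<in> vcar M" for x
    proof -
      have "B x (scl N 0 0) = 0 * B x 0"
        using B that N.subspace_0[OF gN(2)] unfolding bilinear_form_def by blast
      then show ?thesis by simp
    qed
    note cM = wcomp_in_vcar[OF gM] and cN = wcomp_in_vcar[OF gN]
    have G: "G x y = (\<Sum>\<nu>\<in>S. \<Sum>\<mu>\<in>T.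
        tpow C troot (pairing C \<mu> \<nu>) * B (wcomp C M \<nu> x) (wcomp C N \<mu> y))"
      if "x \<in> vcar M" "y \<in> vcar N" "finite S" "finite T" "wsupp C M x \<subseteq> S" "wsupp C N y \<subseteq> T"
      for x y S T
    proof -
      have "G x y = (\<Sum>\<nu>\<in>S. \<Sum>\<mu>\<in>wsupp C N y.
          tpow C troot (pairing C \<mu> \<nu>) * B (wcomp C M \<nu> x) (wcomp C N \<mu> y))"
        unfolding G_def using that z1 cN
        by (intro sum.mono_neutral_left) (auto simp: wsupp_def intro!: sum.neutral)
      also have "\<dots> = (\<Sum>\<nu>\<in>S. \<Sum>\<mu>\<in>T.
          tpow C troot (pairing C \<mu> \<nu>) * B (wcomp C M \<nu> x) (wcomp C N \<mu> y))"
        using that z2 cM by (intro sum.cong refl sum.mono_neutral_left) (auto simp: wsupp_def)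
      finally show ?thesis .
    qed
    note fM = finite_wsupp[OF gM(3)] and fN = finite_wsupp[OF gN(3)]
    note addM = M.subspace_add[OF gM(2)] and addN = N.subspace_add[OF gN(2)]
    note scM = M.subspace_scale[OF gM(2)] and scN = N.subspace_scale[OF gN(2)]
    have "bilinear_form M N G"
      unfolding bilinear_form_def
    proof (intro conjI ballI allI)
      fix x x' y assume x: "x \<in> vcar M" and x': "x' \<in> vcar M" and y: "y \<in> vcar N"
      let ?S = "wsupp C M x \<union> wsupp C M x' \<union> wsupp C M (x + x')" and ?T = "wsupp C N y"
      have fin: "finite ?S" "finite ?T" using x x' y fM fN addM by auto
      show "G (x + x') y = G x y + G x' y"
        using B x x' y addM cM cN
        by (subst (1 2 3) G[OF _ y fin])
          (auto simp: wcomp_linear(1)[OF gM] bilinear_form_def distrib_left sum.distrib)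
    next
      fix x y y' assume x: "x \<in> vcar M" and y': "y' \<in> vcar N" and y: "y \<in> vcar N"
      let ?T = "wsupp C N y \<union> wsupp C N y' \<union> wsupp C N (y + y')" and ?S = "wsupp C M x"
      have fin: "finite ?S" "finite ?T" using x y' y fM fN addN by auto
      show "G x (y + y') = G x y + G x y'"
        using B x y' y addN cM cN
        by (subst (1 2 3) G[OF x _ fin])
          (auto simp: wcomp_linear(1)[OF gN] bilinear_form_def distrib_left sum.distrib)
    next
      fix c x y assume x: "x \<in> vcar M" and y: "y \<in> vcar N"
      let ?S = "wsupp C M x \<union> wsupp C M (scl M c x)" and ?T = "wsupp C N y"
      have fin: "finite ?S" "finite ?T" using x y fM fN scM by auto
      show "G (scl M c x) y = c * G x y"
        using B x y scM cM cN
        by (subst (1 2) G[OF _ y fin])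
          (auto simp: wcomp_linear(2)[OF gM] bilinear_form_def sum_distrib_left mult.left_commute)
    next
      fix c x y assume x: "x \<in> vcar M" and y: "y \<in> vcar N"
      let ?T = "wsupp C N y \<union> wsupp C N (scl N c y)" and ?S = "wsupp C M x"
      have fin: "finite ?S" "finite ?T" using x y fM fN scN by auto
      show "G x (scl N c y) = c * G x y"
        using B x y scN cM cN
        by (subst (1 2) G[OF x _ fin])
          (auto simp: wcomp_linear(2)[OF gN] bilinear_form_def sum_distrib_left mult.left_commute)
    qed
    moreover have "m \<in> vcar M" "n \<in> vcar N"
      using assms(3,6-10) unfolding weight_graded_def by blast+
    then have "G m n = tpow C troot (pairing C \<mu> \<nu>) * B m n"
      using z1 z2 unfolding G_def wsupp_homogeneous[OF gM(1,3) assms(7,8)]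
        wsupp_homogeneous[OF gN(1,3) assms(9,10)]
      by (simp add: wcomp_homogeneous[OF gM(1,3) assms(7,8)]
          wcomp_homogeneous[OF gN(1,3) assms(9,10)])
    ultimately show ?thesis
      using B by (simp add: tensor_J_def tscale_def pure_tensor_def G_def[abs_def])
  qed (simp add: tensor_J_def tscale_def pure_tensor_def)
qed

lemma qtr_homogeneous:
  assumes "vector_space (scl M)" "module.subspace (scl M) (vcar M)" "weight_graded C M"
    and "\<nu> \<in> Lat C" "m \<in> wts M \<nu>" "\<phi> \<in> dual_space M"
  shows "qtr C M (pure_tensor M (dual C s M) m \<phi>) = (v_wt C (- \<nu>))\<^sup>2 * \<phi> m"
proof -
  interpret M: vector_space "scl M" by fact
  define G where "G m \<phi> = (\<Sum>\<nu>\<in>wsupp C M m. (v_wt C (- \<nu>))\<^sup>2 * \<phi> (wcomp C M \<nu> m))"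
    for m and \<phi> :: "_ \<Rightarrow> kfield"
  note c = wcomp_in_vcar[OF assms(1-3)] and f = finite_wsupp[OF assms(3)]
  have z: "\<psi> 0 = 0" if "\<psi> \<in> dual_space M" for \<psi>
  proof -
    have "\<psi> (scl M 0 0) = 0 * \<psi> 0"
      using that M.subspace_0[OF assms(2)] unfolding dual_space_def by blast
    then show ?thesis by simp
  qed
  have G: "G x \<psi> = (\<Sum>\<nu>\<in>S. (v_wt C (- \<nu>))\<^sup>2 * \<psi> (wcomp C M \<nu> x))"
    if "\<psi> \<in> dual_space M" "finite S" "wsupp C M x \<subseteq> S" for x \<psi> S
    unfolding G_def using that z by (intro sum.mono_neutral_left) (auto simp: wsupp_def)
  have "bilinear_form M (dual C s M) G"
    unfolding bilinear_form_def
  proof (intro conjI ballI allI)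
    fix x x' \<psi> assume x: "x \<in> vcar M" and x': "x' \<in> vcar M" and p: "\<psi> \<in> vcar (dual C s M)"
    let ?S = "wsupp C M x \<union> wsupp C M x' \<union> wsupp C M (x + x')"
    have p: "\<psi> \<in> dual_space M" using p by (simp add: dual_def)
    have fin: "finite ?S" using x x' f M.subspace_add[OF assms(2)] by auto
    show "G (x + x') \<psi> = G x \<psi> + G x' \<psi>"
      using p c x x' by (subst (1 2 3) G[OF p fin])
        (auto simp: wcomp_linear(1)[OF assms(1-3)] dual_space_def distrib_left sum.distrib)
  next
    fix d x \<psi> assume x: "x \<in> vcar M" and p: "\<psi> \<in> vcar (dual C s M)"
    let ?S = "wsupp C M x \<union> wsupp C M (scl M d x)"
    have p: "\<psi> \<in> dual_space M" using p by (simp add: dual_def)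
    have fin: "finite ?S" using x f M.subspace_scale[OF assms(2)] by auto
    show "G (scl M d x) \<psi> = d * G x \<psi>"
      using p c x by (subst (1 2) G[OF p fin])
        (auto simp: wcomp_linear(2)[OF assms(1-3)] dual_space_def sum_distrib_left mult.left_commute)
  qed (simp_all add: G_def dual_def distrib_left sum.distrib sum_distrib_left mult.left_commute)
  moreover have "G m \<phi> = (v_wt C (- \<nu>))\<^sup>2 * \<phi> m"
    using z[OF assms(6)] unfolding G_def wsupp_homogeneous[OF assms(1,3-5)]
    by (simp add: wcomp_homogeneous[OF assms(1,3-5)])
  ultimately show ?thesis by (simp add: qtr_def pure_tensor_def G_def[abs_def])
qed

end

theory Submission
  imports Defs
begin

text \<open>
  All the modules in the theorem live on the same few weight-graded spaces, and the algebra acts on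
  each of them through the operators attached to its generators.  The proof therefore works with
  \<^emph>\<open>weight representations\<close> (\<open>weight_rep\<close>): families of graded operators that satisfy the defining
  relations on weight vectors.  Such a family kills every relator, hence the ideal of relations, and
  so defines a module; conversely a weight module yields such a family.

  Two constructions on weight representations are needed.  The transport multiplies \<open>E\<^sub>i\<close> and
  \<open>F\<^sub>i\<close> on the weight space of \<open>\<lambda>\<close> by a power of \<open>t\<close> whose exponent is affine in \<open>\<lambda>\<close>
  (\<open>weight_rep_transport\<close>).  The dual is, at \<open>t = 1\<close>, given by the transposed operators multiplied by
  a power of \<open>v\<close> whose exponent is again affine in the weight (\<open>weight_rep_dual\<close>).  In both cases
  the only relation that takes work is the quantum Serre relation, and a single computation serves
  for both: rescaling multiplies the words \<open>E\<^sub>i\<^sup>p E\<^sub>j E\<^sub>i\<^sup>q\<close> with \<open>p + q\<close> fixed by a power whose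
  exponent, up to a constant, is linear in \<open>p\<close> (\<open>word_twist\<close>).  For the transport this linear part
  is cancelled by the one in the Serre coefficients, where the part of the exponent of \<open>\<kappa>\<close>
  quadratic in \<open>p\<close> is absorbed by the \<open>t\<close>-dependence of the quantum factorials (\<open>serre_coeff_twist\<close>);
  for the dual it vanishes by symmetry of the form, and the coefficients at \<open>t = 1\<close> are symmetric up to
  sign under the reversal of words caused by transposition.

  The map \<open>D\<^sub>M\<close> is invertible, being a nonzero scalar on each weight space, and it intertwines the two
  actions because it does so for the generators: on \<open>E\<^sub>i\<close>, applied to a form of weight \<open>\<kappa>\<close>
  and evaluated on a vector of weight \<open>\<lambda> = - \<kappa> - i\<close>, the claim is the identity
  \<open>\<langle>\<kappa>, i\<rangle> - \<langle>\<kappa> + i, \<kappa> + i\<rangle> = - \<langle>\<kappa>, \<kappa>\<rangle> - \<langle>\<lambda> + i, i\<rangle> + \<langle>i, \<lambda> + i\<rangle> + \<langle>\<lambda>, i\<rangle>\<close> of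
  exponents of \<open>t\<close>, and similarly for the other generators
  (\<open>D_map_intertwines_gen\<close>).  The relations of \<open>U\<^sub>v\<^sub>,\<^sub>t\<close> on the dual of the transport follow by
  carrying them over along \<open>D\<^sub>M\<close> from the transport of the dual (\<open>D_map_iso\<close>).

  For the four identities, \<open>J\<close> contributes \<open>t\<close> to the power \<open>- \<langle>\<lambda>, \<lambda>\<rangle>\<close> on the tensor product of the
  weight space of \<open>\<lambda>\<close> with that of \<open>- \<lambda>\<close> in the dual, in either order, which is exactly the scalar
  of \<open>D\<^sub>M\<close>.  Pairings vanish on the other pairs of weight spaces, and the
  coevaluation tensors, which are sums of such balanced terms, do not depend on the weight basis
  (\<open>contraction_basis_independent\<close>).
\<close>

section \<open>Linear maps on the carrier of a module\<close>

definition linear_on :: "('i, 'm::ab_group_add) wmod \<Rightarrow> (kfield \<Rightarrow> 'n \<Rightarrow> 'n::ab_group_add) \<Rightarrow> ('m \<Rightarrow> 'n) \<Rightarrow> bool" where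
  "linear_on M sc f \<longleftrightarrow>
     (\<forall>m\<in>vcar M. \<forall>n\<in>vcar M. f (m + n) = f m + f n) \<and> (\<forall>c. \<forall>m\<in>vcar M. f (scl M c m) = sc c (f m))"

definition lin_ops :: "('i, 'm::ab_group_add) wmod \<Rightarrow> ('m \<Rightarrow> 'm) set" where
  "lin_ops M = {f \<in> vcar M \<rightarrow> vcar M. linear_on M (scl M) f}"

lemma linear_on_add:
  "linear_on M sc f \<Longrightarrow> m \<in> vcar M \<Longrightarrow> n \<in> vcar M \<Longrightarrow> f (m + n) = f m + f n"
  by (simp add: linear_on_def)

lemma linear_on_scale: "linear_on M sc f \<Longrightarrow> m \<in> vcar M \<Longrightarrow> f (scl M c m) = sc c (f m)"
  by (simp add: linear_on_def)

locale carrier_space = vector_space "scl M"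
  for M :: "('i, 'm::ab_group_add) wmod" +
  assumes carrier: "subspace (vcar M)"
begin

lemmas carrier_0 [simp] = subspace_0[OF carrier]
  and carrier_add [simp] = subspace_add[OF carrier]
  and carrier_diff [simp] = subspace_diff[OF carrier]
  and carrier_neg [simp] = subspace_neg[OF carrier]
  and carrier_scale [simp] = subspace_scale[OF carrier]
  and carrier_sum = subspace_sum[OF carrier]

lemma linear_on_0: "linear_on M sc f \<Longrightarrow> f 0 = 0"
  using linear_on_add[of M sc f 0 0] by simp

lemma linear_on_sum:
  assumes "linear_on M sc f" "\<And>a. a \<in> A \<Longrightarrow> g a \<in> vcar M"
  shows "f (sum g A) = (\<Sum>a\<in>A. f (g a))"
  using assms(2)
  by (induction A rule: infinite_finite_induct)
    (auto simp: linear_on_0[OF assms(1)] linear_on_add[OF assms(1)] carrier_sum)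

lemma linear_on_neg: "linear_on M sc f \<Longrightarrow> m \<in> vcar M \<Longrightarrow> f (- m) = - f m"
  using linear_on_add[of M sc f m "- m"] linear_on_0[of sc f] by (simp add: eq_neg_iff_add_eq_0 add.commute)

lemma linear_on_diff: "linear_on M sc f \<Longrightarrow> m \<in> vcar M \<Longrightarrow> n \<in> vcar M \<Longrightarrow> f (m - n) = f m - f n"
  using linear_on_add[of M sc f m "- n"] linear_on_neg[of sc f n] by simp

end

lemma lin_opsD:
  "f \<in> lin_ops M \<Longrightarrow> m \<in> vcar M \<Longrightarrow> f m \<in> vcar M"
  "f \<in> lin_ops M \<Longrightarrow> linear_on M (scl M) f"
  by (auto simp: lin_ops_def)


section \<open>Modules over the presented algebra\<close>

interpretation fa: ring "free_algebra :: 'i falg ring"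
proof (rule ringI)
  show "abelian_group (free_algebra :: 'i falg ring)"
    by (rule abelian_groupI)
      (auto simp: free_algebra_def add.assoc add.commute intro: exI[of _ "- x" for x])
  show "Group.monoid (free_algebra :: 'i falg ring)"
    by (rule Group.monoidI) (auto simp: free_algebra_def mult.assoc)
qed (auto simp: free_algebra_def distrib_left distrib_right)

lemma free_algebra_simps [simp]:
  "carrier free_algebra = UNIV" "x \<otimes>\<^bsub>free_algebra\<^esub> y = x * y"
  "\<one>\<^bsub>free_algebra\<^esub> = 1" "\<zero>\<^bsub>free_algebra\<^esub> = 0" "x \<oplus>\<^bsub>free_algebra\<^esub> y = x + y"
  by (simp_all add: free_algebra_def)

lemma free_algebra_uminus: "\<ominus>\<^bsub>free_algebra\<^esub> x = - (x :: 'i falg)"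
  by (rule fa.minus_equality) simp_all

lemma rel_ideal_ideal: "ideal (rel_ideal C s) (free_algebra :: 'i falg ring)"
  unfolding rel_ideal_def by (rule fa.genideal_ideal) simp

lemma relators_subset_rel_ideal: "relators C s \<subseteq> rel_ideal C s"
  unfolding rel_ideal_def by (rule fa.genideal_self) simp

lemma rel_ideal_0: "0 \<in> rel_ideal C s"
proof -
  interpret ideal "rel_ideal C s" free_algebra by (rule rel_ideal_ideal)
  show ?thesis using additive_subgroup.zero_closed[OF is_additive_subgroup] by simp
qed

lemma qcoset_eq: "qcoset C s x = {h + x | h. h \<in> rel_ideal C s}"
  by (auto simp: qcoset_def a_r_coset_def')

lemma qrep_qcoset: "qrep (qcoset C s x) \<in> qcoset C s x"
  unfolding qrep_def by (rule someI[of _ x]) (use rel_ideal_0 in \<open>force simp: qcoset_eq\<close>)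

lemma qrep_diff: "qrep (qcoset C s x) - x \<in> rel_ideal C s"
  using qrep_qcoset[of C s x] by (auto simp: qcoset_eq)

lemma qcoset_cong:
  assumes "x - y \<in> rel_ideal C s"
  shows "qcoset C s x = qcoset C s y"
proof -
  interpret ideal "rel_ideal C s" free_algebra by (rule rel_ideal_ideal)
  have "x \<in> qcoset C s y"
    using assms unfolding qcoset_eq by (auto intro!: exI[of _ "x - y"])
  then show ?thesis
    unfolding qcoset_def using a_repr_independence'[of x y] by simp
qed

lemma carrier_qalg: "carrier (qalg C s) = range (qcoset C s)"
  by (auto simp: qalg_def FactRing_def A_RCOSETS_def' qcoset_def a_r_coset_def')

lemma qcoset_carrier [simp]: "qcoset C s x \<in> carrier (qalg C s)"
  by (simp add: carrier_qalg)

lemma qcoset_add: "qcoset C s x \<oplus>\<^bsub>qalg C s\<^esub> qcoset C s y = qcoset C s (x + y)"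
proof -
  interpret ideal "rel_ideal C s" free_algebra by (rule rel_ideal_ideal)
  show ?thesis using a_rcos_sum[of x y] by (simp add: qalg_def FactRing_def qcoset_def)
qed

lemma qcoset_mult: "qcoset C s x \<otimes>\<^bsub>qalg C s\<^esub> qcoset C s y = qcoset C s (x * y)"
proof -
  interpret ideal "rel_ideal C s" free_algebra by (rule rel_ideal_ideal)
  show ?thesis using rcoset_mult_add[of x y] by (simp add: qalg_def FactRing_def qcoset_def)
qed

lemma falg_induct [case_names single add]:
  assumes single: "\<And>w c. P (Poly_Mapping.single w c)"
    and add: "\<And>x y. P x \<Longrightarrow> P y \<Longrightarrow> P (x + y)"
  shows "P (x :: 'i falg)"
proof (induction x rule: update_induct)
  case const
  show ?case using single[of "[]" 0] by simp
next
  case (update f a b)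
  have "Poly_Mapping.update a b f = f + Poly_Mapping.single a b"
    using update(1) by (intro poly_mapping_eqI)
      (auto simp: lookup_update lookup_add lookup_single not_in_keys_iff_lookup_eq_zero when_def)
  then show ?case using add[OF update(3) single] by simp
qed

lemma fscalar_commute: "fscalar c * x = x * (fscalar c :: 'i falg)"
  by (induction x rule: falg_induct)
    (auto simp: fscalar_def mult_single plus_list_def distrib_left distrib_right mult.commute)

lemma fscalar_1: "fscalar 1 = 1"
  by (simp add: fscalar_def flip: single_one add: zero_list_def)

context carrier_space
begin

lemma word_action_carrier:
  "\<forall>g. \<rho> g \<in> lin_ops M \<Longrightarrow> m \<in> vcar M \<Longrightarrow> word_action \<rho> w m \<in> vcar M"
  by (induction w) (auto dest: lin_opsD)

lemma free_action_superset:
  assumes "finite S" "Poly_Mapping.keys x \<subseteq> S"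
  shows "free_action (scl M) \<rho> x m = (\<Sum>w\<in>S. scl M (Poly_Mapping.lookup x w) (word_action \<rho> w m))"
  unfolding free_action_def using assms
  by (intro sum.mono_neutral_left) (auto simp: not_in_keys_iff_lookup_eq_zero)

lemma free_action_add:
  "free_action (scl M) \<rho> (x + y) m = free_action (scl M) \<rho> x m + free_action (scl M) \<rho> y m"
proof -
  let ?S = "Poly_Mapping.keys x \<union> Poly_Mapping.keys y"
  have S: "finite ?S" by simp
  show ?thesis
    using keys_add[of x y]
    by (subst (1 2 3) free_action_superset[OF S]) (auto simp: lookup_add scale_left_distrib sum.distrib)
qed

lemma free_action_single:
  "free_action (scl M) \<rho> (Poly_Mapping.single w c) m = scl M c (word_action \<rho> w m)"
  by (subst free_action_superset[of "{w}"]) auto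

lemma free_action_0: "free_action (scl M) \<rho> 0 m = 0"
  by (simp add: free_action_def)

lemma free_action_fscalar: "free_action (scl M) \<rho> (fscalar c) m = scl M c m"
  by (simp add: fscalar_def free_action_single)

lemma free_action_1: "free_action (scl M) \<rho> 1 m = m"
  using free_action_fscalar[of \<rho> 1] by (simp add: fscalar_1)

lemma free_action_fgen: "free_action (scl M) \<rho> (fgen g) m = \<rho> g m"
  by (simp add: fgen_def free_action_single)

lemma free_action_neg: "free_action (scl M) \<rho> (- x) m = - free_action (scl M) \<rho> x m"
  using free_action_add[of \<rho> x "- x" m] by (simp add: free_action_0 eq_neg_iff_add_eq_0 add.commute)

lemma free_action_diff:
  "free_action (scl M) \<rho> (x - y) m = free_action (scl M) \<rho> x m - free_action (scl M) \<rho> y m"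
  using free_action_add[of \<rho> x "- y" m] by (simp add: free_action_neg)

lemma free_action_sum:
  "free_action (scl M) \<rho> (sum f A) m = (\<Sum>a\<in>A. free_action (scl M) \<rho> (f a) m)"
  by (induction A rule: infinite_finite_induct) (auto simp: free_action_0 free_action_add)

context
  fixes \<rho> :: "'i gen \<Rightarrow> 'm \<Rightarrow> 'm"
  assumes ops: "\<forall>g. \<rho> g \<in> lin_ops M"
begin

lemma word_action_linear: "linear_on M (scl M) (word_action \<rho> w)"
  using ops word_action_carrier[OF ops]
  by (induction w) (auto simp: linear_on_def lin_ops_def)

lemma free_action_lin_ops: "free_action (scl M) \<rho> x \<in> lin_ops M"
  unfolding lin_ops_def free_action_def linear_on_def
  using word_action_carrier[OF ops] word_action_linear
  by (auto intro!: carrier_sum simp: linear_on_def scale_right_distrib sum.distrib scale_sum_right mult.commute)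

lemma free_action_mult:
  assumes m: "m \<in> vcar M"
  shows "free_action (scl M) \<rho> (x * y) m = free_action (scl M) \<rho> x (free_action (scl M) \<rho> y m)"
proof (induction y rule: falg_induct)
  case (single w c)
  have app: "word_action \<rho> (u @ w) m = word_action \<rho> u (word_action \<rho> w m)" for u
    by (induction u) auto
  show ?case
    by (induction x rule: falg_induct)
      (auto simp: mult_single plus_list_def free_action_single free_action_add distrib_right app
        linear_on_scale[OF word_action_linear word_action_carrier[OF ops m]])
next
  case (add y z)
  then show ?case
    using lin_opsD(1)[OF free_action_lin_ops m]
    by (simp add: distrib_left free_action_add linear_on_add[OF lin_opsD(2)[OF free_action_lin_ops]])
qed

lemma free_action_power:
  "m \<in> vcar M \<Longrightarrow> free_action (scl M) \<rho> (x ^ n) m = (free_action (scl M) \<rho> x ^^ n) m"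
  by (induction n) (auto simp: free_action_1 free_action_mult)

text \<open>
  The elements of the free algebra that act as zero form an ideal, so it suffices to know that the
  relators are among them.
\<close>

lemma free_action_rel_ideal:
  assumes "\<forall>r\<in>relators C s. \<forall>m\<in>vcar M. free_action (scl M) \<rho> r m = 0"
    and "x \<in> rel_ideal C s" and "m \<in> vcar M"
  shows "free_action (scl M) \<rho> x m = 0"
proof -
  let ?I = "{x. \<forall>m\<in>vcar M. free_action (scl M) \<rho> x m = 0}"
  have "subgroup ?I (add_monoid free_algebra)"
    by (rule fa.add.subgroupI)
      (auto simp: free_action_0 free_action_add free_action_neg free_algebra_uminus intro: exI[of _ 0])
  then have "ideal ?I free_algebra"
    by (rule idealI[OF fa.ring_axioms])
      (auto simp: free_action_mult linear_on_0[OF lin_opsD(2)] free_action_lin_ops lin_opsD)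
  moreover have "relators C s \<subseteq> ?I" using assms(1) by auto
  ultimately have "rel_ideal C s \<subseteq> ?I"
    unfolding rel_ideal_def by (rule fa.genideal_minimal)
  then show ?thesis using assms(2,3) by auto
qed

lemma free_action_qrep_qcoset:
  assumes "\<forall>r\<in>relators C s. \<forall>m\<in>vcar M. free_action (scl M) \<rho> r m = 0" and "m \<in> vcar M"
  shows "free_action (scl M) \<rho> (qrep (qcoset C s x)) m = free_action (scl M) \<rho> x m"
  using free_action_rel_ideal[OF assms(1) qrep_diff assms(2), of x]
  by (simp add: free_action_diff)

text \<open>
  The action of a coset is defined through an arbitrary representative; since the ideal of relations
  acts as zero, all representatives act alike and the module axioms are those of the action of the
  free algebra.
\<close>

lemma qmodule_of_free_action:
  assumes rel: "\<forall>r\<in>relators C s. \<forall>m\<in>vcar M. free_action (scl M) \<rho> r m = 0"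
    and act: "\<forall>u\<in>carrier (qalg C s). \<forall>m\<in>vcar M. act M u m = free_action (scl M) \<rho> (qrep u) m"
  shows "qmodule C s M"
proof -
  have eq: "act M (qcoset C s x) m = free_action (scl M) \<rho> x m" if "m \<in> vcar M" for x m
    using act that free_action_qrep_qcoset[OF rel that] by simp
  have lin: "free_action (scl M) \<rho> x m \<in> vcar M" if "m \<in> vcar M" for x m
    using free_action_lin_ops that by (rule lin_opsD)
  show ?thesis
    unfolding qmodule_def carrier_qalg qscalar_def
    by (auto simp: eq lin vector_space_axioms carrier qcoset_add qcoset_mult free_action_add
        free_action_mult free_action_fscalar linear_on_add[OF lin_opsD(2)[OF free_action_lin_ops]])
qed

end

end

lemma qmodule_carrier_space: "qmodule C s M \<Longrightarrow> carrier_space M"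
  by (simp add: qmodule_def carrier_space_def carrier_space_axioms_def)

text \<open>
  Conversely, additivity and multiplicativity reduce the action of any coset to the operators of the
  generators.  These operators commute with scalars because scalars act through central
  elements of the algebra.
\<close>

lemma qmodule_gens:
  assumes M: "qmodule C s M"
  defines "\<rho> \<equiv> \<lambda>g. act M (qgen C s g)"
  shows "\<rho> g \<in> lin_ops M"
    and "m \<in> vcar M \<Longrightarrow> act M (qcoset C s x) m = free_action (scl M) \<rho> x m"
    and "r \<in> relators C s \<Longrightarrow> m \<in> vcar M \<Longrightarrow> free_action (scl M) \<rho> r m = 0"
proof -
  interpret carrier_space M by (rule qmodule_carrier_space[OF M])
  have addu: "act M (qcoset C s (x + y)) m = act M (qcoset C s x) m + act M (qcoset C s y) m"
    and multu: "act M (qcoset C s (x * y)) m = act M (qcoset C s x) (act M (qcoset C s y) m)"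
    and scal: "act M (qcoset C s (fscalar c)) m = scl M c m"
    and car: "act M (qcoset C s x) m \<in> vcar M"
    if "m \<in> vcar M" for x y c m
    using M that unfolding qmodule_def qscalar_def
    by (metis qcoset_carrier qcoset_add, metis qcoset_carrier qcoset_mult, metis, metis qcoset_carrier)
  show ops: "\<rho> g \<in> lin_ops M" for g
  proof -
    have "act M (qcoset C s (fgen g)) (scl M c m) = scl M c (act M (qcoset C s (fgen g)) m)"
      if "m \<in> vcar M" for c m
      using multu[OF that, of "fgen g" "fscalar c"] multu[OF that, of "fscalar c" "fgen g"] that
      by (simp add: fscalar_commute[of c "fgen g"] scal car)
    moreover have "\<forall>m\<in>vcar M. \<forall>n\<in>vcar M. act M (qcoset C s x) (m + n) = act M (qcoset C s x) m + act M (qcoset C s x) n" for x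
      using M unfolding qmodule_def by (metis qcoset_carrier)
    ultimately show ?thesis
      by (auto simp: lin_ops_def linear_on_def \<rho>_def qgen_def car)
  qed
  show act: "act M (qcoset C s x) m = free_action (scl M) \<rho> x m" if m: "m \<in> vcar M" for x m
  proof (induction x rule: falg_induct)
    case (single w c)
    have "act M (qcoset C s (Poly_Mapping.single w 1)) m = word_action \<rho> w m"
    proof (induction w)
      case Nil
      show ?case using scal[OF m, of 1] by (simp add: fscalar_def)
    next
      case (Cons g w)
      have "Poly_Mapping.single (g # w) 1 = fgen g * Poly_Mapping.single w (1 :: kfield)"
        by (simp add: fgen_def mult_single plus_list_def)
      then show ?case using Cons multu[OF m, of "fgen g"] by (simp add: \<rho>_def qgen_def)
    qed
    moreover have "Poly_Mapping.single w c = fscalar c * Poly_Mapping.single w 1"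
      by (simp add: fscalar_def mult_single plus_list_def)
    ultimately have "act M (qcoset C s (Poly_Mapping.single w c)) m = scl M c (word_action \<rho> w m)"
      using multu[OF m, of "fscalar c"] scal[OF car[OF m]] by simp
    then show ?case by (simp only: free_action_single)
  qed (simp add: addu m free_action_add)
  show "free_action (scl M) \<rho> r m = 0" if r: "r \<in> relators C s" and m: "m \<in> vcar M"
  proof -
    have "qcoset C s r = qcoset C s 0"
      using relators_subset_rel_ideal r by (intro qcoset_cong) auto
    then show ?thesis using act[OF m, of r] act[OF m, of 0] by (simp add: free_action_0)
  qed
qed


section \<open>The action on the dual space\<close>

lemma fscalar_add: "fscalar (a + b) = fscalar a + fscalar b"
  by (simp add: fscalar_def single_add)

lemma antipode_free_single: "antipode_free (Poly_Mapping.single w c) = fscalar c * antipode_word w"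
  by (cases "c = 0") (auto simp: antipode_free_def fscalar_def)

lemma antipode_free_add: "antipode_free (x + y) = antipode_free x + antipode_free y"
proof -
  let ?S = "Poly_Mapping.keys x \<union> Poly_Mapping.keys y"
  have *: "antipode_free z = (\<Sum>w\<in>?S. fscalar (Poly_Mapping.lookup z w) * antipode_word w)"
    if "Poly_Mapping.keys z \<subseteq> ?S" for z
    unfolding antipode_free_def using that
    by (intro sum.mono_neutral_left) (auto simp: not_in_keys_iff_lookup_eq_zero fscalar_def)
  show ?thesis
    using keys_add[of x y]
    by (subst (1 2 3) *) (auto simp: lookup_add fscalar_add distrib_right sum.distrib)
qed

text \<open>
  The operator by which a generator acts on linear forms: composition with the antipode, extended by
  zero outside the carrier so that the result lies again in the dual space.
\<close>

definition dual_gen ::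
    "('i, 'm::ab_group_add) wmod \<Rightarrow> ('i gen \<Rightarrow> 'm \<Rightarrow> 'm) \<Rightarrow> 'i gen \<Rightarrow> ('m \<Rightarrow> kfield) \<Rightarrow> 'm \<Rightarrow> kfield" where
  "dual_gen M \<rho> g \<phi> =
     (\<lambda>m. if m \<in> vcar M then \<phi> (free_action (scl M) \<rho> (antipode_gen g) m) else 0)"

lemma dual_simps [simp]:
  "vcar (dual C s M) = dual_space M" "scl (dual C s M) = (\<lambda>c \<phi> m. c * \<phi> m)"
  by (simp_all add: dual_def)

lemma dual_space_linear_on: "\<phi> \<in> dual_space M \<Longrightarrow> linear_on M (*) \<phi>"
  by (auto simp: dual_space_def linear_on_def)

lemma dual_space_outside: "\<phi> \<in> dual_space M \<Longrightarrow> m \<notin> vcar M \<Longrightarrow> \<phi> m = 0"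
  by (auto simp: dual_space_def)

lemma dual_space_eqI:
  "\<phi> \<in> dual_space M \<Longrightarrow> \<psi> \<in> dual_space M \<Longrightarrow> (\<And>m. m \<in> vcar M \<Longrightarrow> \<phi> m = \<psi> m) \<Longrightarrow> \<phi> = \<psi>"
  by (rule ext) (metis dual_space_outside)

context carrier_space
begin

lemma carrier_space_dual: "carrier_space (dual C s M)"
proof -
  interpret D: vector_space "scl (dual C s M)"
    by unfold_locales (auto simp: fun_eq_iff algebra_simps)
  have "D.subspace (vcar (dual C s M))"
    unfolding D.subspace_def by (auto simp: dual_space_def algebra_simps)
  then show ?thesis by unfold_locales
qed

lemma dual_space_comp:
  assumes "\<phi> \<in> dual_space M" "f \<in> lin_ops M"
  shows "(\<lambda>m. if m \<in> vcar M then \<phi> (f m) else 0) \<in> dual_space M"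
  using assms by (auto simp: dual_space_def lin_ops_def linear_on_def Pi_iff)

context
  fixes \<rho> :: "'i gen \<Rightarrow> 'm \<Rightarrow> 'm" and C :: "'i qdatum" and s :: kfield
  assumes ops: "\<forall>g. \<rho> g \<in> lin_ops M"
begin

lemma dual_gen_lin_ops: "dual_gen M \<rho> g \<in> lin_ops (dual C s M)"
  using dual_space_comp[OF _ free_action_lin_ops[OF ops]]
  by (auto simp: lin_ops_def linear_on_def dual_gen_def fun_eq_iff)

text \<open>
  The antipode reverses words, and so does composing linear forms with operators.  The two reversals
  cancel: the dual action of a word is the product, in the given order, of the dual operators of its
  letters.
\<close>

lemma dual_free_action:
  assumes \<phi>: "\<phi> \<in> dual_space M" and m: "m \<in> vcar M"
  shows "free_action (scl (dual C s M)) (dual_gen M \<rho>) x \<phi> m = \<phi> (free_action (scl M) \<rho> (antipode_free x) m)"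
proof -
  interpret D: carrier_space "dual C s M" by (rule carrier_space_dual)
  note lin = dual_space_linear_on[OF \<phi>] and FA = lin_opsD(1)[OF free_action_lin_ops[OF ops]]
  show ?thesis
  proof (induction x rule: falg_induct)
    case (single w c)
    have "word_action (dual_gen M \<rho>) w \<phi> m = \<phi> (free_action (scl M) \<rho> (antipode_word w) m)"
      if "m \<in> vcar M" for m
      using that by (induction w arbitrary: m)
        (auto simp: free_action_1 dual_gen_def free_action_mult[OF ops] FA)
    then show ?case
      using m by (simp add: D.free_action_single[unfolded dual_simps] antipode_free_single
          free_action_mult[OF ops] free_action_fscalar linear_on_scale[OF lin] FA)
  next
    case (add x y)
    then show ?case
      using m by (simp add: D.free_action_add[unfolded dual_simps] antipode_free_add free_action_add
          linear_on_add[OF lin] FA)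
  qed
qed

text \<open>
  The antipode of a coset is computed from a representative in the free algebra and mapped back to
  the quotient.  As the action on \<open>M\<close> factors through the quotient, the action on the dual is thus that
  of a representative through the operators \<open>dual_gen\<close>.
\<close>

lemma dual_act:
  assumes act: "\<forall>x. \<forall>m\<in>vcar M. act M (qcoset C s x) m = free_action (scl M) \<rho> x m"
    and "\<phi> \<in> dual_space M"
  shows "act (dual C s M) u \<phi> = free_action (scl (dual C s M)) (dual_gen M \<rho>) (qrep u) \<phi>"
proof -
  interpret D: carrier_space "dual C s M" by (rule carrier_space_dual)
  have "free_action (scl (dual C s M)) (dual_gen M \<rho>) (qrep u) \<phi> \<in> dual_space M"
    using lin_opsD(1)[OF D.free_action_lin_ops] dual_gen_lin_ops assms(2) by (simp add: dual_simps)
  then have "free_action (scl (dual C s M)) (dual_gen M \<rho>) (qrep u) \<phi> m = 0" if "m \<notin> vcar M" for m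
    using that by (rule dual_space_outside)
  moreover have "act (dual C s M) u \<phi> =
      (\<lambda>m. if m \<in> vcar M then \<phi> (act M (antipode C s u) m) else 0)"
    by (simp add: dual_def)
  ultimately show ?thesis
    using act by (auto simp: fun_eq_iff antipode_def dual_free_action[OF assms(2)] simp del: dual_simps)
qed

end

end


section \<open>Fractional powers\<close>

locale quantum_lattice =
  fixes C :: "('i::finite) qdatum"
  assumes adm: "admissible_lattice C" and den: "common_denominator C"
begin

text \<open>
  The exponents \<open>q \<in> D\<^sup>-\<^sup>1\<int>\<close>, for which the floor in the powers \<open>v\<^sup>q\<close> and \<open>t\<^sup>q\<close> is exact, so that
  the exponential laws hold.
\<close>

definition exponents :: "rat set" where
  "exponents = {q. of_nat (Den C) * q \<in> \<int>}"

lemma exponents_add [simp]: "q \<in> exponents \<Longrightarrow> r \<in> exponents \<Longrightarrow> q + r \<in> exponents"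
  and exponents_diff [simp]: "q \<in> exponents \<Longrightarrow> r \<in> exponents \<Longrightarrow> q - r \<in> exponents"
  and exponents_minus [simp]: "q \<in> exponents \<Longrightarrow> - q \<in> exponents"
  and exponents_of_int [simp]: "of_int n \<in> exponents"
  by (simp_all add: exponents_def distrib_left right_diff_distrib)

lemma exponents_mult [simp]: "q \<in> exponents \<Longrightarrow> of_nat n * q \<in> exponents"
  by (simp add: exponents_def mult.left_commute[of _ "of_nat n"])

lemma exponents_0 [simp]: "0 \<in> exponents"
  using exponents_of_int[of 0] by simp

lemma tpow_add: "s \<noteq> 0 \<Longrightarrow> q \<in> exponents \<Longrightarrow> r \<in> exponents \<Longrightarrow> tpow C s (q + r) = tpow C s q * tpow C s r"
  by (auto simp: exponents_def tpow_def distrib_left power_int_add elim!: Ints_cases)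

lemma tpow_minus: "q \<in> exponents \<Longrightarrow> tpow C s (- q) = inverse (tpow C s q)"
  by (auto simp: exponents_def tpow_def power_int_minus elim!: Ints_cases)

lemma tpow_diff: "s \<noteq> 0 \<Longrightarrow> q \<in> exponents \<Longrightarrow> r \<in> exponents \<Longrightarrow> tpow C s (q - r) = tpow C s q * inverse (tpow C s r)"
  using tpow_add[of s q "- r"] by (simp add: tpow_minus)

lemma tpow_0 [simp]: "tpow C s 0 = 1"
  by (simp add: tpow_def)

lemma tpow_1 [simp]: "tpow C 1 q = 1"
  by (simp add: tpow_def)

lemma tpow_nonzero [simp]: "s \<noteq> 0 \<Longrightarrow> tpow C s q \<noteq> 0"
  by (simp add: tpow_def)

lemma tpow_mult: "s \<noteq> 0 \<Longrightarrow> q \<in> exponents \<Longrightarrow> tpow C s (of_nat n * q) = tpow C s q ^ n"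
  by (induction n) (auto simp: distrib_right tpow_add)

lemma vroot_nonzero [simp]: "vroot \<noteq> 0" and troot_nonzero [simp]: "troot \<noteq> 0"
  by (simp_all add: vroot_def troot_def Zero_fract_def eq_fract)

lemma vpow_tpow: "vpow C = tpow C vroot"
  by (simp add: vpow_def tpow_def fun_eq_iff)

lemma Lat_diff [simp]: "\<nu> \<in> Lat C \<Longrightarrow> \<mu> \<in> Lat C \<Longrightarrow> \<nu> - \<mu> \<in> Lat C"
  using adm by (simp add: admissible_lattice_def)

lemma Lat_simple_root [simp]: "simple_root i \<in> Lat C" and Lat_0 [simp]: "0 \<in> Lat C"
  using adm by (auto simp: admissible_lattice_def root_lattice_def simple_root_def)

lemma Lat_minus [simp]: "\<nu> \<in> Lat C \<Longrightarrow> - \<nu> \<in> Lat C"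
  using Lat_diff[of 0 \<nu>] by simp

lemma Lat_add [simp]: "\<nu> \<in> Lat C \<Longrightarrow> \<mu> \<in> Lat C \<Longrightarrow> \<nu> + \<mu> \<in> Lat C"
  using Lat_diff[of \<nu> "- \<mu>"] by simp

lemma Lat_minus_iff [simp]: "- \<nu> \<in> Lat C \<longleftrightarrow> \<nu> \<in> Lat C"
  using Lat_minus[of \<nu>] Lat_minus[of "- \<nu>"] by auto

lemma pairing_exponents [simp]: "\<nu> \<in> Lat C \<Longrightarrow> \<mu> \<in> Lat C \<Longrightarrow> pairing C \<nu> \<mu> \<in> exponents"
  and dotp_exponents [simp]: "\<nu> \<in> Lat C \<Longrightarrow> \<mu> \<in> Lat C \<Longrightarrow> dotp C \<nu> \<mu> \<in> exponents"
  using den by (auto simp: common_denominator_def exponents_def)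

lemma pairing_add: "pairing C (\<nu> + \<nu>') \<mu> = pairing C \<nu> \<mu> + pairing C \<nu>' \<mu>"
    "pairing C \<nu> (\<mu> + \<mu>') = pairing C \<nu> \<mu> + pairing C \<nu> \<mu>'"
  and pairing_diff: "pairing C (\<nu> - \<nu>') \<mu> = pairing C \<nu> \<mu> - pairing C \<nu>' \<mu>"
    "pairing C \<nu> (\<mu> - \<mu>') = pairing C \<nu> \<mu> - pairing C \<nu> \<mu>'"
  and pairing_minus: "pairing C (- \<nu>) \<mu> = - pairing C \<nu> \<mu>" "pairing C \<nu> (- \<mu>) = - pairing C \<nu> \<mu>"
  by (simp_all add: pairing_def algebra_simps sum.distrib sum_subtractf sum_negf)

lemma pairing_simple_root: "pairing C (simple_root i) (simple_root j) = of_int (Om C i j)"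
proof -
  have "pairing C (simple_root i) (simple_root j) =
      (\<Sum>k\<in>UNIV. \<Sum>l\<in>UNIV. if k = i then if l = j then of_int (Om C k l) else 0 else 0)"
    unfolding pairing_def simple_root_def by (intro sum.cong) auto
  also have "\<dots> = (\<Sum>k\<in>UNIV. if k = i then of_int (Om C k j) else 0)"
    by (intro sum.cong) auto
  finally show ?thesis by simp
qed

lemmas pairing_simps = pairing_add pairing_diff pairing_minus pairing_simple_root

lemma dotp_simps:
  "dotp C (\<nu> + \<nu>') \<mu> = dotp C \<nu> \<mu> + dotp C \<nu>' \<mu>" "dotp C \<nu> (\<mu> + \<mu>') = dotp C \<nu> \<mu> + dotp C \<nu> \<mu>'"
  "dotp C (\<nu> - \<nu>') \<mu> = dotp C \<nu> \<mu> - dotp C \<nu>' \<mu>" "dotp C \<nu> (\<mu> - \<mu>') = dotp C \<nu> \<mu> - dotp C \<nu> \<mu>'"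
  "dotp C (- \<nu>) \<mu> = - dotp C \<nu> \<mu>" "dotp C \<nu> (- \<mu>) = - dotp C \<nu> \<mu>"
  "dotp C (simple_root i) (simple_root j) = of_int (Om C i j + Om C j i)"
  by (simp_all add: dotp_def pairing_simps)

end


section \<open>Weight spaces\<close>

text \<open>
  Of finite dimension, only the finiteness of the set of weights is recorded: it suffices for
  decomposing linear forms into weight components, and it passes to the dual space directly.
\<close>

locale weight_space = quantum_lattice C + carrier_space M
  for C :: "('i::finite) qdatum" and M :: "('i, 'm::ab_group_add) wmod" +
  assumes graded: "weight_graded C M"
    and finite_weights: "\<exists>S. finite S \<and> (\<forall>m\<in>vcar M. wsupp C M m \<subseteq> S)"
begin

lemma subspace_wts: "\<nu> \<in> Lat C \<Longrightarrow> subspace (wts M \<nu>)"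
  and wts_carrier: "\<nu> \<in> Lat C \<Longrightarrow> m \<in> wts M \<nu> \<Longrightarrow> m \<in> vcar M"
  using graded by (auto simp: weight_graded_def)

lemmas wts_0 [simp] = subspace_0[OF subspace_wts]
  and wts_scale = subspace_scale[OF subspace_wts]

lemma finite_wsupp' [simp]: "m \<in> vcar M \<Longrightarrow> finite (wsupp C M m)"
  by (rule finite_wsupp[OF graded])

lemma wsupp_Lat: "m \<in> vcar M \<Longrightarrow> \<nu> \<in> wsupp C M m \<Longrightarrow> \<nu> \<in> Lat C"
  using weight_decomp_wcomp[OF graded] by (auto simp: weight_decomp_def wsupp_def)

lemma wcomp_wts: "m \<in> vcar M \<Longrightarrow> \<nu> \<in> Lat C \<Longrightarrow> wcomp C M \<nu> m \<in> wts M \<nu>"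
  using weight_decomp_wcomp[OF graded] by (auto simp: weight_decomp_def)

lemma wcomp_carrier [simp]: "m \<in> vcar M \<Longrightarrow> wcomp C M \<nu> m \<in> vcar M"
  by (rule wcomp_in_vcar[OF vector_space_axioms carrier graded])

lemmas wcomp_add = wcomp_linear(1)[OF vector_space_axioms carrier graded]
  and wcomp_scale = wcomp_linear(2)[OF vector_space_axioms carrier graded]
  and wcomp_hom = wcomp_homogeneous[OF vector_space_axioms graded]
  and wsupp_hom = wsupp_homogeneous[OF vector_space_axioms graded]
  and wscale_hom = wscale_homogeneous[OF vector_space_axioms graded]

lemma wcomp_sum: "m \<in> vcar M \<Longrightarrow> (\<Sum>\<nu>\<in>wsupp C M m. wcomp C M \<nu> m) = m"
  using weight_decomp_wcomp[OF graded, of m] by (simp add: weight_decomp_def wsupp_def)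

text \<open>
  Identities between linear maps are checked on weight vectors, where the weight components, and all
  operators built from them, are explicit.
\<close>

lemma linear_on_eqI:
  assumes "linear_on M sc f" "linear_on M sc' g"
    and "\<And>\<nu> m. \<nu> \<in> Lat C \<Longrightarrow> m \<in> wts M \<nu> \<Longrightarrow> f m = g m" and "m \<in> vcar M"
  shows "f m = g m"
proof -
  have "f (\<Sum>\<nu>\<in>wsupp C M m. wcomp C M \<nu> m) = g (\<Sum>\<nu>\<in>wsupp C M m. wcomp C M \<nu> m)"
    unfolding linear_on_sum[OF assms(1) wcomp_carrier[OF assms(4)]]
      linear_on_sum[OF assms(2) wcomp_carrier[OF assms(4)]]
    by (intro sum.cong refl assms(3)[OF _ wcomp_wts]) (use assms(4) in \<open>auto intro: wsupp_Lat\<close>)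
  then show ?thesis by (simp add: wcomp_sum assms(4))
qed

lemma wscale_superset:
  assumes "finite S" "wsupp C M m \<subseteq> S"
  shows "wscale C M f m = (\<Sum>\<nu>\<in>S. scl M (f \<nu>) (wcomp C M \<nu> m))"
  unfolding wscale_def using assms by (intro sum.mono_neutral_left) (auto simp: wsupp_def)

lemma wscale_lin_ops: "wscale C M f \<in> lin_ops M"
proof -
  obtain S where "finite S" "\<forall>m\<in>vcar M. wsupp C M m \<subseteq> S" using finite_weights by auto
  then have "wscale C M f m = (\<Sum>\<nu>\<in>S. scl M (f \<nu>) (wcomp C M \<nu> m))" if "m \<in> vcar M" for m
    using that wscale_superset by auto
  then show ?thesis
    by (auto simp: lin_ops_def linear_on_def wcomp_add wcomp_scale scale_right_distrib sum.distrib
        scale_sum_right mult.commute intro!: carrier_sum)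
qed

lemma weight_unique:
  assumes "\<nu> \<in> Lat C" "\<mu> \<in> Lat C" "m \<in> wts M \<nu>" "m \<in> wts M \<mu>" "m \<noteq> 0"
  shows "\<nu> = \<mu>"
  using assms wcomp_hom[of \<nu> m \<nu>] wcomp_hom[of \<mu> m \<nu>] by (auto split: if_splits)

end

text \<open>The weights of a spanning set are the only weights of the space.\<close>

lemma weight_module_weight_space:
  assumes "quantum_lattice C" and M: "weight_module C s M"
  shows "weight_space C M"
proof -
  interpret quantum_lattice C by fact
  interpret carrier_space M using M by (intro qmodule_carrier_space[of C s]) (simp add: weight_module_def)
  have g: "weight_graded C M" using M by (simp add: weight_module_def)
  obtain B where B: "finite B" "B \<subseteq> vcar M" "span B = vcar M"
    using M by (auto simp: weight_module_def)
  let ?S = "\<Union>b\<in>B. wsupp C M b"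
  note lin = wcomp_linear[OF vector_space_axioms carrier g]
  have z: "wcomp C M \<nu> 0 = 0" for \<nu> using lin(2)[of 0 \<nu> 0] by simp
  have "m \<in> vcar M \<and> wsupp C M m \<subseteq> ?S" if "m \<in> span B" for m
    using that
  proof (induction rule: span_induct_alt)
    case (step c x y)
    then have "x \<in> vcar M" using B by auto
    then show ?case using step by (auto simp: wsupp_def lin)
  qed (auto simp: wsupp_def z)
  moreover have "finite ?S" using B by (intro finite_UN_I finite_wsupp[OF g]) auto
  ultimately show ?thesis
    by unfold_locales (use g B(3) in \<open>auto intro!: exI[of _ ?S]\<close>)
qed

text \<open>
  A linear form splits into its restrictions to the weight spaces; there are only finitely many
  of them because only finitely many weights occur.
\<close>

lemma (in weight_space) weight_space_dual: "weight_space C (dual C s M)"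
proof -
  interpret D: carrier_space "dual C s M" by (rule carrier_space_dual)
  have wts: "wts (dual C s M) \<kappa> = {\<phi> \<in> dual_space M. \<forall>\<mu>\<in>Lat C. \<mu> \<noteq> - \<kappa> \<longrightarrow> (\<forall>m\<in>wts M \<mu>. \<phi> m = 0)}" for \<kappa>
    by (simp add: dual_def)
  obtain S where S: "finite S" "\<forall>m\<in>vcar M. wsupp C M m \<subseteq> S" using finite_weights by auto
  define part where "part \<phi> \<kappa> =
    (\<lambda>m. if \<kappa> \<in> Lat C \<and> m \<in> vcar M then \<phi> (wcomp C M (- \<kappa>) m) else 0)" for \<phi> :: "'m \<Rightarrow> kfield" and \<kappa>
  have part: "part \<phi> \<kappa> \<in> dual_space M" if "\<phi> \<in> dual_space M" for \<phi> \<kappa>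
    using that by (auto simp: part_def dual_space_def wcomp_add wcomp_scale)
  have part_wts: "part \<phi> \<kappa> \<in> wts (dual C s M) \<kappa>" if "\<phi> \<in> dual_space M" for \<phi> \<kappa>
    using part[OF that] linear_on_0[OF dual_space_linear_on[OF that]]
    by (auto simp: wts part_def wcomp_hom)
  have supp: "{\<kappa>. part \<phi> \<kappa> \<noteq> 0} \<subseteq> uminus ` S" if "\<phi> \<in> dual_space M" for \<phi>
  proof
    fix \<kappa> assume "\<kappa> \<in> {\<kappa>. part \<phi> \<kappa> \<noteq> 0}"
    then obtain m where "m \<in> vcar M" "\<phi> (wcomp C M (- \<kappa>) m) \<noteq> 0"
      by (auto simp: part_def fun_eq_iff split: if_splits)
    then have "- \<kappa> \<in> wsupp C M m"
      using linear_on_0[OF dual_space_linear_on[OF that]] by (auto simp: wsupp_def)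
    then show "\<kappa> \<in> uminus ` S" using S \<open>m \<in> vcar M\<close> by (auto intro!: image_eqI[of _ _ "- \<kappa>"])
  qed
  have decomp: "weight_decomp C (dual C s M) \<phi> (part \<phi>)" if \<phi>: "\<phi> \<in> dual_space M" for \<phi>
    unfolding weight_decomp_def
  proof (intro conjI)
    show fin: "finite {\<kappa>. part \<phi> \<kappa> \<noteq> 0}"
      using supp[OF \<phi>] S(1) finite_subset by blast
    have sum: "(\<Sum>\<kappa> | part \<phi> \<kappa> \<noteq> 0. part \<phi> \<kappa>) \<in> dual_space M"
      using D.carrier_sum[of _ "part \<phi>"] part[OF \<phi>] by simp
    have "\<phi> m = (\<Sum>\<kappa> | part \<phi> \<kappa> \<noteq> 0. part \<phi> \<kappa>) m" if m: "m \<in> vcar M" for m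
    proof (rule linear_on_eqI[OF dual_space_linear_on[OF \<phi>] dual_space_linear_on[OF sum] _ m])
      fix \<nu> m assume \<nu>: "\<nu> \<in> Lat C" "m \<in> wts M \<nu>"
      have pm: "part \<phi> \<kappa> m = (if \<kappa> = - \<nu> then \<phi> m else 0)" for \<kappa>
        using \<nu> wts_carrier[OF \<nu>] linear_on_0[OF dual_space_linear_on[OF \<phi>]]
        by (auto simp: part_def wcomp_hom)
      have "(\<Sum>\<kappa> | part \<phi> \<kappa> \<noteq> 0. part \<phi> \<kappa>) m = (\<Sum>\<kappa> | part \<phi> \<kappa> \<noteq> 0. part \<phi> \<kappa> m)"
        by (induction rule: infinite_finite_induct) auto
      also have "\<dots> = (if part \<phi> (- \<nu>) = 0 then 0 else \<phi> m)"
        using fin by (simp add: pm)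
      also have "\<dots> = \<phi> m" using pm[of "- \<nu>"] by auto
      finally show "\<phi> m = (\<Sum>\<kappa> | part \<phi> \<kappa> \<noteq> 0. part \<phi> \<kappa>) m" by simp
    qed
    then show "\<phi> = (\<Sum>\<kappa> | part \<phi> \<kappa> \<noteq> 0. part \<phi> \<kappa>)"
      by (rule dual_space_eqI[OF \<phi> sum])
    show "\<forall>\<kappa>\<in>Lat C. part \<phi> \<kappa> \<in> wts (dual C s M) \<kappa>" using part_wts[OF \<phi>] by blast
    show "\<forall>\<kappa>. \<kappa> \<notin> Lat C \<longrightarrow> part \<phi> \<kappa> = 0" by (auto simp: part_def fun_eq_iff)
  qed
  have uniq: "c = part \<phi>" if \<phi>: "\<phi> \<in> dual_space M" and c: "weight_decomp C (dual C s M) \<phi> c" for \<phi> c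
  proof
    fix \<kappa>
    note c' = c[unfolded weight_decomp_def]
    show "c \<kappa> = part \<phi> \<kappa>"
    proof (cases "\<kappa> \<in> Lat C")
      case True
      have ck: "c \<mu> \<in> dual_space M" if "\<mu> \<in> Lat C" for \<mu> using c' that by (auto simp: wts)
      have "c \<kappa> m = part \<phi> \<kappa> m" if m: "m \<in> vcar M" for m
      proof (rule linear_on_eqI[OF dual_space_linear_on[OF ck[OF True]] dual_space_linear_on[OF part[OF \<phi>]] _ m])
        fix \<nu> m assume \<nu>: "\<nu> \<in> Lat C" "m \<in> wts M \<nu>"
        have cm: "c \<mu> m = 0" if "\<mu> \<noteq> - \<nu>" for \<mu>
        proof -
          have "\<nu> \<noteq> - \<mu>" using that by auto
          then show ?thesis using c' \<nu> by (cases "\<mu> \<in> Lat C") (auto simp: wts)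
        qed
        have "\<phi> m = (\<Sum>\<mu> | c \<mu> \<noteq> 0. c \<mu>) m" using c' by metis
        also have "\<dots> = (\<Sum>\<mu> | c \<mu> \<noteq> 0. c \<mu> m)"
          by (induction rule: infinite_finite_induct) auto
        also have "\<dots> = (\<Sum>\<mu> | c \<mu> \<noteq> 0. if \<mu> = - \<nu> then c (- \<nu>) m else 0)"
          by (intro sum.cong) (auto simp: cm)
        also have "\<dots> = (if c (- \<nu>) = 0 then 0 else c (- \<nu>) m)"
          using c' by simp
        also have "\<dots> = c (- \<nu>) m" by simp
        finally show "c \<kappa> m = part \<phi> \<kappa> m"
          using \<nu> wts_carrier[OF \<nu>] True cm[of \<kappa>] linear_on_0[OF dual_space_linear_on[OF \<phi>]]
          by (cases "\<kappa> = - \<nu>") (auto simp: part_def wcomp_hom)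
      qed
      then show ?thesis by (rule dual_space_eqI[OF ck[OF True] part[OF \<phi>]])
    qed (use c' in \<open>auto simp: part_def fun_eq_iff\<close>)
  qed
  have graded: "weight_graded C (dual C s M)"
    unfolding weight_graded_def
  proof (intro conjI ballI)
    fix \<kappa> assume "\<kappa> \<in> Lat C"
    show "D.subspace (wts (dual C s M) \<kappa>)"
      using D.carrier unfolding D.subspace_def by (auto simp: wts)
    show "wts (dual C s M) \<kappa> \<subseteq> vcar (dual C s M)" by (auto simp: wts)
  next
    fix \<phi> assume "\<phi> \<in> vcar (dual C s M)"
    then show "\<exists>!c. weight_decomp C (dual C s M) \<phi> c" using decomp uniq by (intro ex1I[of _ "part \<phi>"]) auto
  qed
  have "wsupp C (dual C s M) \<phi> \<subseteq> uminus ` S" if "\<phi> \<in> dual_space M" for \<phi>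
    using supp[OF that] wcomp_unique[OF graded _ decomp[OF that]] that by (auto simp: wsupp_def)
  then show ?thesis
    by unfold_locales (use graded S in \<open>auto intro!: exI[of _ "uminus ` S"]\<close>)
qed


section \<open>Weight representations by operators\<close>

text \<open>
  The eigenvalues of \<open>K\<^sub>i\<close> and \<open>K'\<^sub>i\<close> on the weight space of \<open>\<nu>\<close>.
\<close>

definition kchar :: "('i::finite) qdatum \<Rightarrow> kfield \<Rightarrow> 'i \<Rightarrow> ('i \<Rightarrow> rat) \<Rightarrow> kfield" where
  "kchar C s i \<nu> = vpow C (dotp C (simple_root i) \<nu>) *
     tpow C s (pairing C \<nu> (simple_root i) - pairing C (simple_root i) \<nu>)"

definition lchar :: "('i::finite) qdatum \<Rightarrow> kfield \<Rightarrow> 'i \<Rightarrow> ('i \<Rightarrow> rat) \<Rightarrow> kfield" where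
  "lchar C s i \<nu> = vpow C (- dotp C (simple_root i) \<nu>) *
     tpow C s (pairing C \<nu> (simple_root i) - pairing C (simple_root i) \<nu>)"

definition serre_coeff :: "('i::finite) qdatum \<Rightarrow> kfield \<Rightarrow> 'i \<Rightarrow> 'i \<Rightarrow> nat \<Rightarrow> kfield" where
  "serre_coeff C s i j p = kappa C s i j p (serre_deg C i j - p) *
     inverse (qfact C s i p) * inverse (qfact C s i (serre_deg C i j - p))"

text \<open>
  The defining relations, read as identities between operators on weight vectors.  The divided powers
  are resolved, their denominators being part of the coefficients \<open>serre_coeff\<close>.  The relations among
  the Cartan generators and those commuting them past \<open>E\<^sub>j\<close> and \<open>F\<^sub>j\<close> are replaced by the requirement
  that \<open>K\<^sub>i\<close>, \<open>K'\<^sub>i\<close> and their inverses act by the right scalars and that \<open>E\<^sub>j\<close>, \<open>F\<^sub>j\<close> shift the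
  weight.
\<close>

definition weight_rep ::
    "('i::finite) qdatum \<Rightarrow> kfield \<Rightarrow> ('i, 'm::ab_group_add) wmod \<Rightarrow> ('i gen \<Rightarrow> 'm \<Rightarrow> 'm) \<Rightarrow> bool" where
  "weight_rep C s M \<rho> \<longleftrightarrow>
     (\<forall>g. \<rho> g \<in> lin_ops M) \<and>
     (\<forall>\<nu>\<in>Lat C. \<forall>m\<in>wts M \<nu>.
       (\<forall>i. \<rho> (GE i) m \<in> wts M (\<nu> + simple_root i) \<and> \<rho> (GF i) m \<in> wts M (\<nu> - simple_root i) \<and>
         \<rho> (GK i) m = scl M (kchar C s i \<nu>) m \<and> \<rho> (GKinv i) m = scl M (inverse (kchar C s i \<nu>)) m \<and>
         \<rho> (GL i) m = scl M (lchar C s i \<nu>) m \<and> \<rho> (GLinv i) m = scl M (inverse (lchar C s i \<nu>)) m) \<and>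
       (\<forall>i j. \<rho> (GE i) (\<rho> (GF j) m) - \<rho> (GF j) (\<rho> (GE i) m) =
         (if i = j then scl M (inverse (v_i C i - inverse (v_i C i)) * (kchar C s i \<nu> - lchar C s i \<nu>)) m
          else 0)) \<and>
       (\<forall>i j. i \<noteq> j \<longrightarrow>
         (\<Sum>p\<le>serre_deg C i j. scl M (serre_coeff C s i j p)
            ((\<rho> (GE i) ^^ p) (\<rho> (GE j) ((\<rho> (GE i) ^^ (serre_deg C i j - p)) m)))) = 0 \<and>
         (\<Sum>p\<le>serre_deg C i j. scl M (serre_coeff C s i j p)
            ((\<rho> (GF i) ^^ (serre_deg C i j - p)) (\<rho> (GF j) ((\<rho> (GF i) ^^ p) m)))) = 0))"

lemma weight_repD:
  assumes "weight_rep C s M \<rho>"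
  shows "\<rho> g \<in> lin_ops M"
    and "\<nu> \<in> Lat C \<Longrightarrow> m \<in> wts M \<nu> \<Longrightarrow> \<rho> (GE i) m \<in> wts M (\<nu> + simple_root i)"
    and "\<nu> \<in> Lat C \<Longrightarrow> m \<in> wts M \<nu> \<Longrightarrow> \<rho> (GF i) m \<in> wts M (\<nu> - simple_root i)"
    and "\<nu> \<in> Lat C \<Longrightarrow> m \<in> wts M \<nu> \<Longrightarrow> \<rho> (GK i) m = scl M (kchar C s i \<nu>) m"
    and "\<nu> \<in> Lat C \<Longrightarrow> m \<in> wts M \<nu> \<Longrightarrow> \<rho> (GKinv i) m = scl M (inverse (kchar C s i \<nu>)) m"
    and "\<nu> \<in> Lat C \<Longrightarrow> m \<in> wts M \<nu> \<Longrightarrow> \<rho> (GL i) m = scl M (lchar C s i \<nu>) m"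
    and "\<nu> \<in> Lat C \<Longrightarrow> m \<in> wts M \<nu> \<Longrightarrow> \<rho> (GLinv i) m = scl M (inverse (lchar C s i \<nu>)) m"
    and "\<nu> \<in> Lat C \<Longrightarrow> m \<in> wts M \<nu> \<Longrightarrow> \<rho> (GE i) (\<rho> (GF j) m) - \<rho> (GF j) (\<rho> (GE i) m) =
         (if i = j then scl M (inverse (v_i C i - inverse (v_i C i)) * (kchar C s i \<nu> - lchar C s i \<nu>)) m
          else 0)"
    and "\<nu> \<in> Lat C \<Longrightarrow> m \<in> wts M \<nu> \<Longrightarrow> i \<noteq> j \<Longrightarrow>
         (\<Sum>p\<le>serre_deg C i j. scl M (serre_coeff C s i j p)
            ((\<rho> (GE i) ^^ p) (\<rho> (GE j) ((\<rho> (GE i) ^^ (serre_deg C i j - p)) m)))) = 0"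
    and "\<nu> \<in> Lat C \<Longrightarrow> m \<in> wts M \<nu> \<Longrightarrow> i \<noteq> j \<Longrightarrow>
         (\<Sum>p\<le>serre_deg C i j. scl M (serre_coeff C s i j p)
            ((\<rho> (GF i) ^^ (serre_deg C i j - p)) (\<rho> (GF j) ((\<rho> (GF i) ^^ p) m)))) = 0"
  using assms unfolding weight_rep_def by blast+

lemma funpow_lin_ops: "f \<in> lin_ops M \<Longrightarrow> f ^^ n \<in> lin_ops M"
  by (induction n) (auto simp: lin_ops_def linear_on_def Pi_iff)

context quantum_lattice
begin

lemma kchar_nonzero [simp]: "s \<noteq> 0 \<Longrightarrow> kchar C s i \<nu> \<noteq> 0"
  and lchar_nonzero [simp]: "s \<noteq> 0 \<Longrightarrow> lchar C s i \<nu> \<noteq> 0"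
  by (simp_all add: kchar_def lchar_def vpow_tpow)

text \<open>
  These are the commutation relations of \<open>K\<^sub>i\<close>, \<open>K'\<^sub>i\<close> with \<open>E\<^sub>j\<close>, \<open>F\<^sub>j\<close> in terms of eigenvalues.
\<close>

lemma char_shift:
  assumes "s \<noteq> 0" "\<nu> \<in> Lat C"
  shows "kchar C s i (\<nu> + simple_root j) = vpow C (of_int (Om C i j + Om C j i)) *
      tpow C s (of_int (Om C j i - Om C i j)) * kchar C s i \<nu>"
    and "lchar C s i (\<nu> + simple_root j) = vpow C (of_int (- (Om C i j + Om C j i))) *
      tpow C s (of_int (Om C j i - Om C i j)) * lchar C s i \<nu>"
    and "kchar C s i (\<nu> - simple_root j) = vpow C (of_int (- (Om C i j + Om C j i))) *
      tpow C s (of_int (Om C i j - Om C j i)) * kchar C s i \<nu>"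
    and "lchar C s i (\<nu> - simple_root j) = vpow C (of_int (Om C i j + Om C j i)) *
      tpow C s (of_int (Om C i j - Om C j i)) * lchar C s i \<nu>"
proof -
  have *: "tpow C r x * tpow C s y = tpow C r a * tpow C s b * (tpow C r c * tpow C s d)"
    if "x = a + c" "y = b + d" "a \<in> exponents" "c \<in> exponents" "b \<in> exponents" "d \<in> exponents" "r \<noteq> 0"
    for r x y a b c d using that assms(1) by (simp add: tpow_add)
  show "kchar C s i (\<nu> + simple_root j) = vpow C (of_int (Om C i j + Om C j i)) *
      tpow C s (of_int (Om C j i - Om C i j)) * kchar C s i \<nu>"
    "lchar C s i (\<nu> + simple_root j) = vpow C (of_int (- (Om C i j + Om C j i))) *
      tpow C s (of_int (Om C j i - Om C i j)) * lchar C s i \<nu>"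
    "kchar C s i (\<nu> - simple_root j) = vpow C (of_int (- (Om C i j + Om C j i))) *
      tpow C s (of_int (Om C i j - Om C j i)) * kchar C s i \<nu>"
    "lchar C s i (\<nu> - simple_root j) = vpow C (of_int (Om C i j + Om C j i)) *
      tpow C s (of_int (Om C i j - Om C j i)) * lchar C s i \<nu>"
    unfolding kchar_def lchar_def vpow_tpow using assms(2)
    by (intro *; simp del: of_int_add of_int_diff of_int_minus; simp add: dotp_simps pairing_simps)+
qed

end

context weight_space
begin

lemma free_action_serre:
  assumes ops: "\<forall>g. \<rho> g \<in> lin_ops M" and m: "m \<in> vcar M"
  shows "free_action (scl M) \<rho> (fscalar c * divpow C s i g p * fgen h * divpow C s i g q) m =
    scl M (c * inverse (qfact C s i p) * inverse (qfact C s i q)) ((\<rho> g ^^ p) (\<rho> h ((\<rho> g ^^ q) m)))"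
proof -
  have FA: "free_action (scl M) \<rho> (divpow C s i g n) y = scl M (inverse (qfact C s i n)) ((\<rho> g ^^ n) y)"
    if "y \<in> vcar M" for n y
  proof -
    have "(free_action (scl M) \<rho> (fgen g) ^^ n) y = (\<rho> g ^^ n) y"
      by (induction n) (auto simp: free_action_fgen)
    then show ?thesis
      using that by (simp add: divpow_def free_action_mult[OF ops] free_action_fscalar free_action_power[OF ops])
  qed
  have car: "(\<rho> g ^^ n) y \<in> vcar M" "\<rho> h y \<in> vcar M" if "y \<in> vcar M" for n h y
    using that lin_opsD(1)[OF funpow_lin_ops] lin_opsD(1) ops by blast+
  have lin: "(\<rho> g ^^ n) (scl M a y) = scl M a ((\<rho> g ^^ n) y)" "\<rho> h (scl M a y) = scl M a (\<rho> h y)"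
    if "y \<in> vcar M" for n h a y
    using that linear_on_scale[OF lin_opsD(2)[OF funpow_lin_ops]] linear_on_scale[OF lin_opsD(2)] ops by blast+
  show ?thesis
    by (simp add: m FA free_action_mult[OF ops] free_action_fscalar free_action_fgen car lin ac_simps)
qed

lemma weight_rep_relators:
  assumes rep: "weight_rep C s M \<rho>" and s: "s \<noteq> 0"
  shows "\<forall>r\<in>relators C s. \<forall>m\<in>vcar M. free_action (scl M) \<rho> r m = 0"
proof (intro ballI)
  fix r m assume r: "r \<in> relators C s" and m: "m \<in> vcar M"
  have ops: "\<forall>g. \<rho> g \<in> lin_ops M" using weight_repD(1)[OF rep] by blast
  show "free_action (scl M) \<rho> r m = 0"
  proof (rule linear_on_eqI[of _ _ "scl M" "\<lambda>_. 0", OF lin_opsD(2)[OF free_action_lin_ops[OF ops]] _ _ m])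
    show "linear_on M (scl M) (\<lambda>_. 0)" by (simp add: linear_on_def)
  next
    fix \<nu> m assume \<nu>: "\<nu> \<in> Lat C" and w: "m \<in> wts M \<nu>"
    have m: "m \<in> vcar M" by (rule wts_carrier[OF \<nu> w])
    have car: "\<rho> g y \<in> vcar M" if "y \<in> vcar M" for g y
      using that ops lin_opsD(1) by blast
    have lin: "\<rho> g (scl M a y) = scl M a (\<rho> g y)" if "y \<in> vcar M" for g a y
      using that linear_on_scale[OF lin_opsD(2)] ops by blast
    note FA = free_action_mult[OF ops] free_action_diff free_action_add free_action_fscalar
      free_action_fgen free_action_1 free_action_0 free_action_sum
    have cart: "\<exists>c. \<forall>m\<in>wts M \<nu>. \<rho> g m = scl M c m" if "g \<in> cartan_gens" for g
      using that weight_repD(4-7)[OF rep \<nu>] unfolding cartan_gens_def by blast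
    have shift: "\<rho> (GE i) m \<in> wts M (\<nu> + simple_root i)" "\<rho> (GF i) m \<in> wts M (\<nu> - simple_root i)" for i
      using weight_repD(2,3)[OF rep \<nu> w] by blast+
    have K: "\<rho> (GK i) y = scl M (kchar C s i \<mu>) y" "\<rho> (GKinv i) y = scl M (inverse (kchar C s i \<mu>)) y"
      "\<rho> (GL i) y = scl M (lchar C s i \<mu>) y" "\<rho> (GLinv i) y = scl M (inverse (lchar C s i \<mu>)) y"
      if "\<mu> \<in> Lat C" "y \<in> wts M \<mu>" for \<mu> y i
      using weight_repD(4-7)[OF rep] that by blast+
    note K0 = K[OF \<nu> w]
    have KE: "\<rho> (GK i) (\<rho> (GE j) m) = scl M (kchar C s i (\<nu> + simple_root j)) (\<rho> (GE j) m)"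
      "\<rho> (GK i) (\<rho> (GF j) m) = scl M (kchar C s i (\<nu> - simple_root j)) (\<rho> (GF j) m)"
      "\<rho> (GL i) (\<rho> (GE j) m) = scl M (lchar C s i (\<nu> + simple_root j)) (\<rho> (GE j) m)"
      "\<rho> (GL i) (\<rho> (GF j) m) = scl M (lchar C s i (\<nu> - simple_root j)) (\<rho> (GF j) m)" for i j
      by (intro K Lat_add Lat_diff \<nu> Lat_simple_root shift)+
    from r consider
        (1) g h where "r = fgen g * fgen h - fgen h * fgen g" "g \<in> cartan_gens" "h \<in> cartan_gens"
      | (2) i where "r = fgen (GK i) * fgen (GKinv i) - 1"
      | (3) i where "r = fgen (GL i) * fgen (GLinv i) - 1"
      | (4) i j where "r = fgen (GK i) * fgen (GE j) * fgen (GKinv i) -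
        fscalar (vpow C (of_int (Om C i j + Om C j i)) * tpow C s (of_int (Om C j i - Om C i j)))
          * fgen (GE j)"
      | (5) i j where "r = fgen (GL i) * fgen (GE j) * fgen (GLinv i) -
        fscalar (vpow C (of_int (- (Om C i j + Om C j i))) * tpow C s (of_int (Om C j i - Om C i j)))
          * fgen (GE j)"
      | (6) i j where "r = fgen (GK i) * fgen (GF j) * fgen (GKinv i) -
        fscalar (vpow C (of_int (- (Om C i j + Om C j i))) * tpow C s (of_int (Om C i j - Om C j i)))
          * fgen (GF j)"
      | (7) i j where "r = fgen (GL i) * fgen (GF j) * fgen (GLinv i) -
        fscalar (vpow C (of_int (Om C i j + Om C j i)) * tpow C s (of_int (Om C i j - Om C j i)))
          * fgen (GF j)"
      | (8) i j where "r = fgen (GE i) * fgen (GF j) - fgen (GF j) * fgen (GE i) -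
        (if i = j
         then fscalar (inverse (v_i C i - inverse (v_i C i))) * (fgen (GK i) - fgen (GL i))
         else 0)"
      | (9) i j where "i \<noteq> j" "r = (\<Sum>p\<le>serre_deg C i j.
         fscalar (kappa C s i j p (serre_deg C i j - p)) *
         divpow C s i (GE i) p * fgen (GE j) * divpow C s i (GE i) (serre_deg C i j - p))"
      | (10) i j where "i \<noteq> j" "r = (\<Sum>p\<le>serre_deg C i j.
         fscalar (kappa C s i j p (serre_deg C i j - p)) *
         divpow C s i (GF i) (serre_deg C i j - p) * fgen (GF j) * divpow C s i (GF i) p)"
      unfolding relators_def by blast
    then show "free_action (scl M) \<rho> r m = 0"
    proof cases
      case 1
      obtain c d where "\<forall>m\<in>wts M \<nu>. \<rho> g m = scl M c m" "\<forall>m\<in>wts M \<nu>. \<rho> h m = scl M d m"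
        using cart[OF 1(2)] cart[OF 1(3)] by auto
      then show ?thesis using m w by (simp add: 1(1) FA car lin mult.commute)
    next
      case 8
      have "\<rho> (GE i) (\<rho> (GF j) m) - \<rho> (GF j) (\<rho> (GE i) m) =
         (if i = j then scl M (inverse (v_i C i - inverse (v_i C i)) * (kchar C s i \<nu> - lchar C s i \<nu>)) m
          else 0)"
        using weight_repD(8-10)[OF rep \<nu> w] by blast
      then show ?thesis
        using m by (simp add: 8 FA car K0 scale_left_diff_distrib scale_right_diff_distrib right_diff_distrib)
    next
      case 9
      then have "(\<Sum>p\<le>serre_deg C i j. scl M (serre_coeff C s i j p)
            ((\<rho> (GE i) ^^ p) (\<rho> (GE j) ((\<rho> (GE i) ^^ (serre_deg C i j - p)) m)))) = 0"
        using weight_repD(8-10)[OF rep \<nu> w] by blast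
      then show ?thesis
        unfolding 9(2) free_action_sum free_action_serre[OF ops m] serre_coeff_def .
    next
      case 10
      then have "(\<Sum>p\<le>serre_deg C i j. scl M (serre_coeff C s i j p)
            ((\<rho> (GF i) ^^ (serre_deg C i j - p)) (\<rho> (GF j) ((\<rho> (GF i) ^^ p) m)))) = 0"
        using weight_repD(8-10)[OF rep \<nu> w] by blast
      then show ?thesis
        unfolding 10(2) free_action_sum free_action_serre[OF ops m] serre_coeff_def
        by (simp only: mult.assoc mult.commute mult.left_commute)
    next
      case 2
      then show ?thesis using m s by (simp add: FA car lin K0)
    next
      case 3
      then show ?thesis using m s by (simp add: FA car lin K0)
    next
      case 4
      then show ?thesis using m s by (simp add: FA car lin K0 KE char_shift[OF s \<nu>] mult.assoc del: of_int_add of_int_minus of_int_diff)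
    next
      case 5
      then show ?thesis using m s by (simp add: FA car lin K0 KE char_shift[OF s \<nu>] mult.assoc del: of_int_add of_int_minus of_int_diff)
    next
      case 6
      then show ?thesis using m s by (simp add: FA car lin K0 KE char_shift[OF s \<nu>] mult.assoc del: of_int_add of_int_minus of_int_diff)
    next
      case 7
      then show ?thesis using m s by (simp add: FA car lin K0 KE char_shift[OF s \<nu>] mult.assoc del: of_int_add of_int_minus of_int_diff)
    qed
  qed
qed

text \<open>
  The operators of the inverse Cartan generators are not prescribed on weight vectors; they are forced
  to be the inverse scalars since they commute with, and invert, the operators of \<open>K\<^sub>i\<close> and \<open>K'\<^sub>i\<close>.
\<close>

lemma qmodule_weight_rep:
  assumes qm: "qmodule C s M" and s: "s \<noteq> 0"
    and M: "\<forall>\<nu>\<in>Lat C. \<forall>m\<in>wts M \<nu>. \<forall>i.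
        act M (qgen C s (GE i)) m \<in> wts M (\<nu> + simple_root i) \<and>
        act M (qgen C s (GF i)) m \<in> wts M (\<nu> - simple_root i) \<and>
        act M (qgen C s (GK i)) m = scl M (kchar C s i \<nu>) m \<and>
        act M (qgen C s (GL i)) m = scl M (lchar C s i \<nu>) m"
  shows "weight_rep C s M (\<lambda>g. act M (qgen C s g))" (is "weight_rep C s M ?\<rho>")
proof -
  note gens = qmodule_gens[OF qm]
  have ops: "\<forall>g. ?\<rho> g \<in> lin_ops M" using gens(1) by blast
  have car: "?\<rho> g y \<in> vcar M" if "y \<in> vcar M" for g y
    using that ops lin_opsD(1) by blast
  have lin: "?\<rho> g (scl M a y) = scl M a (?\<rho> g y)" if "y \<in> vcar M" for g a y
    using that linear_on_scale[OF lin_opsD(2)] ops by blast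
  note FA = free_action_mult[OF ops] free_action_diff free_action_add free_action_fscalar
      free_action_fgen free_action_1 free_action_0 free_action_sum
  have rels:
    "g \<in> cartan_gens \<Longrightarrow> h \<in> cartan_gens \<Longrightarrow> fgen g * fgen h - fgen h * fgen g \<in> relators C s"
    "fgen (GK i) * fgen (GKinv i) - 1 \<in> relators C s"
    "fgen (GL i) * fgen (GLinv i) - 1 \<in> relators C s"
    "fgen (GE i) * fgen (GF j) - fgen (GF j) * fgen (GE i) -
        (if i = j
         then fscalar (inverse (v_i C i - inverse (v_i C i))) * (fgen (GK i) - fgen (GL i))
         else 0) \<in> relators C s"
    "i \<noteq> j \<Longrightarrow> (\<Sum>p\<le>serre_deg C i j.
         fscalar (kappa C s i j p (serre_deg C i j - p)) *
         divpow C s i (GE i) p * fgen (GE j) * divpow C s i (GE i) (serre_deg C i j - p)) \<in> relators C s"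
    "i \<noteq> j \<Longrightarrow> (\<Sum>p\<le>serre_deg C i j.
         fscalar (kappa C s i j p (serre_deg C i j - p)) *
         divpow C s i (GF i) (serre_deg C i j - p) * fgen (GF j) * divpow C s i (GF i) p) \<in> relators C s"
    for g h i j
    unfolding relators_def by blast+
  have cart: "GK i \<in> cartan_gens" "GKinv i \<in> cartan_gens" "GL i \<in> cartan_gens" "GLinv i \<in> cartan_gens" for i
    by (auto simp: cartan_gens_def)
  have inv: "?\<rho> h m = scl M (inverse c) m"
    if m: "m \<in> vcar M" and g: "?\<rho> g m = scl M c m" and c: "c \<noteq> 0"
      and r: "fgen g * fgen h - fgen h * fgen g \<in> relators C s" "fgen g * fgen h - 1 \<in> relators C s"
    for g h c m
  proof -
    have "?\<rho> g (?\<rho> h m) = ?\<rho> h (?\<rho> g m)" "?\<rho> g (?\<rho> h m) = m"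
      using gens(3)[OF r(1) m] gens(3)[OF r(2) m] m by (simp_all add: FA car)
    then have "m = scl M c (?\<rho> h m)" using g m by (simp add: lin)
    then have "scl M (inverse c) m = scl M (inverse c) (scl M c (?\<rho> h m))" by simp
    then show ?thesis using c by simp
  qed
  show ?thesis
    unfolding weight_rep_def
  proof (intro conjI ballI allI impI)
    fix g show "?\<rho> g \<in> lin_ops M" using ops by blast
  next
    fix \<nu> m i assume \<nu>: "\<nu> \<in> Lat C" and w: "m \<in> wts M \<nu>"
    have m: "m \<in> vcar M" by (rule wts_carrier[OF \<nu> w])
    show E: "act M (qgen C s (GE i)) m \<in> wts M (\<nu> + simple_root i)"
      and "act M (qgen C s (GF i)) m \<in> wts M (\<nu> - simple_root i)"
      and K: "act M (qgen C s (GK i)) m = scl M (kchar C s i \<nu>) m"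
      and L: "act M (qgen C s (GL i)) m = scl M (lchar C s i \<nu>) m"
      using M \<nu> w by blast+
    show "act M (qgen C s (GKinv i)) m = scl M (inverse (kchar C s i \<nu>)) m"
      by (rule inv[OF m K _ rels(1)[OF cart(1,2)] rels(2)]) (use s in simp)
    show "act M (qgen C s (GLinv i)) m = scl M (inverse (lchar C s i \<nu>)) m"
      by (rule inv[OF m L _ rels(1)[OF cart(3,4)] rels(3)]) (use s in simp)
    fix j
    have "act M (qgen C s (GK i)) m = scl M (kchar C s i \<nu>) m" "act M (qgen C s (GL i)) m = scl M (lchar C s i \<nu>) m" for i
      using M \<nu> w by blast+
    then show "act M (qgen C s (GE i)) (act M (qgen C s (GF j)) m) - act M (qgen C s (GF j)) (act M (qgen C s (GE i)) m) =
         (if i = j then scl M (inverse (v_i C i - inverse (v_i C i)) * (kchar C s i \<nu> - lchar C s i \<nu>)) m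
          else 0)"
      using gens(3)[OF rels(4)[of i j] m] m
      by (cases "i = j") (simp_all add: FA car scale_left_diff_distrib scale_right_diff_distrib right_diff_distrib)
    assume ij: "i \<noteq> j"
    show "(\<Sum>p\<le>serre_deg C i j. scl M (serre_coeff C s i j p)
            ((act M (qgen C s (GE i)) ^^ p) (act M (qgen C s (GE j)) ((act M (qgen C s (GE i)) ^^ (serre_deg C i j - p)) m)))) = 0"
      using gens(3)[OF rels(5)[OF ij] m]
      unfolding free_action_sum free_action_serre[OF ops m] serre_coeff_def .
    show "(\<Sum>p\<le>serre_deg C i j. scl M (serre_coeff C s i j p)
            ((act M (qgen C s (GF i)) ^^ (serre_deg C i j - p)) (act M (qgen C s (GF j)) ((act M (qgen C s (GF i)) ^^ p) m)))) = 0"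
      using gens(3)[OF rels(6)[OF ij] m]
      unfolding free_action_sum free_action_serre[OF ops m] serre_coeff_def
      by (simp only: mult.assoc mult.commute mult.left_commute)
  qed
qed

lemma weight_module_weight_rep:
  "weight_module C s M \<Longrightarrow> s \<noteq> 0 \<Longrightarrow> weight_rep C s M (\<lambda>g. act M (qgen C s g))"
  by (rule qmodule_weight_rep) (auto simp: weight_module_def kchar_def lchar_def)

end


section \<open>Rescaling operators by powers with affine exponents\<close>

lemma choose_two_add: "(p + q) choose 2 = (p choose 2) + (q choose 2) + p * (q :: nat)"
  by (induction q) (auto simp: numeral_2_eq_2)

text \<open>
  In the quantum number the variable \<open>t\<close> factors out: \<open>(vt)\<^sup>p - (v/t)\<^sup>-\<^sup>p = t\<^sup>p (v\<^sup>p - v\<^sup>-\<^sup>p)\<close>.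
\<close>

lemma symmetric_quotient_twist:
  fixes v t :: "'a::field"
  assumes "t \<noteq> 0"
  shows "((v * t) ^ Suc n - (v * inverse t) powi (- int (Suc n))) / (v * t - inverse (v * inverse t)) =
    t ^ n * ((v ^ Suc n - v powi (- int (Suc n))) / (v - inverse v))"
proof -
  have k: "(v * t) ^ k - (v * inverse t) powi (- int k) = t ^ k * (v ^ k - v powi (- int k))" for k
  proof -
    have "(v * inverse t) powi (- int k) = t ^ k * v powi (- int k)"
      by (simp add: power_int_minus power_mult_distrib power_inverse)
    then show ?thesis
      by (simp only: power_mult_distrib right_diff_distrib mult.commute)
  qed
  have "v * t - inverse (v * inverse t) = t * (v - inverse v)"
    by (simp add: right_diff_distrib mult.commute)
  moreover have "t * x / (t * y) = x / y" for x y using assms by simp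
  ultimately show ?thesis
    using k[of "Suc n"] power_Suc[of t n] by (simp only: mult.assoc times_divide_eq_right)
qed

context quantum_lattice
begin

lemma qnum_twist:
  assumes "s \<noteq> 0"
  shows "qnum C s i (Suc n) = t_i C s i ^ n * qnum C 1 i (Suc n)"
proof -
  have t: "t_i C s i \<noteq> 0" "t_i C 1 i = 1" using assms by (simp_all add: t_i_def)
  show ?thesis
    unfolding qnum_def t(2) symmetric_quotient_twist[OF t(1)] by (simp only: inverse_1 mult_1_right)
qed

lemma qfact_twist: "s \<noteq> 0 \<Longrightarrow> qfact C s i n = t_i C s i ^ (n choose 2) * qfact C 1 i n"
proof (induction n)
  case (Suc n)
  have "qfact C r i (Suc n) = qfact C r i n * qnum C r i (Suc n)" for r
    by (simp add: qfact_def)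
  moreover have "Suc n choose 2 = (n choose 2) + n" by (simp add: numeral_2_eq_2)
  ultimately show ?case
    using Suc by (simp add: qnum_twist[OF Suc.prems] power_add)
qed (simp add: qfact_def binomial_eq_0)

text \<open>
  The quantum factorials, which depend on \<open>t\<close> through \<open>t\<^sub>i\<close> to the power \<open>p choose 2\<close>, absorb the
  quadratic part \<open>- d\<^sub>i p p'\<close> of the exponent in \<open>\<kappa>\<close>, up to a constant: only a part linear in \<open>p\<close>
  is left.
\<close>

lemma serre_coeff_twist:
  assumes s: "s \<noteq> 0" and p: "p \<le> serre_deg C i j"
  shows "serre_coeff C s i j p =
    tpow C s (of_int (int p * (Om C i j - Om C j i) - int (serre_deg C i j choose 2) * Om C i i)) *
      serre_coeff C 1 i j p"
proof -
  obtain q where N: "serre_deg C i j = p + q" using p by (auto simp: le_iff_add)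
  have t: "t_i C s i ^ n = tpow C s (of_int (int n * Om C i i))" for n
    unfolding t_i_def using tpow_mult[OF s exponents_of_int, of n "Om C i i"] by simp
  have inv: "inverse (tpow C s (of_int k)) = tpow C s (of_int (- k))" for k
    using tpow_minus[OF exponents_of_int, of s k] by simp
  have add: "tpow C s (of_int k) * tpow C s (of_int l) = tpow C s (of_int (k + l))" for k l
    using tpow_add[OF s exponents_of_int exponents_of_int, of k l] by simp
  have "serre_coeff C s i j p =
    (tpow C s (of_int (- Om C i i * int p * int q + int p * Om C i j - int p * Om C j i)) *
     tpow C s (of_int (- (int (p choose 2) * Om C i i))) * tpow C s (of_int (- (int (q choose 2) * Om C i i)))) *
    serre_coeff C 1 i j p"
    unfolding serre_coeff_def kappa_def N qfact_twist[OF s] t inverse_mult_distrib inv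
    by (simp add: ac_simps del: of_int_add of_int_diff of_int_minus of_int_mult)
  also have "tpow C s (of_int (- Om C i i * int p * int q + int p * Om C i j - int p * Om C j i)) *
     tpow C s (of_int (- (int (p choose 2) * Om C i i))) * tpow C s (of_int (- (int (q choose 2) * Om C i i))) =
     tpow C s (of_int (int p * (Om C i j - Om C j i) - int (serre_deg C i j choose 2) * Om C i i))"
    unfolding add N choose_two_add by (rule arg_cong[where f = "\<lambda>k. tpow C s (of_int k)"]) (simp add: algebra_simps)
  finally show ?thesis .
qed

lemma serre_coeff_reverse:
  assumes "p \<le> serre_deg C i j"
  shows "serre_coeff C 1 i j (serre_deg C i j - p) = (- 1) ^ serre_deg C i j * serre_coeff C 1 i j p"
proof -
  obtain q where N: "serre_deg C i j = p + q" using assms by (auto simp: le_iff_add)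
  have "(- 1 :: kfield) ^ q = (- 1) ^ (p + q) * (- 1) ^ p"
    by (simp add: power_add flip: power_mult_distrib)
  then show ?thesis unfolding serre_coeff_def kappa_def N by (simp add: ac_simps)
qed

end

context weight_space
begin

text \<open>
  A function that changes by a constant under the shift by \<open>\<sigma>\<close> is known at the weight reached after
  \<open>p\<close> shifts.  Stating it for all such functions avoids naming that weight as a multiple of \<open>\<sigma>\<close>.
\<close>

lemma funpow_weight:
  assumes "\<sigma> \<in> Lat C" "\<forall>\<nu>\<in>Lat C. \<forall>m\<in>wts M \<nu>. X m \<in> wts M (\<nu> + \<sigma>)" "\<nu> \<in> Lat C" "m \<in> wts M \<nu>"
  obtains \<mu> where "\<mu> \<in> Lat C" "(X ^^ p) m \<in> wts M \<mu>"
    and "\<And>h b. \<forall>\<nu>. h (\<nu> + \<sigma>) = h \<nu> + b \<Longrightarrow> h \<mu> = h \<nu> + of_nat p * (b :: rat)"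
proof -
  have "\<exists>\<mu>\<in>Lat C. (X ^^ p) m \<in> wts M \<mu> \<and>
      (\<forall>h b. (\<forall>\<nu>. h (\<nu> + \<sigma>) = h \<nu> + b) \<longrightarrow> h \<mu> = h \<nu> + of_nat p * (b :: rat))"
  proof (induction p)
    case (Suc p)
    then obtain \<mu> where \<mu>: "\<mu> \<in> Lat C" "(X ^^ p) m \<in> wts M \<mu>"
      "\<forall>h b. (\<forall>\<nu>. h (\<nu> + \<sigma>) = h \<nu> + b) \<longrightarrow> h \<mu> = h \<nu> + of_nat p * (b :: rat)" by blast
    have "(X ^^ Suc p) m \<in> wts M (\<mu> + \<sigma>)" using assms(2) \<mu> by simp
    moreover have "h (\<mu> + \<sigma>) = h \<nu> + of_nat (Suc p) * b" if "\<forall>\<nu>. h (\<nu> + \<sigma>) = h \<nu> + b" for h and b :: rat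
    proof -
      have "h (\<mu> + \<sigma>) = h \<mu> + b" "h \<mu> = h \<nu> + of_nat p * b" using that \<mu>(3) by blast+
      then show ?thesis by (simp add: distrib_right)
    qed
    ultimately show ?case using \<mu>(1) assms(1) Lat_add by blast
  qed (use assms in auto)
  then show thesis using that by blast
qed

text \<open>
  Each application of \<open>X\<close> raises the exponent of the next one by \<open>a\<close>, which accumulates to
  \<open>0 + 1 + \<dots> + (p - 1)\<close> times \<open>a\<close>.
\<close>

lemma funpow_twist:
  assumes X: "X \<in> lin_ops M" and r: "r \<noteq> 0" and \<sigma>: "\<sigma> \<in> Lat C"
    and shX: "\<forall>\<nu>\<in>Lat C. \<forall>m\<in>wts M \<nu>. X m \<in> wts M (\<nu> + \<sigma>)"
    and X': "\<forall>\<nu>\<in>Lat C. \<forall>m\<in>wts M \<nu>. X' m = scl M (c * tpow C r (f \<nu>)) (X m)"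
    and f: "\<forall>\<nu>\<in>Lat C. f \<nu> \<in> exponents" "\<forall>\<nu>. f (\<nu> + \<sigma>) = f \<nu> + a" and a: "a \<in> exponents"
    and \<nu>: "\<nu> \<in> Lat C" and m: "m \<in> wts M \<nu>"
  shows "(X' ^^ p) m = scl M (c ^ p * tpow C r (of_nat p * f \<nu> + of_nat (p choose 2) * a)) ((X ^^ p) m)"
proof (induction p)
  case (Suc p)
  let ?k = "c ^ p * tpow C r (of_nat p * f \<nu> + of_nat (p choose 2) * a)"
  obtain \<mu> where L: "\<mu> \<in> Lat C" and W: "(X ^^ p) m \<in> wts M \<mu>"
    and F: "\<And>h b. \<forall>\<nu>. h (\<nu> + \<sigma>) = h \<nu> + b \<Longrightarrow> h \<mu> = h \<nu> + of_nat p * (b :: rat)"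
    using funpow_weight[OF \<sigma> shX \<nu> m] by blast
  have "(X' ^^ Suc p) m = X' (scl M ?k ((X ^^ p) m))" using Suc by simp
  also have "\<dots> = scl M (c * tpow C r (f \<mu>) * ?k) (X ((X ^^ p) m))"
    using bspec[OF bspec[OF X' L] wts_scale[OF L W, of ?k]]
      linear_on_scale[OF lin_opsD(2)[OF X] wts_carrier[OF L W]] by simp
  also have "c * tpow C r (f \<mu>) * ?k =
      c ^ Suc p * tpow C r (f \<mu> + (of_nat p * f \<nu> + of_nat (p choose 2) * a))"
    using r f(1) L \<nu> a by (subst tpow_add) auto
  also have "f \<mu> + (of_nat p * f \<nu> + of_nat (p choose 2) * a) =
      of_nat (Suc p) * f \<nu> + of_nat (Suc p choose 2) * a"
    by (simp add: F[OF f(2)] numeral_2_eq_2 algebra_simps)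
  finally show ?case by simp
qed (simp add: binomial_eq_0)

text \<open>
  Rescaling two operators by powers with exponents affine in the weight rescales the word
  \<open>X\<^sup>pYX\<^sup>q\<close> by a power whose dependence on \<open>p\<close>, for fixed \<open>p + q\<close>, comes from the two numbers \<open>b\<close>
  and \<open>e\<close> by which \<open>X\<close> and \<open>Y\<close> change each other's exponent.
\<close>

lemma word_twist:
  assumes X: "X \<in> lin_ops M" and Y: "Y \<in> lin_ops M" and r: "r \<noteq> 0" and \<sigma>: "\<sigma> \<in> Lat C" and \<tau>: "\<tau> \<in> Lat C"
    and shX: "\<forall>\<nu>\<in>Lat C. \<forall>m\<in>wts M \<nu>. X m \<in> wts M (\<nu> + \<sigma>)"
    and shY: "\<forall>\<nu>\<in>Lat C. \<forall>m\<in>wts M \<nu>. Y m \<in> wts M (\<nu> + \<tau>)"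
    and X': "\<forall>\<nu>\<in>Lat C. \<forall>m\<in>wts M \<nu>. X' m = scl M (c * tpow C r (f \<nu>)) (X m)"
    and Y': "\<forall>\<nu>\<in>Lat C. \<forall>m\<in>wts M \<nu>. Y' m = scl M (c * tpow C r (g \<nu>)) (Y m)"
    and f: "\<forall>\<nu>\<in>Lat C. f \<nu> \<in> exponents" "\<forall>\<nu>. f (\<nu> + \<sigma>) = f \<nu> + a" "\<forall>\<nu>. f (\<nu> + \<tau>) = f \<nu> + e"
    and g: "\<forall>\<nu>\<in>Lat C. g \<nu> \<in> exponents" "\<forall>\<nu>. g (\<nu> + \<sigma>) = g \<nu> + b"
    and abe: "a \<in> exponents" "b \<in> exponents" "e \<in> exponents"
    and \<nu>: "\<nu> \<in> Lat C" and m: "m \<in> wts M \<nu>"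
  shows "(X' ^^ p) (Y' ((X' ^^ q) m)) =
    scl M (c ^ Suc (p + q) * tpow C r (of_nat (p + q) * f \<nu> + g \<nu> + of_nat ((p + q) choose 2) * a +
        of_nat q * b + of_nat p * e)) ((X ^^ p) (Y ((X ^^ q) m)))"
proof -
  obtain \<mu> where L\<mu>: "\<mu> \<in> Lat C" and W: "(X ^^ q) m \<in> wts M \<mu>"
    and F: "\<And>h b. \<forall>\<nu>. h (\<nu> + \<sigma>) = h \<nu> + b \<Longrightarrow> h \<mu> = h \<nu> + of_nat q * (b :: rat)"
    using funpow_weight[OF \<sigma> shX \<nu> m] by blast
  note tw = funpow_twist[where f = f, OF X r \<sigma> shX X' f(1,2) abe(1)]
  let ?k = "c ^ q * tpow C r (of_nat q * f \<nu> + of_nat (q choose 2) * a)"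
  have Yq: "Y ((X ^^ q) m) \<in> wts M (\<mu> + \<tau>)" using shY L\<mu> W by blast
  have L: "\<mu> + \<tau> \<in> Lat C" using L\<mu> \<tau> by simp
  have "Y' ((X' ^^ q) m) = scl M (c * tpow C r (g \<mu>) * ?k) (Y ((X ^^ q) m))"
    unfolding tw[OF \<nu> m, of q] using bspec[OF bspec[OF Y' L\<mu>] wts_scale[OF L\<mu> W, of ?k]]
      linear_on_scale[OF lin_opsD(2)[OF Y] wts_carrier[OF L\<mu> W]] by simp
  moreover have Z: "\<dots> \<in> wts M (\<mu> + \<tau>)" using wts_scale[OF L Yq] .
  ultimately have "(X' ^^ p) (Y' ((X' ^^ q) m)) =
      scl M (c ^ p * tpow C r (of_nat p * f (\<mu> + \<tau>) + of_nat (p choose 2) * a) *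
        (c * tpow C r (g \<mu>) * ?k)) ((X ^^ p) (Y ((X ^^ q) m)))"
    using tw[OF L Z, of p] linear_on_scale[OF lin_opsD(2)[OF funpow_lin_ops[OF X]] wts_carrier[OF L Yq]]
    by simp
  also have "c ^ p * tpow C r (of_nat p * f (\<mu> + \<tau>) + of_nat (p choose 2) * a) * (c * tpow C r (g \<mu>) * ?k) =
     c ^ Suc (p + q) * tpow C r (of_nat p * f (\<mu> + \<tau>) + of_nat (p choose 2) * a + (g \<mu> +
        (of_nat q * f \<nu> + of_nat (q choose 2) * a)))"
    using r bspec[OF f(1) L] bspec[OF f(1) \<nu>] bspec[OF g(1) L\<mu>] abe by (simp add: tpow_add power_add)
  also have "of_nat p * f (\<mu> + \<tau>) + of_nat (p choose 2) * a + (g \<mu> +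
        (of_nat q * f \<nu> + of_nat (q choose 2) * a)) =
      of_nat (p + q) * f \<nu> + g \<nu> + of_nat ((p + q) choose 2) * a + of_nat q * b + of_nat p * e"
    by (simp add: f(3) F[OF f(2)] F[OF g(2)] choose_two_add algebra_simps)
  finally show ?thesis .
qed

end


section \<open>Transport of weight representations\<close>

context weight_space
begin

lemma transport_gen_hom:
  assumes "\<nu> \<in> Lat C" "m \<in> wts M \<nu>" and rep: "weight_rep C 1 M (\<lambda>g. act M (qgen C 1 g))"
  shows "transport_gen C M (GE i) m = scl M (tpow C troot (pairing C \<nu> (simple_root i))) (act M (qgen C 1 (GE i)) m)"
    and "transport_gen C M (GF i) m =
      scl M (tpow C troot (of_int (Om C i i) - pairing C (simple_root i) \<nu>)) (act M (qgen C 1 (GF i)) m)"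
    and "transport_gen C M (GK i) m = scl M (kchar C troot i \<nu>) m"
    and "transport_gen C M (GKinv i) m = scl M (inverse (kchar C troot i \<nu>)) m"
    and "transport_gen C M (GL i) m = scl M (lchar C troot i \<nu>) m"
    and "transport_gen C M (GLinv i) m = scl M (inverse (lchar C troot i \<nu>)) m"
  using linear_on_scale[OF lin_opsD(2)[OF weight_repD(1)[OF rep]]] wts_carrier[OF assms(1,2)]
  by (simp_all add: wscale_hom[OF assms(1,2)] kchar_def lchar_def)

text \<open>
  In the commutator of \<open>E\<^sub>i\<close> and \<open>F\<^sub>j\<close> both products acquire the same power of \<open>t\<close>, and for \<open>i = j\<close> it
  is the power that distinguishes the eigenvalues of \<open>K\<^sub>i\<close> and \<open>K'\<^sub>i\<close> from those at \<open>t = 1\<close>.  The Serre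
  sums at \<open>t\<close> are a constant times those at \<open>t = 1\<close>.
\<close>

lemma weight_rep_transport:
  assumes rep: "weight_rep C 1 M (\<lambda>g. act M (qgen C 1 g))"
  shows "weight_rep C troot M (transport_gen C M)"
proof -
  let ?E = "\<lambda>i. act M (qgen C 1 (GE i))" and ?F = "\<lambda>i. act M (qgen C 1 (GF i))"
  note ops = weight_repD(1)[OF rep] and gen = transport_gen_hom[OF _ _ rep]
  have comp: "(\<lambda>m. f (g m)) \<in> lin_ops M" if "f \<in> lin_ops M" "g \<in> lin_ops M" for f g
    using that by (auto simp: lin_ops_def linear_on_def Pi_iff)
  have ops_t: "transport_gen C M g \<in> lin_ops M" for g
    by (cases g) (simp_all add: comp ops wscale_lin_ops)
  have EE: "\<forall>\<nu>\<in>Lat C. \<forall>m\<in>wts M \<nu>. ?E i m \<in> wts M (\<nu> + simple_root i)"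
    and FF: "\<forall>\<nu>\<in>Lat C. \<forall>m\<in>wts M \<nu>. ?F i m \<in> wts M (\<nu> + - simple_root i)" for i
    using weight_repD(2,3)[OF rep] by simp_all
  have gE: "\<forall>\<nu>\<in>Lat C. \<forall>m\<in>wts M \<nu>. transport_gen C M (GE i) m =
      scl M (1 * tpow C troot (pairing C \<nu> (simple_root i))) (?E i m)"
    and gF: "\<forall>\<nu>\<in>Lat C. \<forall>m\<in>wts M \<nu>. transport_gen C M (GF i) m =
      scl M (1 * tpow C troot (of_int (Om C i i) - pairing C (simple_root i) \<nu>)) (?F i m)" for i
    using gen(1,2) by simp_all
  note Serre_E = word_twist[where f = "\<lambda>\<nu>. pairing C \<nu> (simple_root i)" and g = "\<lambda>\<nu>. pairing C \<nu> (simple_root j)" for i j, OF ops ops troot_nonzero Lat_simple_root Lat_simple_root EE EE gE gE]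
  note Serre_F = word_twist[where f = "\<lambda>\<nu>. of_int (Om C i i) - pairing C (simple_root i) \<nu>"
    and g = "\<lambda>\<nu>. of_int (Om C j j) - pairing C (simple_root j) \<nu>" for i j, OF ops ops troot_nonzero Lat_minus[OF Lat_simple_root] Lat_minus[OF Lat_simple_root] FF FF gF gF]
  show ?thesis
    unfolding weight_rep_def
  proof (intro conjI ballI allI impI)
    fix g show "transport_gen C M g \<in> lin_ops M" by (rule ops_t)
  next
    fix \<nu> m i assume \<nu>: "\<nu> \<in> Lat C" and w: "m \<in> wts M \<nu>"
    have m: "m \<in> vcar M" by (rule wts_carrier[OF \<nu> w])
    have L: "\<nu> + simple_root k \<in> Lat C" "\<nu> - simple_root k \<in> Lat C" for k using \<nu> by simp_all
    show "transport_gen C M (GE i) m \<in> wts M (\<nu> + simple_root i)"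
      and "transport_gen C M (GF i) m \<in> wts M (\<nu> - simple_root i)"
      unfolding gen(1,2)[OF \<nu> w] by (intro wts_scale L weight_repD(2,3)[OF rep \<nu> w])+
    show "transport_gen C M (GK i) m = scl M (kchar C troot i \<nu>) m"
      "transport_gen C M (GKinv i) m = scl M (inverse (kchar C troot i \<nu>)) m"
      "transport_gen C M (GL i) m = scl M (lchar C troot i \<nu>) m"
      "transport_gen C M (GLinv i) m = scl M (inverse (lchar C troot i \<nu>)) m"
      by (rule gen[OF \<nu> w])+
    fix j
    have carE: "?E k m \<in> vcar M" "?F k m \<in> vcar M" for k using ops m lin_opsD(1) by blast+
    have lin: "act M (qgen C 1 g) (scl M c y) = scl M c (act M (qgen C 1 g) y)" if "y \<in> vcar M" for g c y
      using ops that linear_on_scale[OF lin_opsD(2)] by blast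
    let ?e = "of_int (Om C j j) - pairing C (simple_root j) \<nu> + pairing C \<nu> (simple_root i) - of_int (Om C j i)"
    have "transport_gen C M (GE i) (transport_gen C M (GF j) m) =
        scl M (tpow C troot (of_int (Om C j j) - pairing C (simple_root j) \<nu>) *
          tpow C troot (pairing C (\<nu> - simple_root j) (simple_root i))) (?E i (?F j m))"
      unfolding gen(2)[OF \<nu> w] gen(1)[OF L(2) wts_scale[OF L(2) weight_repD(3)[OF rep \<nu> w]]]
      by (simp add: lin carE mult.commute)
    also have "tpow C troot (of_int (Om C j j) - pairing C (simple_root j) \<nu>) *
          tpow C troot (pairing C (\<nu> - simple_root j) (simple_root i)) = tpow C troot ?e"
      using \<nu> by (subst tpow_add[symmetric]) (auto simp: pairing_simps algebra_simps)
    finally have EF: "transport_gen C M (GE i) (transport_gen C M (GF j) m) = scl M (tpow C troot ?e) (?E i (?F j m))" .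
    have "transport_gen C M (GF j) (transport_gen C M (GE i) m) =
        scl M (tpow C troot (pairing C \<nu> (simple_root i)) *
          tpow C troot (of_int (Om C j j) - pairing C (simple_root j) (\<nu> + simple_root i))) (?F j (?E i m))"
      unfolding gen(1)[OF \<nu> w] gen(2)[OF L(1) wts_scale[OF L(1) weight_repD(2)[OF rep \<nu> w]]]
      by (simp add: lin carE mult.commute)
    also have "tpow C troot (pairing C \<nu> (simple_root i)) *
          tpow C troot (of_int (Om C j j) - pairing C (simple_root j) (\<nu> + simple_root i)) = tpow C troot ?e"
      using \<nu> by (subst tpow_add[symmetric]) (auto simp: pairing_simps algebra_simps)
    finally have "transport_gen C M (GE i) (transport_gen C M (GF j) m) - transport_gen C M (GF j) (transport_gen C M (GE i) m)
        = scl M (tpow C troot ?e) (?E i (?F j m) - ?F j (?E i m))"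
      using EF by (simp add: scale_right_diff_distrib)
    also have "\<dots> = (if i = j then scl M (inverse (v_i C i - inverse (v_i C i)) * (kchar C troot i \<nu> - lchar C troot i \<nu>)) m
          else 0)"
      unfolding weight_repD(8)[OF rep \<nu> w]
      by (auto simp: kchar_def lchar_def algebra_simps)
    finally show "transport_gen C M (GE i) (transport_gen C M (GF j) m) - transport_gen C M (GF j) (transport_gen C M (GE i) m) =
        (if i = j then scl M (inverse (v_i C i - inverse (v_i C i)) * (kchar C troot i \<nu> - lchar C troot i \<nu>)) m
          else 0)" .
    assume ij: "i \<noteq> j"
    let ?N = "serre_deg C i j"
    \<comment> \<open>The part of the exponent linear in \<open>p\<close> left over from the coefficients cancels against the one from the word.\<close>
    have coeff: "serre_coeff C troot i j p * tpow C troot x = tpow C troot (y + of_nat ?N * of_int (Om C i j)) * serre_coeff C 1 i j p"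
      if p: "p \<le> ?N" and "x = y + of_nat (?N choose 2) * of_int (Om C i i) + of_nat (?N - p) * of_int (Om C i j) + of_nat p * of_int (Om C j i)"
        and "y \<in> exponents" for p x y
    proof -
      have x: "x \<in> exponents"
        unfolding that(2) by (intro exponents_add exponents_mult exponents_of_int that(3))
      obtain q where N: "?N = p + q" using le_Suc_ex[OF p] by blast
      show ?thesis
        unfolding serre_coeff_twist[OF troot_nonzero that(1)] mult.assoc mult.commute[of "serre_coeff C 1 i j p"]
        unfolding mult.assoc[symmetric] tpow_add[OF troot_nonzero exponents_of_int x, symmetric]
        by (rule arg_cong[where f = "\<lambda>z. tpow C troot z * serre_coeff C 1 i j p"])
          (simp add: that(2) N algebra_simps)
    qed
    have "(\<Sum>p\<le>?N. scl M (serre_coeff C troot i j p)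
            ((transport_gen C M (GE i) ^^ p) (transport_gen C M (GE j) ((transport_gen C M (GE i) ^^ (?N - p)) m)))) =
      (\<Sum>p\<le>?N. scl M (tpow C troot (of_nat ?N * pairing C \<nu> (simple_root i) + pairing C \<nu> (simple_root j) +
            of_nat ?N * of_int (Om C i j)) * serre_coeff C 1 i j p)
          ((?E i ^^ p) (?E j ((?E i ^^ (?N - p)) m))))"
    proof (rule sum.cong, simp)
      fix p assume "p \<in> {..?N}"
      then have p: "p \<le> ?N" by simp
      have "(transport_gen C M (GE i) ^^ p) (transport_gen C M (GE j) ((transport_gen C M (GE i) ^^ (?N - p)) m)) =
        scl M (1 ^ Suc (p + (?N - p)) * tpow C troot (of_nat (p + (?N - p)) * pairing C \<nu> (simple_root i) + pairing C \<nu> (simple_root j) +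
          of_nat ((p + (?N - p)) choose 2) * of_int (Om C i i) + of_nat (?N - p) * of_int (Om C i j) + of_nat p * of_int (Om C j i)))
          ((?E i ^^ p) (?E j ((?E i ^^ (?N - p)) m)))"
        by (rule Serre_E) (use \<nu> w in \<open>simp_all add: pairing_simps\<close>)
      then show "scl M (serre_coeff C troot i j p)
            ((transport_gen C M (GE i) ^^ p) (transport_gen C M (GE j) ((transport_gen C M (GE i) ^^ (?N - p)) m))) =
          scl M (tpow C troot (of_nat ?N * pairing C \<nu> (simple_root i) + pairing C \<nu> (simple_root j) +
            of_nat ?N * of_int (Om C i j)) * serre_coeff C 1 i j p)
          ((?E i ^^ p) (?E j ((?E i ^^ (?N - p)) m)))"
        using p \<nu> by (simp add: coeff)
    qed
    also have "\<dots> = 0"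
      using weight_repD(9)[OF rep \<nu> w ij] by (simp flip: scale_scale scale_sum_right)
    finally show "(\<Sum>p\<le>?N. scl M (serre_coeff C troot i j p)
            ((transport_gen C M (GE i) ^^ p) (transport_gen C M (GE j) ((transport_gen C M (GE i) ^^ (?N - p)) m)))) = 0" .
    let ?f = "\<lambda>k. of_int (Om C k k) - pairing C (simple_root k) \<nu>"
    have "(\<Sum>p\<le>?N. scl M (serre_coeff C troot i j p)
            ((transport_gen C M (GF i) ^^ (?N - p)) (transport_gen C M (GF j) ((transport_gen C M (GF i) ^^ p) m)))) =
      (\<Sum>p\<le>?N. scl M (tpow C troot (of_nat ?N * ?f i + ?f j + of_nat ?N * of_int (Om C i j)) * serre_coeff C 1 i j p)
          ((?F i ^^ (?N - p)) (?F j ((?F i ^^ p) m))))"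
    proof (rule sum.cong, simp)
      fix p assume "p \<in> {..?N}"
      then have p: "p \<le> ?N" by simp
      have "(transport_gen C M (GF i) ^^ (?N - p)) (transport_gen C M (GF j) ((transport_gen C M (GF i) ^^ p) m)) =
        scl M (1 ^ Suc (?N - p + p) * tpow C troot (of_nat (?N - p + p) * ?f i + ?f j +
          of_nat ((?N - p + p) choose 2) * of_int (Om C i i) + of_nat p * of_int (Om C j i) + of_nat (?N - p) * of_int (Om C i j)))
          ((?F i ^^ (?N - p)) (?F j ((?F i ^^ p) m)))"
        by (rule Serre_F) (use \<nu> w in \<open>simp_all add: pairing_simps\<close>)
      then show "scl M (serre_coeff C troot i j p)
            ((transport_gen C M (GF i) ^^ (?N - p)) (transport_gen C M (GF j) ((transport_gen C M (GF i) ^^ p) m))) =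
          scl M (tpow C troot (of_nat ?N * ?f i + ?f j + of_nat ?N * of_int (Om C i j)) * serre_coeff C 1 i j p)
          ((?F i ^^ (?N - p)) (?F j ((?F i ^^ p) m)))"
        using p \<nu> coeff[OF p, of "of_nat ?N * ?f i + ?f j + of_nat (?N choose 2) * of_int (Om C i i) +
          of_nat p * of_int (Om C j i) + of_nat (?N - p) * of_int (Om C i j)" "of_nat ?N * ?f i + ?f j"]
        by simp
    qed
    also have "\<dots> = 0"
      using weight_repD(10)[OF rep \<nu> w ij] by (simp flip: scale_scale scale_sum_right)
    finally show "(\<Sum>p\<le>?N. scl M (serre_coeff C troot i j p)
            ((transport_gen C M (GF i) ^^ (?N - p)) (transport_gen C M (GF j) ((transport_gen C M (GF i) ^^ p) m)))) = 0" .
  qed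
qed

end


section \<open>The dual of a weight representation\<close>

lemma sum_fun_apply: "(\<Sum>a\<in>A. f a) x = (\<Sum>a\<in>A. f a x :: 'b::comm_monoid_add)"
  by (induction A rule: infinite_finite_induct) auto

definition transpose :: "('i, 'm::ab_group_add) wmod \<Rightarrow> ('m \<Rightarrow> 'm) \<Rightarrow> ('m \<Rightarrow> kfield) \<Rightarrow> 'm \<Rightarrow> kfield" where
  "transpose M f \<phi> = (\<lambda>m. if m \<in> vcar M then \<phi> (f m) else 0)"

lemma transpose_apply: "m \<in> vcar M \<Longrightarrow> transpose M f \<phi> m = \<phi> (f m)"
  by (simp add: transpose_def)

lemma (in carrier_space) transpose_lin_ops: "f \<in> lin_ops M \<Longrightarrow> transpose M f \<in> lin_ops (dual C s M)"
  using dual_space_comp[of _ f] by (auto simp: lin_ops_def[of "dual C s M"] linear_on_def transpose_def fun_eq_iff)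

lemma transpose_funpow:
  assumes "f \<in> lin_ops M" "m \<in> vcar M"
  shows "(transpose M f ^^ n) \<phi> m = \<phi> ((f ^^ n) m)"
  using assms(2)
proof (induction n arbitrary: m)
  case (Suc n)
  then have "f m \<in> vcar M" using assms(1) by (simp add: lin_opsD)
  then show ?case using Suc by (simp add: transpose_def funpow_swap1)
qed simp

lemma dual_wts: "wts (dual C s M) \<kappa> =
    {\<phi> \<in> dual_space M. \<forall>\<mu>\<in>Lat C. \<mu> \<noteq> - \<kappa> \<longrightarrow> (\<forall>m\<in>wts M \<mu>. \<phi> m = 0)}"
  by (simp add: dual_def)

context weight_space
begin

lemma dual_eqI:
  assumes "\<phi> \<in> dual_space M" "\<psi> \<in> dual_space M"
    and "\<And>\<nu> m. \<nu> \<in> Lat C \<Longrightarrow> m \<in> wts M \<nu> \<Longrightarrow> \<phi> m = \<psi> m"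
  shows "\<phi> = \<psi>"
  using assms(1,2)
  by (rule dual_space_eqI) (rule linear_on_eqI[OF dual_space_linear_on[OF assms(1)] dual_space_linear_on[OF assms(2)] assms(3)])

lemma dual_wtsI:
  "\<phi> \<in> dual_space M \<Longrightarrow> (\<And>\<mu> m. \<mu> \<in> Lat C \<Longrightarrow> m \<in> wts M \<mu> \<Longrightarrow> \<phi> m \<noteq> 0 \<Longrightarrow> \<mu> = - \<kappa>) \<Longrightarrow>
    \<phi> \<in> wts (dual C s M) \<kappa>"
  by (auto simp: dual_wts)

lemma dual_wtsD:
  "\<phi> \<in> wts (dual C s M) \<kappa> \<Longrightarrow> \<phi> \<in> dual_space M"
  "\<phi> \<in> wts (dual C s M) \<kappa> \<Longrightarrow> \<mu> \<in> Lat C \<Longrightarrow> m \<in> wts M \<mu> \<Longrightarrow> \<phi> m \<noteq> 0 \<Longrightarrow> \<mu> = - \<kappa>"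
  by (auto simp: dual_wts)

lemma serre_sum_reverse:
  "(\<Sum>p\<le>serre_deg C i j. scl M (serre_coeff C 1 i j p) (W (serre_deg C i j - p))) =
    scl M ((- 1) ^ serre_deg C i j) (\<Sum>p\<le>serre_deg C i j. scl M (serre_coeff C 1 i j p) (W p))"
proof -
  let ?N = "serre_deg C i j"
  have "(\<Sum>p\<le>?N. scl M (serre_coeff C 1 i j p) (W (?N - p))) =
      (\<Sum>p\<le>?N. scl M (serre_coeff C 1 i j (?N - p)) (W p))"
    by (rule sum.reindex_bij_witness[of _ "\<lambda>p. ?N - p" "\<lambda>p. ?N - p"]) auto
  also have "\<dots> = (\<Sum>p\<le>?N. scl M ((- 1) ^ ?N) (scl M (serre_coeff C 1 i j p) (W p)))"
    by (intro sum.cong refl) (simp add: serre_coeff_reverse)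
  finally show ?thesis by (simp only: scale_sum_right)
qed

text \<open>
  Transposition turns the Serre sum into the one with all words reversed, which equals the original
  sum up to sign.
\<close>

lemma transpose_serre:
  assumes X: "X \<in> lin_ops M" and Y: "Y \<in> lin_ops M" and \<phi>: "\<phi> \<in> dual_space M"
    and serre: "\<And>\<nu> m. \<nu> \<in> Lat C \<Longrightarrow> m \<in> wts M \<nu> \<Longrightarrow>
      (\<Sum>p\<le>serre_deg C i j. scl M (serre_coeff C 1 i j p) ((X ^^ p) (Y ((X ^^ (serre_deg C i j - p)) m)))) = 0"
  shows "(\<Sum>p\<le>serre_deg C i j. (\<lambda>m. serre_coeff C 1 i j p *
      (transpose M X ^^ p) (transpose M Y ((transpose M X ^^ (serre_deg C i j - p)) \<phi>)) m)) = 0"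
    (is "?S = 0")
proof -
  let ?N = "serre_deg C i j"
  interpret D: weight_space C "dual C 1 M" by (rule weight_space_dual)
  have T: "(transpose M X ^^ p) (transpose M Y ((transpose M X ^^ q) \<phi>)) \<in> vcar (dual C 1 M)" for p q
    using \<phi> by (intro lin_opsD(1)[OF funpow_lin_ops[OF transpose_lin_ops[OF X, of C 1]]]
        lin_opsD(1)[OF transpose_lin_ops[OF Y, of C 1]]) simp
  have S: "?S \<in> dual_space M"
    using D.carrier_sum[of "{..?N}" "\<lambda>p. scl (dual C 1 M) (serre_coeff C 1 i j p)
      ((transpose M X ^^ p) (transpose M Y ((transpose M X ^^ (serre_deg C i j - p)) \<phi>)))"] T D.carrier_scale
    by simp
  show ?thesis
  proof (rule dual_eqI[OF S])
    show "0 \<in> dual_space M" using D.carrier_0 by simp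
    fix \<nu> m assume \<nu>: "\<nu> \<in> Lat C" and w: "m \<in> wts M \<nu>"
    have m: "m \<in> vcar M" by (rule wts_carrier[OF \<nu> w])
    have Xm: "(X ^^ p) y \<in> vcar M" and Ym: "Y y \<in> vcar M" if "y \<in> vcar M" for p y
      using that lin_opsD(1)[OF funpow_lin_ops[OF X]] lin_opsD(1)[OF Y] by auto
    have "?S m = (\<Sum>p\<le>?N. serre_coeff C 1 i j p * \<phi> ((X ^^ (?N - p)) (Y ((X ^^ p) m))))"
      by (simp add: sum_fun_apply transpose_funpow[OF X] transpose_apply m Xm Ym)
    also have "\<dots> = \<phi> (\<Sum>p\<le>?N. scl M (serre_coeff C 1 i j p) ((X ^^ (?N - p)) (Y ((X ^^ p) m))))"
      by (subst linear_on_sum[OF dual_space_linear_on[OF \<phi>]])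
        (simp_all add: m Xm Ym linear_on_scale[OF dual_space_linear_on[OF \<phi>]])
    also have "(\<Sum>p\<le>?N. scl M (serre_coeff C 1 i j p) ((X ^^ (?N - p)) (Y ((X ^^ p) m)))) =
       (\<Sum>p\<le>?N. scl M (serre_coeff C 1 i j p) ((X ^^ (?N - p)) (Y ((X ^^ (?N - (?N - p))) m))))"
      by (intro sum.cong) auto
    also have "\<dots> = 0"
      unfolding serre_sum_reverse[of i j "\<lambda>p. (X ^^ p) (Y ((X ^^ (?N - p)) m))"] serre[OF \<nu> w] by simp
    finally show "?S m = 0 m" by (simp add: linear_on_0[OF dual_space_linear_on[OF \<phi>]])
  qed
qed

lemma char_1: "kchar C 1 i \<nu> = tpow C vroot (dotp C (simple_root i) \<nu>)"
  "lchar C 1 i \<nu> = tpow C vroot (- dotp C (simple_root i) \<nu>)"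
  by (simp_all add: kchar_def lchar_def vpow_tpow)

context
  fixes s \<rho>
  assumes s: "s \<noteq> 0" and rep: "weight_rep C s M \<rho>"
begin

text \<open>
  Evaluated on a weight vector, the antipode contributes only a Cartan eigenvalue.  In \<open>S(E\<^sub>i)\<close> the
  Cartan element acts after \<open>E\<^sub>i\<close>, hence the shifted weight; in \<open>S(F\<^sub>i)\<close> it acts first.
\<close>

lemma dual_gen_hom:
  assumes "\<phi> \<in> dual_space M" and \<nu>: "\<nu> \<in> Lat C" and w: "m \<in> wts M \<nu>"
  shows "dual_gen M \<rho> (GE i) \<phi> m = - inverse (kchar C s i (\<nu> + simple_root i)) * \<phi> (\<rho> (GE i) m)"
    and "dual_gen M \<rho> (GF i) \<phi> m = - inverse (lchar C s i \<nu>) * \<phi> (\<rho> (GF i) m)"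
    and "dual_gen M \<rho> (GK i) \<phi> m = inverse (kchar C s i \<nu>) * \<phi> m"
    and "dual_gen M \<rho> (GKinv i) \<phi> m = kchar C s i \<nu> * \<phi> m"
    and "dual_gen M \<rho> (GL i) \<phi> m = inverse (lchar C s i \<nu>) * \<phi> m"
    and "dual_gen M \<rho> (GLinv i) \<phi> m = lchar C s i \<nu> * \<phi> m"
proof -
  have ops: "\<forall>g. \<rho> g \<in> lin_ops M" using weight_repD(1)[OF rep] by blast
  have m: "m \<in> vcar M" by (rule wts_carrier[OF \<nu> w])
  have car: "\<rho> g y \<in> vcar M" if "y \<in> vcar M" for g y using that ops lin_opsD(1) by blast
  have lin: "\<rho> g (scl M a y) = scl M a (\<rho> g y)" if "y \<in> vcar M" for g a y
    using that linear_on_scale[OF lin_opsD(2)] ops by blast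
  note \<phi> = linear_on_scale[OF dual_space_linear_on[OF assms(1)]] linear_on_neg[OF dual_space_linear_on[OF assms(1)]]
  have KE: "\<rho> (GKinv i) (\<rho> (GE i) m) = scl M (inverse (kchar C s i (\<nu> + simple_root i))) (\<rho> (GE i) m)"
    using weight_repD(5)[OF rep _ weight_repD(2)[OF rep \<nu> w]] \<nu> by simp
  note simps = dual_gen_def m free_action_neg free_action_mult[OF ops] free_action_fgen \<phi> car lin
    KE weight_repD(4-7)[OF rep \<nu> w]
  show "dual_gen M \<rho> (GE i) \<phi> m = - inverse (kchar C s i (\<nu> + simple_root i)) * \<phi> (\<rho> (GE i) m)"
    "dual_gen M \<rho> (GF i) \<phi> m = - inverse (lchar C s i \<nu>) * \<phi> (\<rho> (GF i) m)"
    "dual_gen M \<rho> (GK i) \<phi> m = inverse (kchar C s i \<nu>) * \<phi> m"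
    "dual_gen M \<rho> (GKinv i) \<phi> m = kchar C s i \<nu> * \<phi> m"
    "dual_gen M \<rho> (GL i) \<phi> m = inverse (lchar C s i \<nu>) * \<phi> m"
    "dual_gen M \<rho> (GLinv i) \<phi> m = lchar C s i \<nu> * \<phi> m"
    by (simp_all add: simps)
qed

end

text \<open>
  At \<open>t = 1\<close> the operators on the dual are, up to sign and powers of \<open>v\<close> with exponents
  affine in the weight, the transposes of the operators on \<open>M\<close>.  Transposing reverses words; the coefficients of the quantum Serre
  relation at \<open>t = 1\<close> are symmetric up to sign under this reversal.
\<close>

lemma weight_rep_dual:
  assumes rep: "weight_rep C 1 M \<rho>"
  shows "weight_rep C 1 (dual C 1 M) (dual_gen M \<rho>)"
proof -
  interpret D: weight_space C "dual C 1 M" by (rule weight_space_dual)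
  have ops: "\<forall>g. \<rho> g \<in> lin_ops M" using weight_repD(1)[OF rep] by blast
  have one: "(1 :: kfield) \<noteq> 0" by simp
  note hom = dual_gen_hom[OF one rep]
  let ?T = "\<lambda>g. transpose M (\<rho> g)"
  have opsT: "?T g \<in> lin_ops (dual C 1 M)" for g using transpose_lin_ops ops by blast
  have opsD: "dual_gen M \<rho> g \<in> lin_ops (dual C 1 M)" for g by (rule dual_gen_lin_ops[OF ops])
  have car: "\<rho> g y \<in> vcar M" if "y \<in> vcar M" for g y
    using that lin_opsD(1) ops by blast
  have TE: "\<forall>\<kappa>\<in>Lat C. \<forall>\<phi>\<in>wts (dual C 1 M) \<kappa>. ?T (GE i) \<phi> \<in> wts (dual C 1 M) (\<kappa> + simple_root i)" for i
  proof (intro ballI dual_wtsI)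
    fix \<kappa> \<phi> \<mu> m assume \<kappa>: "\<kappa> \<in> Lat C" "\<phi> \<in> wts (dual C 1 M) \<kappa>"
    show "?T (GE i) \<phi> \<in> dual_space M" using lin_opsD(1)[OF opsT] dual_wtsD(1)[OF \<kappa>(2)] by simp
    assume \<mu>: "\<mu> \<in> Lat C" "m \<in> wts M \<mu>" "?T (GE i) \<phi> m \<noteq> 0"
    then have "\<mu> + simple_root i = - \<kappa>"
      using weight_repD(2)[OF rep \<mu>(1,2)]
      by (intro dual_wtsD(2)[OF \<kappa>(2), of _ "\<rho> (GE i) m"]) (auto simp: transpose_def split: if_splits)
    then show "\<mu> = - (\<kappa> + simple_root i)" by (simp add: eq_diff_eq diff_conv_add_uminus[symmetric])
  qed
  have TF: "\<forall>\<kappa>\<in>Lat C. \<forall>\<phi>\<in>wts (dual C 1 M) \<kappa>. ?T (GF i) \<phi> \<in> wts (dual C 1 M) (\<kappa> + - simple_root i)" for i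
  proof (intro ballI dual_wtsI)
    fix \<kappa> \<phi> \<mu> m assume \<kappa>: "\<kappa> \<in> Lat C" "\<phi> \<in> wts (dual C 1 M) \<kappa>"
    show "?T (GF i) \<phi> \<in> dual_space M" using lin_opsD(1)[OF opsT] dual_wtsD(1)[OF \<kappa>(2)] by simp
    assume \<mu>: "\<mu> \<in> Lat C" "m \<in> wts M \<mu>" "?T (GF i) \<phi> m \<noteq> 0"
    then have "\<mu> - simple_root i = - \<kappa>"
      using weight_repD(3)[OF rep \<mu>(1,2)]
      by (intro dual_wtsD(2)[OF \<kappa>(2), of _ "\<rho> (GF i) m"]) (auto simp: transpose_def split: if_splits)
    then show "\<mu> = - (\<kappa> + - simple_root i)" by (simp add: diff_eq_eq)
  qed
  have gE: "\<forall>\<kappa>\<in>Lat C. \<forall>\<phi>\<in>wts (dual C 1 M) \<kappa>. dual_gen M \<rho> (GE i) \<phi> =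
      scl (dual C 1 M) (- 1 * tpow C vroot (dotp C (simple_root i) \<kappa>)) (?T (GE i) \<phi>)" for i
  proof (intro ballI)
    fix \<kappa> \<phi> assume \<kappa>: "\<kappa> \<in> Lat C" "\<phi> \<in> wts (dual C 1 M) \<kappa>"
    note \<phi> = dual_wtsD(1)[OF \<kappa>(2)]
    show "dual_gen M \<rho> (GE i) \<phi> = scl (dual C 1 M) (- 1 * tpow C vroot (dotp C (simple_root i) \<kappa>)) (?T (GE i) \<phi>)"
    proof (rule dual_eqI)
      show "dual_gen M \<rho> (GE i) \<phi> \<in> dual_space M" using lin_opsD(1)[OF opsD] \<phi> by simp
      show "scl (dual C 1 M) (- 1 * tpow C vroot (dotp C (simple_root i) \<kappa>)) (?T (GE i) \<phi>) \<in> dual_space M"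
        unfolding dual_simps(1)[of C 1 M, symmetric]
        by (intro D.carrier_scale lin_opsD(1)[OF opsT]) (simp add: \<phi>)
      fix \<nu> m assume \<nu>: "\<nu> \<in> Lat C" "m \<in> wts M \<nu>"
      show "dual_gen M \<rho> (GE i) \<phi> m = scl (dual C 1 M) (- 1 * tpow C vroot (dotp C (simple_root i) \<kappa>)) (?T (GE i) \<phi>) m"
      proof (cases "\<phi> (\<rho> (GE i) m) = 0")
        case False
        then have "\<nu> + simple_root i = - \<kappa>"
          using weight_repD(2)[OF rep \<nu>] \<nu> by (intro dual_wtsD(2)[OF \<kappa>(2) _ _ False]) auto
        then show ?thesis
          using \<kappa>(1) wts_carrier[OF \<nu>] by (simp add: hom[OF \<phi> \<nu>] char_1 dotp_simps transpose_def tpow_minus)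
      qed (use wts_carrier[OF \<nu>] in \<open>simp add: hom[OF \<phi> \<nu>] transpose_def\<close>)
    qed
  qed
  have gF: "\<forall>\<kappa>\<in>Lat C. \<forall>\<phi>\<in>wts (dual C 1 M) \<kappa>. dual_gen M \<rho> (GF i) \<phi> =
      scl (dual C 1 M) (- 1 * tpow C vroot (dotp C (simple_root i) (simple_root i) - dotp C (simple_root i) \<kappa>)) (?T (GF i) \<phi>)" for i
  proof (intro ballI)
    fix \<kappa> \<phi> assume \<kappa>: "\<kappa> \<in> Lat C" "\<phi> \<in> wts (dual C 1 M) \<kappa>"
    let ?c = "- 1 * tpow C vroot (dotp C (simple_root i) (simple_root i) - dotp C (simple_root i) \<kappa>)"
    note \<phi> = dual_wtsD(1)[OF \<kappa>(2)]
    show "dual_gen M \<rho> (GF i) \<phi> = scl (dual C 1 M) ?c (?T (GF i) \<phi>)"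
    proof (rule dual_eqI)
      show "dual_gen M \<rho> (GF i) \<phi> \<in> dual_space M" using lin_opsD(1)[OF opsD] \<phi> by simp
      show "scl (dual C 1 M) ?c (?T (GF i) \<phi>) \<in> dual_space M"
        unfolding dual_simps(1)[of C 1 M, symmetric]
        by (intro D.carrier_scale lin_opsD(1)[OF opsT]) (simp add: \<phi>)
      fix \<nu> m assume \<nu>: "\<nu> \<in> Lat C" "m \<in> wts M \<nu>"
      show "dual_gen M \<rho> (GF i) \<phi> m = scl (dual C 1 M) ?c (?T (GF i) \<phi>) m"
      proof (cases "\<phi> (\<rho> (GF i) m) = 0")
        case False
        then have "\<nu> - simple_root i = - \<kappa>"
          using weight_repD(3)[OF rep \<nu>] \<nu> by (intro dual_wtsD(2)[OF \<kappa>(2) _ _ False]) auto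
        then have "\<nu> = simple_root i - \<kappa>" by (simp add: diff_eq_eq)
        moreover have "inverse (tpow C vroot (dotp C (simple_root i) \<kappa> - dotp C (simple_root i) (simple_root i))) =
            tpow C vroot (dotp C (simple_root i) (simple_root i) - dotp C (simple_root i) \<kappa>)"
          using \<kappa>(1) by (subst tpow_minus[symmetric]) simp_all
        ultimately show ?thesis
          using \<kappa>(1) wts_carrier[OF \<nu>] by (simp add: hom[OF \<phi> \<nu>] char_1 dotp_simps(4) transpose_def)
      qed (use wts_carrier[OF \<nu>] in \<open>simp add: hom[OF \<phi> \<nu>] transpose_def\<close>)
    qed
  qed
  have cart: "dual_gen M \<rho> g \<phi> = scl (dual C 1 M) c \<phi>"
    if "\<kappa> \<in> Lat C" "\<phi> \<in> wts (dual C 1 M) \<kappa>" "\<And>m. m \<in> wts M (- \<kappa>) \<Longrightarrow> dual_gen M \<rho> g \<phi> m = c * \<phi> m"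
      "\<And>\<nu> m. \<nu> \<in> Lat C \<Longrightarrow> m \<in> wts M \<nu> \<Longrightarrow> \<phi> m = 0 \<Longrightarrow> dual_gen M \<rho> g \<phi> m = 0" for \<kappa> \<phi> g c
  proof (rule dual_eqI)
    note \<phi> = dual_wtsD(1)[OF that(2)]
    show "dual_gen M \<rho> g \<phi> \<in> dual_space M" using lin_opsD(1)[OF opsD] \<phi> by simp
    show "scl (dual C 1 M) c \<phi> \<in> dual_space M" using D.carrier_scale[of \<phi>] \<phi> by simp
    fix \<nu> m assume \<nu>: "\<nu> \<in> Lat C" "m \<in> wts M \<nu>"
    show "dual_gen M \<rho> g \<phi> m = scl (dual C 1 M) c \<phi> m"
      using that(3,4) \<nu> dual_wtsD(2)[OF that(2) \<nu>] by (cases "\<phi> m = 0") auto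
  qed
  note Serre_E = D.word_twist[where f = "\<lambda>\<nu>. dotp C (simple_root i) \<nu>" and g = "\<lambda>\<nu>. dotp C (simple_root j) \<nu>" for i j,
      OF opsT opsT vroot_nonzero Lat_simple_root Lat_simple_root TE TE gE gE]
  note Serre_F = D.word_twist[where f = "\<lambda>\<nu>. dotp C (simple_root i) (simple_root i) - dotp C (simple_root i) \<nu>"
      and g = "\<lambda>\<nu>. dotp C (simple_root j) (simple_root j) - dotp C (simple_root j) \<nu>" for i j,
      OF opsT opsT vroot_nonzero Lat_minus[OF Lat_simple_root] Lat_minus[OF Lat_simple_root] TF TF gF gF]
  have dotp_commute: "dotp C \<nu> \<mu> = dotp C \<mu> \<nu>" for \<nu> \<mu> by (simp add: dotp_def)
  show ?thesis
    unfolding weight_rep_def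
  proof (intro conjI ballI allI impI)
    fix g show "dual_gen M \<rho> g \<in> lin_ops (dual C 1 M)" by (rule opsD)
  next
    fix \<kappa> \<phi> i assume \<kappa>: "\<kappa> \<in> Lat C" and w: "\<phi> \<in> wts (dual C 1 M) \<kappa>"
    note \<phi> = dual_wtsD(1)[OF w]
    have L: "\<kappa> + simple_root k \<in> Lat C" "\<kappa> + - simple_root k \<in> Lat C" for k using \<kappa> by simp_all
    have E: "dual_gen M \<rho> (GE k) \<phi> \<in> wts (dual C 1 M) (\<kappa> + simple_root k)"
      and F: "dual_gen M \<rho> (GF k) \<phi> \<in> wts (dual C 1 M) (\<kappa> + - simple_root k)" for k
      using gE gF TE TF \<kappa> w D.wts_scale[OF L(1)] D.wts_scale[OF L(2)] by metis+
    show "dual_gen M \<rho> (GE i) \<phi> \<in> wts (dual C 1 M) (\<kappa> + simple_root i)" by (rule E)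
    show "dual_gen M \<rho> (GF i) \<phi> \<in> wts (dual C 1 M) (\<kappa> - simple_root i)" using F by simp
    note c = cart[OF \<kappa> w]
    show "dual_gen M \<rho> (GK i) \<phi> = scl (dual C 1 M) (kchar C 1 i \<kappa>) \<phi>"
      "dual_gen M \<rho> (GKinv i) \<phi> = scl (dual C 1 M) (inverse (kchar C 1 i \<kappa>)) \<phi>"
      "dual_gen M \<rho> (GL i) \<phi> = scl (dual C 1 M) (lchar C 1 i \<kappa>) \<phi>"
      "dual_gen M \<rho> (GLinv i) \<phi> = scl (dual C 1 M) (inverse (lchar C 1 i \<kappa>)) \<phi>"
      by (rule c, simp add: \<kappa> hom(3-6)[OF \<phi> Lat_minus[OF \<kappa>]] char_1 dotp_simps tpow_minus,
          use hom(3-6)[OF \<phi>] in simp)+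
    fix j
    \<comment> \<open>Both orders of the two rescaled operators collect this scalar; it is \<open>1\<close> for \<open>i = j\<close>.\<close>
    let ?c = "tpow C vroot (dotp C (simple_root j) (simple_root j) - dotp C (simple_root j) \<kappa> + dotp C (simple_root i) \<kappa>
          - dotp C (simple_root i) (simple_root j))"
    have lins: "dual_gen M \<rho> g (scl (dual C 1 M) c (?T h \<phi>)) = scl (dual C 1 M) c (dual_gen M \<rho> g (?T h \<phi>))" for g h c
      by (rule linear_on_scale[OF lin_opsD(2)[OF opsD] lin_opsD(1)[OF opsT]]) (simp add: \<phi>)
    have EF: "dual_gen M \<rho> (GE i) (dual_gen M \<rho> (GF j) \<phi>) = scl (dual C 1 M) ?c (?T (GE i) (?T (GF j) \<phi>))"
    proof -
      have A: "dual_gen M \<rho> (GF j) \<phi> = scl (dual C 1 M) (- 1 * tpow C vroot (dotp C (simple_root j) (simple_root j) - dotp C (simple_root j) \<kappa>)) (?T (GF j) \<phi>)"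
        using gF \<kappa> w by blast
      have B: "dual_gen M \<rho> (GE i) (?T (GF j) \<phi>) =
         scl (dual C 1 M) (- 1 * tpow C vroot (dotp C (simple_root i) (\<kappa> + - simple_root j))) (?T (GE i) (?T (GF j) \<phi>))"
        using gE L(2) TF \<kappa> w by blast
      have C: "?c = tpow C vroot (dotp C (simple_root j) (simple_root j) - dotp C (simple_root j) \<kappa>) *
          tpow C vroot (dotp C (simple_root i) (\<kappa> + - simple_root j))"
        using \<kappa> L(2) by (subst tpow_add[symmetric]) (auto simp: dotp_simps(1-6) algebra_simps)
      show ?thesis unfolding A lins B C D.scale_scale by simp
    qed
    have FE: "dual_gen M \<rho> (GF j) (dual_gen M \<rho> (GE i) \<phi>) = scl (dual C 1 M) ?c (?T (GF j) (?T (GE i) \<phi>))"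
    proof -
      have A: "dual_gen M \<rho> (GE i) \<phi> = scl (dual C 1 M) (- 1 * tpow C vroot (dotp C (simple_root i) \<kappa>)) (?T (GE i) \<phi>)"
        using gE \<kappa> w by blast
      have B: "dual_gen M \<rho> (GF j) (?T (GE i) \<phi>) =
         scl (dual C 1 M) (- 1 * tpow C vroot (dotp C (simple_root j) (simple_root j) - dotp C (simple_root j) (\<kappa> + simple_root i))) (?T (GF j) (?T (GE i) \<phi>))"
        using gF L(1) TE \<kappa> w by blast
      have C: "?c = tpow C vroot (dotp C (simple_root i) \<kappa>) *
          tpow C vroot (dotp C (simple_root j) (simple_root j) - dotp C (simple_root j) (\<kappa> + simple_root i))"
        using \<kappa> L(1) dotp_commute[of "simple_root i" "simple_root j"]
        by (subst tpow_add[symmetric]) (auto simp: dotp_simps(1-6) algebra_simps)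
      show ?thesis unfolding A lins B C D.scale_scale by simp
    qed
    show "dual_gen M \<rho> (GE i) (dual_gen M \<rho> (GF j) \<phi>) - dual_gen M \<rho> (GF j) (dual_gen M \<rho> (GE i) \<phi>) =
      (if i = j then scl (dual C 1 M) (inverse (v_i C i - inverse (v_i C i)) * (kchar C 1 i \<kappa> - lchar C 1 i \<kappa>)) \<phi> else 0)"
      (is "?l = ?r")
    proof (rule dual_eqI)
      show "?l \<in> dual_space M"
        using D.carrier_diff[of "dual_gen M \<rho> (GE i) (dual_gen M \<rho> (GF j) \<phi>)" "dual_gen M \<rho> (GF j) (dual_gen M \<rho> (GE i) \<phi>)"]
          lin_opsD(1)[OF opsD] \<phi> by simp
      show "?r \<in> dual_space M" using D.carrier_scale[of \<phi>] D.carrier_0 \<phi> by simp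
      fix \<nu> m assume \<nu>: "\<nu> \<in> Lat C" "m \<in> wts M \<nu>"
      note m = wts_carrier[OF \<nu>]
      note lin\<phi> = dual_space_linear_on[OF \<phi>]
      have "?l m = - ?c * \<phi> (\<rho> (GE i) (\<rho> (GF j) m) - \<rho> (GF j) (\<rho> (GE i) m))"
        unfolding EF FE by (simp add: transpose_def m car linear_on_diff[OF lin\<phi>] algebra_simps)
      also have "\<dots> = ?r m"
      proof (cases "i = j \<and> \<phi> m \<noteq> 0")
        case True
        then have \<nu>\<kappa>: "\<nu> = - \<kappa>" using dual_wtsD(2)[OF w \<nu>] by simp
        show ?thesis
          unfolding weight_repD(8)[OF rep \<nu>] using True m
          by (simp add: linear_on_scale[OF lin\<phi>] \<nu>\<kappa> char_1 dotp_simps(5,6) right_diff_distrib left_diff_distrib)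
      next
        case False
        then show ?thesis
          unfolding weight_repD(8)[OF rep \<nu>] using m linear_on_0[OF lin\<phi>] by (auto simp: linear_on_scale[OF lin\<phi>])
      qed
      finally show "?l m = ?r m" .
    qed
    assume ij: "i \<noteq> j"
    let ?N = "serre_deg C i j"
    let ?KE = "(- 1) ^ Suc ?N * tpow C vroot (of_nat ?N * dotp C (simple_root i) \<kappa> + dotp C (simple_root j) \<kappa> +
      of_nat (?N choose 2) * dotp C (simple_root i) (simple_root i) + of_nat ?N * dotp C (simple_root i) (simple_root j))"
    have "(\<Sum>p\<le>?N. scl (dual C 1 M) (serre_coeff C 1 i j p)
          ((dual_gen M \<rho> (GE i) ^^ p) (dual_gen M \<rho> (GE j) ((dual_gen M \<rho> (GE i) ^^ (?N - p)) \<phi>)))) =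
        (\<Sum>p\<le>?N. scl (dual C 1 M) ?KE (scl (dual C 1 M) (serre_coeff C 1 i j p)
          ((?T (GE i) ^^ p) (?T (GE j) ((?T (GE i) ^^ (?N - p)) \<phi>)))))"
    proof (rule sum.cong, simp)
      fix p assume "p \<in> {..?N}"
      then have p: "p \<le> ?N" by simp
      have "(dual_gen M \<rho> (GE i) ^^ p) (dual_gen M \<rho> (GE j) ((dual_gen M \<rho> (GE i) ^^ (?N - p)) \<phi>)) =
        scl (dual C 1 M) ((- 1) ^ Suc (p + (?N - p)) * tpow C vroot (of_nat (p + (?N - p)) * dotp C (simple_root i) \<kappa> + dotp C (simple_root j) \<kappa> +
          of_nat ((p + (?N - p)) choose 2) * dotp C (simple_root i) (simple_root i) + of_nat (?N - p) * dotp C (simple_root i) (simple_root j) + of_nat p * dotp C (simple_root i) (simple_root j)))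
          ((?T (GE i) ^^ p) (?T (GE j) ((?T (GE i) ^^ (?N - p)) \<phi>)))"
        by (rule Serre_E) (use \<kappa> w dotp_commute[of "simple_root i" "simple_root j"] in \<open>simp_all add: dotp_simps(1-6)\<close>)
      moreover have "of_nat (?N - p) * dotp C (simple_root i) (simple_root j) + of_nat p * dotp C (simple_root i) (simple_root j) =
          of_nat ?N * dotp C (simple_root i) (simple_root j)"
        using p by (simp flip: distrib_right of_nat_add)
      ultimately show "scl (dual C 1 M) (serre_coeff C 1 i j p)
          ((dual_gen M \<rho> (GE i) ^^ p) (dual_gen M \<rho> (GE j) ((dual_gen M \<rho> (GE i) ^^ (?N - p)) \<phi>))) =
        scl (dual C 1 M) ?KE (scl (dual C 1 M) (serre_coeff C 1 i j p)
          ((?T (GE i) ^^ p) (?T (GE j) ((?T (GE i) ^^ (?N - p)) \<phi>))))"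
        using p by (simp add: add.assoc mult.left_commute)
    qed
    also have "\<dots> = scl (dual C 1 M) ?KE (\<Sum>p\<le>?N. scl (dual C 1 M) (serre_coeff C 1 i j p)
          ((?T (GE i) ^^ p) (?T (GE j) ((?T (GE i) ^^ (?N - p)) \<phi>))))"
      unfolding D.scale_sum_right ..
    also have "(\<Sum>p\<le>?N. scl (dual C 1 M) (serre_coeff C 1 i j p)
          ((?T (GE i) ^^ p) (?T (GE j) ((?T (GE i) ^^ (?N - p)) \<phi>)))) = 0"
      unfolding dual_simps
      by (rule transpose_serre[OF _ _ \<phi>]) (use weight_repD(9)[OF rep _ _ ij] ops in blast)+
    finally show "(\<Sum>p\<le>?N. scl (dual C 1 M) (serre_coeff C 1 i j p)
          ((dual_gen M \<rho> (GE i) ^^ p) (dual_gen M \<rho> (GE j) ((dual_gen M \<rho> (GE i) ^^ (?N - p)) \<phi>)))) = 0"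
      by (simp only: D.scale_zero_right)
    let ?f = "\<lambda>k. dotp C (simple_root k) (simple_root k) - dotp C (simple_root k) \<kappa>"
    let ?KF = "(- 1) ^ Suc ?N * tpow C vroot (of_nat ?N * ?f i + ?f j +
      of_nat (?N choose 2) * dotp C (simple_root i) (simple_root i) + of_nat ?N * dotp C (simple_root i) (simple_root j))"
    have "(\<Sum>p\<le>?N. scl (dual C 1 M) (serre_coeff C 1 i j p)
          ((dual_gen M \<rho> (GF i) ^^ (?N - p)) (dual_gen M \<rho> (GF j) ((dual_gen M \<rho> (GF i) ^^ p) \<phi>)))) =
        (\<Sum>p\<le>?N. scl (dual C 1 M) ?KF (scl (dual C 1 M) (serre_coeff C 1 i j p)
          ((?T (GF i) ^^ (?N - p)) (?T (GF j) ((?T (GF i) ^^ (?N - (?N - p))) \<phi>)))))"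
    proof (rule sum.cong, simp)
      fix p assume "p \<in> {..?N}"
      then have p: "p \<le> ?N" by simp
      have "(dual_gen M \<rho> (GF i) ^^ (?N - p)) (dual_gen M \<rho> (GF j) ((dual_gen M \<rho> (GF i) ^^ p) \<phi>)) =
        scl (dual C 1 M) ((- 1) ^ Suc (?N - p + p) * tpow C vroot (of_nat (?N - p + p) * ?f i + ?f j +
          of_nat ((?N - p + p) choose 2) * dotp C (simple_root i) (simple_root i) + of_nat p * dotp C (simple_root i) (simple_root j) + of_nat (?N - p) * dotp C (simple_root i) (simple_root j)))
          ((?T (GF i) ^^ (?N - p)) (?T (GF j) ((?T (GF i) ^^ p) \<phi>)))"
        by (rule Serre_F) (use \<kappa> w dotp_commute[of "simple_root i" "simple_root j"] in \<open>simp_all add: dotp_simps(1-6)\<close>)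
      moreover have "of_nat p * dotp C (simple_root i) (simple_root j) + of_nat (?N - p) * dotp C (simple_root i) (simple_root j) =
          of_nat ?N * dotp C (simple_root i) (simple_root j)"
        using p by (simp flip: distrib_right of_nat_add)
      ultimately show "scl (dual C 1 M) (serre_coeff C 1 i j p)
          ((dual_gen M \<rho> (GF i) ^^ (?N - p)) (dual_gen M \<rho> (GF j) ((dual_gen M \<rho> (GF i) ^^ p) \<phi>))) =
        scl (dual C 1 M) ?KF (scl (dual C 1 M) (serre_coeff C 1 i j p)
          ((?T (GF i) ^^ (?N - p)) (?T (GF j) ((?T (GF i) ^^ (?N - (?N - p))) \<phi>))))"
        using p by (simp add: add.assoc mult.left_commute)
    qed
    also have "\<dots> = scl (dual C 1 M) ?KF (scl (dual C 1 M) ((- 1) ^ ?N)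
        (\<Sum>p\<le>?N. scl (dual C 1 M) (serre_coeff C 1 i j p)
          ((?T (GF i) ^^ p) (?T (GF j) ((?T (GF i) ^^ (?N - p)) \<phi>)))))"
      unfolding D.scale_sum_right[symmetric]
        D.serre_sum_reverse[of i j "\<lambda>p. (?T (GF i) ^^ p) (?T (GF j) ((?T (GF i) ^^ (?N - p)) \<phi>))"] ..
    also have "(\<Sum>p\<le>?N. scl (dual C 1 M) (serre_coeff C 1 i j p)
          ((?T (GF i) ^^ p) (?T (GF j) ((?T (GF i) ^^ (?N - p)) \<phi>)))) = 0"
      unfolding dual_simps
    proof (rule transpose_serre[OF _ _ \<phi>])
      fix \<nu> m assume \<nu>: "\<nu> \<in> Lat C" "m \<in> wts M \<nu>"
      let ?W = "\<lambda>p. (\<rho> (GF i) ^^ (?N - p)) (\<rho> (GF j) ((\<rho> (GF i) ^^ p) m))"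
      have "(\<Sum>p\<le>?N. scl M (serre_coeff C 1 i j p) ((\<rho> (GF i) ^^ p) (\<rho> (GF j) ((\<rho> (GF i) ^^ (?N - p)) m)))) =
          (\<Sum>p\<le>?N. scl M (serre_coeff C 1 i j p) (?W (?N - p)))"
        by (intro sum.cong) auto
      also have "\<dots> = 0"
        by (rule trans[OF serre_sum_reverse[of i j ?W]]) (simp only: weight_repD(10)[OF rep \<nu> ij] scale_zero_right)
      finally show "(\<Sum>p\<le>?N. scl M (serre_coeff C 1 i j p) ((\<rho> (GF i) ^^ p) (\<rho> (GF j) ((\<rho> (GF i) ^^ (?N - p)) m)))) = 0" .
    qed (use ops in blast)+
    finally show "(\<Sum>p\<le>?N. scl (dual C 1 M) (serre_coeff C 1 i j p)
          ((dual_gen M \<rho> (GF i) ^^ (?N - p)) (dual_gen M \<rho> (GF j) ((dual_gen M \<rho> (GF i) ^^ p) \<phi>)))) = 0"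
      by (simp only: D.scale_zero_right)
  qed
qed

end


section \<open>The comparison of duals\<close>

lemma transport_simps [simp]:
  "vcar (transport C M) = vcar M" "scl (transport C M) = scl M" "wts (transport C M) = wts M"
  by (simp_all add: transport_def)

lemma transport_structure [simp]:
  "weight_graded C (transport C M) = weight_graded C M" "wcomp C (transport C M) = wcomp C M"
  "wsupp C (transport C M) = wsupp C M" "lin_ops (transport C M) = lin_ops M"
  "dual_space (transport C M) = dual_space M" "linear_on (transport C M) = linear_on M"
  "dual_gen (transport C M) = dual_gen M"
  by (simp_all add: weight_graded_def weight_decomp_def wcomp_def wsupp_def lin_ops_def linear_on_def
      dual_space_def dual_gen_def fun_eq_iff)

lemma free_action_intertwine:
  fixes M :: "('i, 'm::ab_group_add) wmod" and N :: "('i, 'n::ab_group_add) wmod"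
    and \<rho> :: "'i gen \<Rightarrow> 'm \<Rightarrow> 'm" and \<rho>' :: "'i gen \<Rightarrow> 'n \<Rightarrow> 'n"
  assumes "carrier_space M" "carrier_space N" and \<rho>: "\<forall>g. \<rho> g \<in> lin_ops M"
    and f: "linear_on M (scl N) f" "\<And>g m. m \<in> vcar M \<Longrightarrow> f (\<rho> g m) = \<rho>' g (f m)" and m: "m \<in> vcar M"
  shows "f (free_action (scl M) \<rho> x m) = free_action (scl N) \<rho>' x (f m)"
proof -
  interpret M: carrier_space M by fact
  interpret N: carrier_space N by fact
  note car = M.word_action_carrier[OF \<rho> m]
  have "f (word_action \<rho> w m) = word_action \<rho>' w (f m)" for w
    by (induction w) (simp_all add: f(2) car)
  then show ?thesis
    by (induction x rule: falg_induct)
      (simp_all add: M.free_action_single N.free_action_single M.free_action_add N.free_action_add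
        linear_on_scale[OF f(1)] linear_on_add[OF f(1)] car lin_opsD(1)[OF M.free_action_lin_ops[OF \<rho>] m])
qed

locale qv1_module = weight_space C M
  for C :: "('i::finite) qdatum" and M :: "('i, 'm::ab_group_add) wmod" +
  assumes weight_module: "weight_module C 1 M"
begin

abbreviation "\<rho>\<^sub>1 \<equiv> \<lambda>g. act M (qgen C 1 g)"
abbreviation "\<rho>\<^sub>t \<equiv> transport_gen C M"

lemma rep: "weight_rep C 1 M \<rho>\<^sub>1"
  by (rule weight_module_weight_rep[OF weight_module]) simp

lemma rep_t: "weight_rep C troot M \<rho>\<^sub>t"
  by (rule weight_rep_transport[OF rep])

lemma ops: "\<forall>g. \<rho>\<^sub>1 g \<in> lin_ops M" and ops_t: "\<forall>g. \<rho>\<^sub>t g \<in> lin_ops M"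
  using weight_repD(1)[OF rep] weight_repD(1)[OF rep_t] by blast+

sublocale D: weight_space C "dual C 1 M"
  by (rule weight_space_dual)

lemma dual_act_1:
  "\<phi> \<in> dual_space M \<Longrightarrow>
    act (dual C 1 M) u \<phi> = free_action (scl (dual C 1 M)) (dual_gen M \<rho>\<^sub>1) (qrep u) \<phi>"
  using qmodule_gens(2) weight_module by (intro dual_act[OF ops]) (auto simp: weight_module_def)

lemma dual_relators_1:
  "\<forall>r\<in>relators C 1. \<forall>\<phi>\<in>vcar (dual C 1 M). free_action (scl (dual C 1 M)) (dual_gen M \<rho>\<^sub>1) r \<phi> = 0"
  by (rule D.weight_rep_relators[OF weight_rep_dual[OF rep]]) simp

lemma dual_ops_1: "\<forall>g. dual_gen M \<rho>\<^sub>1 g \<in> lin_ops (dual C 1 M)"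
  using dual_gen_lin_ops[OF ops] by blast

lemma dual_qmodule_1: "qmodule C 1 (dual C 1 M)"
  by (rule D.qmodule_of_free_action[OF dual_ops_1 dual_relators_1]) (use dual_act_1 in simp)

lemma dual_act_gen: "\<phi> \<in> dual_space M \<Longrightarrow> act (dual C 1 M) (qgen C 1 g) \<phi> = dual_gen M \<rho>\<^sub>1 g \<phi>"
  using D.free_action_qrep_qcoset[OF dual_ops_1 dual_relators_1, of \<phi> "fgen g"]
  by (simp add: dual_act_1 qgen_def D.free_action_fgen[unfolded dual_simps])

text \<open>
  The transport of the dual refers to the module action on the dual, so the operators \<open>dual_gen\<close> have
  to be traded for that action.
\<close>

lemma dual_rep: "weight_rep C 1 (dual C 1 M) (\<lambda>g. act (dual C 1 M) (qgen C 1 g))"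
proof (rule D.qmodule_weight_rep[OF dual_qmodule_1])
  show "\<forall>\<kappa>\<in>Lat C. \<forall>\<phi>\<in>wts (dual C 1 M) \<kappa>. \<forall>i.
       act (dual C 1 M) (qgen C 1 (GE i)) \<phi> \<in> wts (dual C 1 M) (\<kappa> + simple_root i) \<and>
       act (dual C 1 M) (qgen C 1 (GF i)) \<phi> \<in> wts (dual C 1 M) (\<kappa> - simple_root i) \<and>
       act (dual C 1 M) (qgen C 1 (GK i)) \<phi> = scl (dual C 1 M) (kchar C 1 i \<kappa>) \<phi> \<and>
       act (dual C 1 M) (qgen C 1 (GL i)) \<phi> = scl (dual C 1 M) (lchar C 1 i \<kappa>) \<phi>"
    using weight_repD(2-7)[OF weight_rep_dual[OF rep]] by (simp add: dual_act_gen dual_wtsD(1))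
qed simp

lemma rep_dual_t: "weight_rep C troot (dual C 1 M) (transport_gen C (dual C 1 M))"
  by (rule D.weight_rep_transport[OF dual_rep])

lemma transport_relators: "\<forall>r\<in>relators C troot. \<forall>m\<in>vcar M. free_action (scl M) \<rho>\<^sub>t r m = 0"
  by (rule weight_rep_relators[OF rep_t]) simp

lemma D_map_lin_ops: "D_map C M \<in> lin_ops (dual C 1 M)"
  unfolding D_map_def by (rule D.wscale_lin_ops)

lemma D_map_dual_space: "\<phi> \<in> dual_space M \<Longrightarrow> D_map C M \<phi> \<in> dual_space M"
  using lin_opsD(1)[OF D_map_lin_ops] by simp

lemma D_map_hom:
  assumes "\<kappa> \<in> Lat C" "\<phi> \<in> wts (dual C 1 M) \<kappa>"
  shows "D_map C M \<phi> m = tpow C troot (- pairing C \<kappa> \<kappa>) * \<phi> m"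
  unfolding D_map_def D.wscale_hom[OF assms] by (simp add: pairing_simps)

lemma D_map_bij: "bij_betw (D_map C M) (dual_space M) (dual_space M)"
proof -
  define G where "G = wscale C (dual C 1 M) (\<lambda>\<kappa>. tpow C troot (pairing C (- \<kappa>) (- \<kappa>)))"
  have G: "G \<in> lin_ops (dual C 1 M)" unfolding G_def by (rule D.wscale_lin_ops)
  have comp: "linear_on (dual C 1 M) (scl (dual C 1 M)) (\<lambda>x. f (g x))"
    if "f \<in> lin_ops (dual C 1 M)" "g \<in> lin_ops (dual C 1 M)" for f g
    using that by (auto simp: lin_ops_def linear_on_def Pi_iff)
  have id: "linear_on (dual C 1 M) (scl (dual C 1 M)) (\<lambda>x. x)" by (simp add: linear_on_def)
  have inv: "tpow C troot (pairing C \<kappa> \<kappa>) * (tpow C troot (- pairing C \<kappa> \<kappa>) * x) = x"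
    "tpow C troot (- pairing C \<kappa> \<kappa>) * (tpow C troot (pairing C \<kappa> \<kappa>) * x) = x" if "\<kappa> \<in> Lat C" for \<kappa> x
    using that by (simp_all add: tpow_minus mult.assoc[symmetric])
  have GD: "G (D_map C M \<phi>) = \<phi>" if "\<phi> \<in> dual_space M" for \<phi>
  proof (rule D.linear_on_eqI[OF comp[OF G D_map_lin_ops] id])
    fix \<kappa> \<phi> assume \<kappa>: "\<kappa> \<in> Lat C" "\<phi> \<in> wts (dual C 1 M) \<kappa>"
    show "G (D_map C M \<phi>) = \<phi>"
      unfolding G_def D_map_def D.wscale_hom[OF \<kappa>] D.wscale_hom[OF \<kappa>(1) D.wts_scale[OF \<kappa>]]
      by (simp add: pairing_simps fun_eq_iff inv[OF \<kappa>(1)])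
  qed (use that in simp)
  have DG: "D_map C M (G \<phi>) = \<phi>" if "\<phi> \<in> dual_space M" for \<phi>
  proof (rule D.linear_on_eqI[OF comp[OF D_map_lin_ops G] id])
    fix \<kappa> \<phi> assume \<kappa>: "\<kappa> \<in> Lat C" "\<phi> \<in> wts (dual C 1 M) \<kappa>"
    show "D_map C M (G \<phi>) = \<phi>"
      unfolding G_def D_map_def D.wscale_hom[OF \<kappa>] D.wscale_hom[OF \<kappa>(1) D.wts_scale[OF \<kappa>]]
      by (simp add: pairing_simps fun_eq_iff inv[OF \<kappa>(1)])
  qed (use that in simp)
  show ?thesis
    by (rule bij_betw_byWitness[where f' = G])
      (use GD DG D_map_dual_space lin_opsD(1)[OF G] in auto)
qed

text \<open>
  Both sides are linear in \<open>\<phi>\<close> and in the argument, so weight vectors suffice.  For these only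
  the powers of \<open>t\<close> have to be compared, and only where the values of \<open>\<phi>\<close> do not
  vanish, which ties the two weights together.
\<close>

lemma D_map_intertwines_gen:
  assumes "\<phi> \<in> dual_space M"
  shows "D_map C M (transport_gen C (dual C 1 M) g \<phi>) = dual_gen M \<rho>\<^sub>t g (D_map C M \<phi>)"
proof -
  have lin: "linear_on (dual C 1 M) (scl (dual C 1 M)) (\<lambda>x. f (g x))"
    if "f \<in> lin_ops (dual C 1 M)" "g \<in> lin_ops (dual C 1 M)" for f g
    using that by (auto simp: lin_ops_def linear_on_def Pi_iff)
  have tops: "dual_gen M \<rho>\<^sub>t g \<in> lin_ops (dual C 1 M)" "transport_gen C (dual C 1 M) g \<in> lin_ops (dual C 1 M)"
    for g using dual_gen_lin_ops[OF ops_t] weight_repD(1)[OF rep_dual_t] by blast+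
  have ops_dual: "dual_gen M \<rho>\<^sub>t g \<phi> \<in> dual_space M" "transport_gen C (dual C 1 M) g \<phi> \<in> dual_space M"
    if "\<phi> \<in> dual_space M" for g \<phi>
    using that tops[THEN lin_opsD(1)] by simp_all
  show ?thesis
  proof (rule D.linear_on_eqI[OF lin[OF D_map_lin_ops tops(2)] lin[OF tops(1) D_map_lin_ops]])
    fix \<kappa> \<phi> assume \<kappa>: "\<kappa> \<in> Lat C" "\<phi> \<in> wts (dual C 1 M) \<kappa>"
    note \<phi> = dual_wtsD(1)[OF \<kappa>(2)]
    note D\<phi> = D_map_dual_space[OF \<phi>]
    have L: "\<kappa> + simple_root k \<in> Lat C" "\<kappa> - simple_root k \<in> Lat C" for k using \<kappa>(1) by simp_all
    note T = D.transport_gen_hom[OF \<kappa> dual_rep]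
    note W = weight_repD(2,3)[OF rep_dual_t \<kappa>]
    show "D_map C M (transport_gen C (dual C 1 M) g \<phi>) = dual_gen M \<rho>\<^sub>t g (D_map C M \<phi>)"
    proof (rule dual_eqI)
      show "D_map C M (transport_gen C (dual C 1 M) g \<phi>) \<in> dual_space M"
        by (intro D_map_dual_space ops_dual \<phi>)
      show "dual_gen M \<rho>\<^sub>t g (D_map C M \<phi>) \<in> dual_space M"
        by (intro D_map_dual_space ops_dual \<phi>)
      fix \<nu> m assume \<nu>: "\<nu> \<in> Lat C" "m \<in> wts M \<nu>"
      note m = wts_carrier[OF \<nu>]
      note h1 = dual_gen_hom[OF one_neq_zero rep \<phi> \<nu>] and ht = dual_gen_hom[OF troot_nonzero rep_t D\<phi> \<nu>]
      note gt = transport_gen_hom[OF \<nu> rep]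
      have \<phi>s: "\<phi> (scl M c y) = c * \<phi> y" "D_map C M \<phi> (scl M c y) = c * D_map C M \<phi> y" if "y \<in> vcar M" for c y
        using that linear_on_scale[OF dual_space_linear_on[OF \<phi>]] linear_on_scale[OF dual_space_linear_on[OF D\<phi>]] by auto
      have car: "\<rho>\<^sub>1 g m \<in> vcar M" for g using ops m lin_opsD(1) by blast
      have cart: "D_map C M (scl (dual C 1 M) c \<phi>) m = c * D_map C M \<phi> m" for c
        using linear_on_scale[OF lin_opsD(2)[OF D_map_lin_ops], of \<phi> c] \<phi> by simp
      have D0: "D_map C M \<phi> m = tpow C troot (- pairing C \<kappa> \<kappa>) * \<phi> m" for m by (rule D_map_hom[OF \<kappa>])
      have supp: "\<phi> m = 0 \<or> \<nu> = - \<kappa>" using dual_wtsD(2)[OF \<kappa>(2) \<nu>] by blast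
      show "D_map C M (transport_gen C (dual C 1 M) g \<phi>) m = dual_gen M \<rho>\<^sub>t g (D_map C M \<phi>) m"
      proof (cases g)
        case (GE i)
        have "D_map C M (transport_gen C (dual C 1 M) (GE i) \<phi>) m =
          tpow C troot (- pairing C (\<kappa> + simple_root i) (\<kappa> + simple_root i)) *
            (tpow C troot (pairing C \<kappa> (simple_root i)) * (- inverse (kchar C 1 i (\<nu> + simple_root i)) * \<phi> (\<rho>\<^sub>1 (GE i) m)))"
          unfolding D_map_hom[OF L(1) W(1)]
          unfolding T(1) by (simp add: dual_act_gen \<phi> h1(1))
        also have "\<dots> = - inverse (kchar C troot i (\<nu> + simple_root i)) * (tpow C troot (pairing C \<nu> (simple_root i)) *
            (tpow C troot (- pairing C \<kappa> \<kappa>) * \<phi> (\<rho>\<^sub>1 (GE i) m)))"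
        proof (cases "\<phi> (\<rho>\<^sub>1 (GE i) m) = 0")
          case False
          then have "\<nu> + simple_root i = - \<kappa>"
            using weight_repD(2)[OF rep \<nu>] \<nu> by (intro dual_wtsD(2)[OF \<kappa>(2) _ _ False]) auto
          then have \<nu>\<kappa>: "\<nu> = - \<kappa> - simple_root i" by (simp add: eq_diff_eq)
          have "tpow C troot (- pairing C (\<kappa> + simple_root i) (\<kappa> + simple_root i)) * tpow C troot (pairing C \<kappa> (simple_root i)) =
              tpow C troot (- (pairing C (\<nu> + simple_root i) (simple_root i) - pairing C (simple_root i) (\<nu> + simple_root i))) *
              tpow C troot (pairing C \<nu> (simple_root i)) * tpow C troot (- pairing C \<kappa> \<kappa>)"
            using \<nu> \<kappa> by (simp add: tpow_add[symmetric] del: minus_diff_eq)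
              (rule arg_cong[where f = "tpow C troot"], simp add: \<nu>\<kappa> pairing_simps)
          then show ?thesis
            using \<nu> by (simp add: kchar_def tpow_minus mult_ac del: minus_diff_eq)
        qed simp
        also have "\<dots> = dual_gen M \<rho>\<^sub>t (GE i) (D_map C M \<phi>) m"
          unfolding ht(1) gt(1) by (simp add: \<phi>s car D0)
        finally show ?thesis by (simp only: GE)
      next
        case (GF i)
        have "D_map C M (transport_gen C (dual C 1 M) (GF i) \<phi>) m =
          tpow C troot (- pairing C (\<kappa> - simple_root i) (\<kappa> - simple_root i)) *
            (tpow C troot (of_int (Om C i i) - pairing C (simple_root i) \<kappa>) * (- inverse (lchar C 1 i \<nu>) * \<phi> (\<rho>\<^sub>1 (GF i) m)))"
          unfolding D_map_hom[OF L(2) W(2)]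
          unfolding T(2) by (simp add: dual_act_gen \<phi> h1(2))
        also have "\<dots> = - inverse (lchar C troot i \<nu>) * (tpow C troot (of_int (Om C i i) - pairing C (simple_root i) \<nu>) *
            (tpow C troot (- pairing C \<kappa> \<kappa>) * \<phi> (\<rho>\<^sub>1 (GF i) m)))"
        proof (cases "\<phi> (\<rho>\<^sub>1 (GF i) m) = 0")
          case False
          then have "\<nu> - simple_root i = - \<kappa>"
            using weight_repD(3)[OF rep \<nu>] \<nu> by (intro dual_wtsD(2)[OF \<kappa>(2) _ _ False]) auto
          then have \<nu>\<kappa>: "\<nu> = simple_root i - \<kappa>" by (simp add: diff_eq_eq)
          have "tpow C troot (- pairing C (\<kappa> - simple_root i) (\<kappa> - simple_root i)) * tpow C troot (of_int (Om C i i) - pairing C (simple_root i) \<kappa>) =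
              tpow C troot (- (pairing C \<nu> (simple_root i) - pairing C (simple_root i) \<nu>)) *
              tpow C troot (of_int (Om C i i) - pairing C (simple_root i) \<nu>) * tpow C troot (- pairing C \<kappa> \<kappa>)"
            using \<nu> \<kappa> by (simp add: tpow_add[symmetric] del: minus_diff_eq)
              (rule arg_cong[where f = "tpow C troot"], simp add: \<nu>\<kappa> pairing_simps)
          then show ?thesis
            using \<nu> by (simp add: lchar_def tpow_minus mult_ac del: minus_diff_eq)
        qed simp
        also have "\<dots> = dual_gen M \<rho>\<^sub>t (GF i) (D_map C M \<phi>) m"
          unfolding ht(2) gt(2) by (simp add: \<phi>s car D0)
        finally show ?thesis by (simp only: GF)
      next
        case (GK i)
        show ?thesis
          unfolding GK T(3) cart ht(3) using supp \<kappa>(1)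
          by (auto simp: D0 kchar_def vpow_tpow dotp_simps pairing_simps tpow_minus tpow_diff)
      next
        case (GKinv i)
        show ?thesis
          unfolding GKinv T(4) cart ht(4) using supp \<kappa>(1)
          by (auto simp: D0 kchar_def vpow_tpow dotp_simps pairing_simps tpow_minus tpow_diff)
      next
        case (GL i)
        show ?thesis
          unfolding GL T(5) cart ht(5) using supp \<kappa>(1)
          by (auto simp: D0 lchar_def vpow_tpow dotp_simps pairing_simps tpow_minus tpow_diff)
      next
        case (GLinv i)
        show ?thesis
          unfolding GLinv T(6) cart ht(6) using supp \<kappa>(1)
          by (auto simp: D0 lchar_def vpow_tpow dotp_simps pairing_simps tpow_minus tpow_diff)
      qed
    qed
  qed (use assms in simp)
qed

lemma D_map_intertwines:
  assumes "\<phi> \<in> dual_space M"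
  shows "D_map C M (free_action (scl (dual C 1 M)) (transport_gen C (dual C 1 M)) x \<phi>) =
    free_action (scl (dual C 1 M)) (dual_gen M \<rho>\<^sub>t) x (D_map C M \<phi>)"
proof (rule free_action_intertwine[OF D.carrier_space_axioms D.carrier_space_axioms])
  show "\<forall>g. transport_gen C (dual C 1 M) g \<in> lin_ops (dual C 1 M)" using weight_repD(1)[OF rep_dual_t] by blast
  show "linear_on (dual C 1 M) (scl (dual C 1 M)) (D_map C M)" by (rule lin_opsD(2)[OF D_map_lin_ops])
qed (use assms D_map_intertwines_gen in simp_all)

text \<open>
  The relations hold on the dual of the transport because they hold on the transport of the
  dual.
\<close>

lemma D_map_iso: "qmodule_iso C troot (transport C (dual C 1 M)) (dual C troot (transport C M)) (D_map C M)"
proof -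
  interpret T: carrier_space "transport C (dual C 1 M)"
    using D.vector_space_axioms D.carrier by (simp add: carrier_space_def carrier_space_axioms_def)
  interpret MT: carrier_space "transport C M"
    using vector_space_axioms carrier by (simp add: carrier_space_def carrier_space_axioms_def)
  interpret DT: carrier_space "dual C troot (transport C M)"
    by (rule MT.carrier_space_dual)
  have rel1: "\<forall>r\<in>relators C troot. \<forall>\<phi>\<in>vcar (dual C 1 M).
      free_action (scl (dual C 1 M)) (transport_gen C (dual C 1 M)) r \<phi> = 0"
    by (rule D.weight_rep_relators[OF rep_dual_t]) simp
  have ops1: "\<forall>g. transport_gen C (dual C 1 M) g \<in> lin_ops (transport C (dual C 1 M))"
    using weight_repD(1)[OF rep_dual_t] by simp
  have q1: "qmodule C troot (transport C (dual C 1 M))"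
    by (rule T.qmodule_of_free_action[OF ops1]) (use rel1 in \<open>simp_all add: transport_def\<close>)
  have act_t: "\<forall>x. \<forall>m\<in>vcar (transport C M). act (transport C M) (qcoset C troot x) m = free_action (scl (transport C M)) \<rho>\<^sub>t x m"
    using free_action_qrep_qcoset[OF ops_t transport_relators] by (simp add: transport_def)
  have ops2': "\<forall>g. \<rho>\<^sub>t g \<in> lin_ops (transport C M)" using ops_t by simp
  have ops2: "\<forall>g. dual_gen M \<rho>\<^sub>t g \<in> lin_ops (dual C troot (transport C M))"
    using MT.dual_gen_lin_ops[OF ops2'] by simp
  have act2: "act (dual C troot (transport C M)) u \<phi> = free_action (scl (dual C 1 M)) (dual_gen M \<rho>\<^sub>t) (qrep u) \<phi>"
    if "\<phi> \<in> dual_space M" for u \<phi>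
    using MT.dual_act[OF ops2' act_t, of \<phi> u] that by simp
  have rel2: "free_action (scl (dual C 1 M)) (dual_gen M \<rho>\<^sub>t) r \<phi> = 0"
    if r: "r \<in> relators C troot" and \<phi>: "\<phi> \<in> dual_space M" for r \<phi>
  proof -
    obtain \<psi> where \<psi>: "\<psi> \<in> dual_space M" "\<phi> = D_map C M \<psi>"
      using bij_betw_imp_surj_on[OF D_map_bij] \<phi> by blast
    have "free_action (scl (dual C 1 M)) (dual_gen M \<rho>\<^sub>t) r \<phi> = D_map C M 0"
      using D_map_intertwines[OF \<psi>(1), of r] rel1 r \<psi> by simp
    also have "\<dots> = 0" by (rule D.linear_on_0[OF lin_opsD(2)[OF D_map_lin_ops]])
    finally show ?thesis .
  qed
  have q2: "qmodule C troot (dual C troot (transport C M))"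
    by (rule DT.qmodule_of_free_action[OF ops2]) (use rel2 act2 in simp_all)
  have lin: "linear_on (dual C 1 M) (scl (dual C 1 M)) (D_map C M)"
    by (rule lin_opsD(2)[OF D_map_lin_ops])
  have act: "D_map C M (act (transport C (dual C 1 M)) u \<phi>) = act (dual C troot (transport C M)) u (D_map C M \<phi>)"
    if "\<phi> \<in> dual_space M" for u \<phi>
    using D_map_intertwines[OF that, of "qrep u"] act2[OF D_map_dual_space[OF that]] by (simp add: transport_def)
  show ?thesis
    unfolding qmodule_iso_def using q1 q2 D_map_bij act linear_on_add[OF lin] linear_on_scale[OF lin] by simp
qed

end


section \<open>Tensor products of weight spaces\<close>

lemma bilinear_form_transport [simp]:
  "bilinear_form (transport C M) N = bilinear_form M N" "bilinear_form M (transport C N) = bilinear_form M N"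
  by (simp_all add: bilinear_form_def fun_eq_iff)

lemma pure_tensor_transport [simp]:
  "pure_tensor (transport C M) N = pure_tensor M N" "pure_tensor M (transport C N) = pure_tensor M N"
  by (simp_all add: pure_tensor_def fun_eq_iff)

lemma bilinear_form_dual_transport:
  "bilinear_form (dual C s (transport C M)) N = bilinear_form (dual C 1 M) N"
  "bilinear_form N (dual C s (transport C M)) = bilinear_form N (dual C 1 M)"
  by (simp_all add: bilinear_form_def fun_eq_iff)

lemma pure_tensor_dual_transport:
  "pure_tensor (dual C s (transport C M)) N = pure_tensor (dual C 1 M) N"
  "pure_tensor N (dual C s (transport C M)) = pure_tensor N (dual C 1 M)"
  by (simp_all add: pure_tensor_def bilinear_form_dual_transport fun_eq_iff)

lemma tensor_space_transport: "tensor_space (transport C M) (transport C N) = tensor_space M N"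
  by (simp add: tensor_space_def)

lemma bilinear_form_linear_on:
  assumes "bilinear_form M N B"
  shows "n \<in> vcar N \<Longrightarrow> linear_on M (*) (\<lambda>m. B m n)" and "m \<in> vcar M \<Longrightarrow> linear_on N (*) (B m)"
  using assms by (auto simp: bilinear_form_def linear_on_def)

interpretation tens: vector_space tscale
  by (rule vector_space_tscale)

lemma pure_tensor_in_tensor_space:
  "m \<in> vcar M \<Longrightarrow> n \<in> vcar N \<Longrightarrow> pure_tensor M N m n \<in> tensor_space M N"
  unfolding tensor_space_def by (rule tens.span_base) blast

text \<open>
  Linearity on the whole function space of which the tensor product is a subspace; all the maps in
  question are defined and linear there.
\<close>

definition tens_linear :: "(kfield \<Rightarrow> 'x \<Rightarrow> 'x) \<Rightarrow> (('m, 'n) tens \<Rightarrow> 'x::ab_group_add) \<Rightarrow> bool" where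
  "tens_linear sc f \<longleftrightarrow> (\<forall>z w. f (z + w) = f z + f w) \<and> (\<forall>c z. f (tscale c z) = sc c (f z))"

lemma tens_linear_scale: "tens_linear sc f \<Longrightarrow> f (tscale c z) = sc c (f z)"
  by (simp add: tens_linear_def)

lemma tens_linear_add: "tens_linear sc f \<Longrightarrow> f (z + w) = f z + f w"
  by (simp add: tens_linear_def)

lemma tens_linear_0: "tens_linear sc f \<Longrightarrow> f 0 = 0"
  using tens_linear_add[of sc f 0 0] by (simp only: add_0_right add_cancel_right_right)

lemma tens_linear_sum: "tens_linear sc f \<Longrightarrow> f (\<Sum>a\<in>A. g a) = (\<Sum>a\<in>A. f (g a))"
  by (induction A rule: infinite_finite_induct)
    (simp_all only: sum.infinite sum.empty sum.insert tens_linear_0 tens_linear_add not_False_eq_True)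

lemma tens_linear_maps:
  "tens_linear tscale (tensor_map M N f g)" "tens_linear tscale (tensor_J C M N)"
  "tens_linear (*) ev" "tens_linear (*) (qtr C M)"
  by (auto simp: tens_linear_def tensor_map_def tensor_J_def ev_def qtr_def tscale_def fun_eq_iff)

lemma tens_linear_comp: "tens_linear sc f \<Longrightarrow> tens_linear tscale g \<Longrightarrow> tens_linear sc (\<lambda>z. f (g z))"
  by (simp add: tens_linear_def)

locale tensor_spaces = M: weight_space C M + N: weight_space C N
  for C :: "('i::finite) qdatum" and M :: "('i, 'm::ab_group_add) wmod" and N :: "('i, 'n::ab_group_add) wmod"
begin

text \<open>
  The tensor product is spanned by pure tensors, and these depend linearly on both arguments, so
  pure tensors of weight vectors suffice to test an identity.
\<close>

lemma tensor_eqI: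
  assumes f: "tens_linear sc f" and g: "tens_linear sc g"
    and hom: "\<And>\<nu> \<mu> m n. \<nu> \<in> Lat C \<Longrightarrow> m \<in> wts M \<nu> \<Longrightarrow> \<mu> \<in> Lat C \<Longrightarrow> n \<in> wts N \<mu> \<Longrightarrow>
      f (pure_tensor M N m n) = g (pure_tensor M N m n)"
    and z: "z \<in> tensor_space M N"
  shows "f z = g z"
proof -
  have lin1: "linear_on M sc (\<lambda>m. h (pure_tensor M N m n))" if "tens_linear sc h" "n \<in> vcar N" for h n
    using that by (simp add: linear_on_def tens_linear_def pure_tensor_bilinear)
  have lin2: "linear_on N sc (\<lambda>n. h (pure_tensor M N m n))" if "tens_linear sc h" "m \<in> vcar M" for h m
    using that by (simp add: linear_on_def tens_linear_def pure_tensor_bilinear)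
  have pure: "f (pure_tensor M N m n) = g (pure_tensor M N m n)" if "m \<in> vcar M" "n \<in> vcar N" for m n
  proof (rule M.linear_on_eqI[OF lin1[OF f that(2)] lin1[OF g that(2)] _ that(1)])
    fix \<nu> m assume \<nu>: "\<nu> \<in> Lat C" "m \<in> wts M \<nu>"
    note m = M.wts_carrier[OF \<nu>]
    show "f (pure_tensor M N m n) = g (pure_tensor M N m n)"
      by (rule N.linear_on_eqI[OF lin2[OF f m] lin2[OF g m] hom[OF \<nu>] that(2)])
  qed
  show ?thesis
    using z unfolding tensor_space_def
  proof (induction rule: tens.span_induct_alt)
    case base
    show ?case by (simp only: tens_linear_0[OF f] tens_linear_0[OF g])
  next
    case (step c x y)
    then have "f x = g x" using pure by blast
    then show ?case
      by (simp only: step(2) tens_linear_add[OF f] tens_linear_add[OF g] tens_linear_scale[OF f] tens_linear_scale[OF g])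
  qed
qed

lemma tensor_J_hom:
  assumes "\<nu> \<in> Lat C" "m \<in> wts M \<nu>" "\<mu> \<in> Lat C" "n \<in> wts N \<mu>"
  shows "tensor_J C M N (pure_tensor M N m n) = tscale (tpow C troot (pairing C \<mu> \<nu>)) (pure_tensor M N m n)"
  by (rule tensor_J_homogeneous[OF M.vector_space_axioms M.carrier M.graded
        N.vector_space_axioms N.carrier N.graded assms])

text \<open>
  A left inverse is obtained by rescaling weight components by the inverse powers of \<open>t\<close>; summing
  over fixed finite sets that contain all weights makes bilinearity evident.
\<close>

lemma tensor_J_inj: "inj_on (tensor_J C M N) (tensor_space M N)"
proof -
  obtain S T where S: "finite S" "\<forall>m\<in>vcar M. wsupp C M m \<subseteq> S" and T: "finite T" "\<forall>n\<in>vcar N. wsupp C N n \<subseteq> T"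
    using M.finite_weights N.finite_weights by blast
  define G where "G B m n = (\<Sum>\<nu>\<in>S. \<Sum>\<mu>\<in>T. inverse (tpow C troot (pairing C \<mu> \<nu>)) * B (wcomp C M \<nu> m) (wcomp C N \<mu> n))"
    for B :: "'m \<Rightarrow> 'n \<Rightarrow> kfield" and m n
  define K where "K z = (\<lambda>B. if bilinear_form M N B then z (G B) else 0)" for z :: "('m, 'n) tens"
  have lin: "tens_linear tscale K"
    by (auto simp: tens_linear_def K_def tscale_def fun_eq_iff)
  have bil: "bilinear_form M N (G B)" if "bilinear_form M N B" for B
    using that unfolding bilinear_form_def G_def
    by (auto simp: M.wcomp_add M.wcomp_scale N.wcomp_add N.wcomp_scale distrib_left sum.distrib
        sum_distrib_left mult.left_commute)
  have KJ: "K (tensor_J C M N z) = z" if "z \<in> tensor_space M N" for z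
  proof (rule tensor_eqI[OF tens_linear_comp[OF lin tens_linear_maps(2)] _ _ that])
    show "tens_linear tscale (\<lambda>z. z)" by (simp add: tens_linear_def)
    fix \<nu> m \<mu> n assume h: "\<nu> \<in> Lat C" "m \<in> wts M \<nu>" "\<mu> \<in> Lat C" "n \<in> wts N \<mu>"
    note m = M.wts_carrier[OF h(1,2)] and n = N.wts_carrier[OF h(3,4)]
    have Gm: "G B m n = inverse (tpow C troot (pairing C \<mu> \<nu>)) * B m n" if B: "bilinear_form M N B" for B
    proof (cases "m = 0 \<or> n = 0")
      case True
      have "B m n = 0"
        using True M.linear_on_0[OF bilinear_form_linear_on(1)[OF B n]] N.linear_on_0[OF bilinear_form_linear_on(2)[OF B m]] by auto
      moreover have "G B m n = 0"
        using True M.linear_on_0[OF bilinear_form_linear_on(1)[OF bil[OF B] n]] N.linear_on_0[OF bilinear_form_linear_on(2)[OF bil[OF B] m]] by auto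
      ultimately show ?thesis by simp
    next
      case False
      then have "\<nu> \<in> S" "\<mu> \<in> T"
        using S(2) T(2) m n M.wsupp_hom[OF h(1,2)] N.wsupp_hom[OF h(3,4)] by auto
      have "G B m n = (\<Sum>\<nu>'\<in>S. \<Sum>\<mu>'\<in>T. if \<mu>' = \<mu> then (if \<nu>' = \<nu> then inverse (tpow C troot (pairing C \<mu> \<nu>)) * B m n else 0) else 0)"
        unfolding G_def M.wcomp_hom[OF h(1,2)] N.wcomp_hom[OF h(3,4)]
        using M.linear_on_0[OF bilinear_form_linear_on(1)[OF B n]] N.linear_on_0[OF bilinear_form_linear_on(2)[OF B m]]
          M.linear_on_0[OF bilinear_form_linear_on(1)[OF B N.carrier_0]]
        by (intro sum.cong refl) auto
      then show ?thesis using \<open>\<nu> \<in> S\<close> \<open>\<mu> \<in> T\<close> S(1) T(1) by simp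
    qed
    show "K (tensor_J C M N (pure_tensor M N m n)) = pure_tensor M N m n"
      unfolding tensor_J_hom[OF h] K_def
      by (auto simp: tscale_def pure_tensor_def bil Gm fun_eq_iff)
  qed
  then show ?thesis by (metis inj_onI)
qed

lemma tensor_J_inv_eq:
  "x \<in> tensor_space M N \<Longrightarrow> tensor_J C M N x = y \<Longrightarrow> tensor_J_inv C M N y = x"
  unfolding tensor_J_inv_def tensor_space_transport by (rule inv_into_f_eq[OF tensor_J_inj])

end

context qv1_module
begin

sublocale DM: tensor_spaces C "dual C 1 M" M ..
sublocale MD: tensor_spaces C M "dual C 1 M" ..

lemma tensor_map_D_id:
  assumes "\<phi> \<in> dual_space M" "m \<in> vcar M"
  shows "tensor_map (dual C troot (transport C M)) (transport C M) (D_map C M) id (pure_tensor (dual C 1 M) M \<phi> m) =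
      pure_tensor (dual C 1 M) M (D_map C M \<phi>) m"
    and "tensor_map (transport C M) (dual C troot (transport C M)) id (D_map C M) (pure_tensor M (dual C 1 M) m \<phi>) =
      pure_tensor M (dual C 1 M) m (D_map C M \<phi>)"
proof -
  note lin = lin_opsD(2)[OF D_map_lin_ops]
  have "tensor_map (dual C troot (transport C M)) (transport C M) (D_map C M) id (pure_tensor (dual C 1 M) M \<phi> m) =
      pure_tensor (dual C troot (transport C M)) (transport C M) (D_map C M \<phi>) (id m)"
    by (rule tensor_map_pure)
      (use D_map_dual_space linear_on_add[OF lin] linear_on_scale[OF lin] in simp_all)
  then show "tensor_map (dual C troot (transport C M)) (transport C M) (D_map C M) id (pure_tensor (dual C 1 M) M \<phi> m) =
      pure_tensor (dual C 1 M) M (D_map C M \<phi>) m"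
    by (simp add: pure_tensor_dual_transport)
  have "tensor_map (transport C M) (dual C troot (transport C M)) id (D_map C M) (pure_tensor M (dual C 1 M) m \<phi>) =
      pure_tensor (transport C M) (dual C troot (transport C M)) (id m) (D_map C M \<phi>)"
    by (rule tensor_map_pure)
      (use D_map_dual_space linear_on_add[OF lin] linear_on_scale[OF lin] in simp_all)
  then show "tensor_map (transport C M) (dual C troot (transport C M)) id (D_map C M) (pure_tensor M (dual C 1 M) m \<phi>) =
      pure_tensor M (dual C 1 M) m (D_map C M \<phi>)"
    by (simp add: pure_tensor_dual_transport)
qed

text \<open>
  For a form of weight \<open>\<kappa>\<close> and a vector of weight \<open>\<mu>\<close> the two sides carry the exponents \<open>- \<langle>\<kappa>, \<kappa>\<rangle>\<close> and
  \<open>\<langle>\<mu>, \<kappa>\<rangle>\<close>; these agree for \<open>\<mu> = - \<kappa>\<close>, and otherwise the pairing is zero.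
\<close>

lemma ev_comparison:
  assumes "z \<in> tensor_space (dual C 1 M) M"
  shows "ev (tensor_map (dual C troot (transport C M)) (transport C M) (D_map C M) id z) =
    ev (tensor_J C (dual C 1 M) M z)"
proof (rule DM.tensor_eqI[OF tens_linear_comp[OF tens_linear_maps(3,1)] tens_linear_comp[OF tens_linear_maps(3,2)] _ assms])
  fix \<kappa> \<phi> \<mu> m assume h: "\<kappa> \<in> Lat C" "\<phi> \<in> wts (dual C 1 M) \<kappa>" "\<mu> \<in> Lat C" "m \<in> wts M \<mu>"
  note \<phi> = dual_wtsD(1)[OF h(2)] and m = wts_carrier[OF h(3,4)]
  have "ev (tensor_map (dual C troot (transport C M)) (transport C M) (D_map C M) id (pure_tensor (dual C 1 M) M \<phi> m))
      = tpow C troot (- pairing C \<kappa> \<kappa>) * \<phi> m"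
    using D_map_hom[OF h(1,2)] by (simp add: tensor_map_D_id(1)[OF \<phi> m] ev_pure[OF D_map_dual_space[OF \<phi>]])
  also have "\<dots> = tpow C troot (pairing C \<mu> \<kappa>) * \<phi> m"
    using dual_wtsD(2)[OF h(2-4)] by (cases "\<phi> m = 0") (simp_all add: pairing_simps)
  also have "\<dots> = ev (tensor_J C (dual C 1 M) M (pure_tensor (dual C 1 M) M \<phi> m))"
    by (simp add: DM.tensor_J_hom[OF h] tens_linear_scale[OF tens_linear_maps(3)] ev_pure[OF \<phi>])
  finally show "ev (tensor_map (dual C troot (transport C M)) (transport C M) (D_map C M) id (pure_tensor (dual C 1 M) M \<phi> m))
      = ev (tensor_J C (dual C 1 M) M (pure_tensor (dual C 1 M) M \<phi> m))" .
qed

lemma qtr_comparison: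
  assumes "z \<in> tensor_space M (dual C 1 M)"
  shows "qtr C (transport C M) (tensor_map (transport C M) (dual C troot (transport C M)) id (D_map C M) z) =
    qtr C M (tensor_J C M (dual C 1 M) z)"
proof (rule MD.tensor_eqI[OF tens_linear_comp[OF tens_linear_maps(4,1)] tens_linear_comp[OF tens_linear_maps(4,2)] _ assms])
  fix \<mu> m \<kappa> \<phi> assume h: "\<mu> \<in> Lat C" "m \<in> wts M \<mu>" "\<kappa> \<in> Lat C" "\<phi> \<in> wts (dual C 1 M) \<kappa>"
  note \<phi> = dual_wtsD(1)[OF h(4)] and m = wts_carrier[OF h(1,2)]
  have qtr: "qtr C (transport C M) = qtr C M" by (simp add: qtr_def fun_eq_iff)
  have hom: "qtr C M (pure_tensor M (dual C 1 M) m \<psi>) = (v_wt C (- \<mu>))\<^sup>2 * \<psi> m" if "\<psi> \<in> dual_space M" for \<psi>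
    by (rule qtr_homogeneous[OF vector_space_axioms carrier graded h(1,2) that])
  have "qtr C (transport C M) (tensor_map (transport C M) (dual C troot (transport C M)) id (D_map C M) (pure_tensor M (dual C 1 M) m \<phi>))
      = (v_wt C (- \<mu>))\<^sup>2 * (tpow C troot (- pairing C \<kappa> \<kappa>) * \<phi> m)"
    using D_map_hom[OF h(3,4)] by (simp add: qtr tensor_map_D_id(2)[OF \<phi> m] hom[OF D_map_dual_space[OF \<phi>]])
  also have "\<dots> = tpow C troot (pairing C \<kappa> \<mu>) * ((v_wt C (- \<mu>))\<^sup>2 * \<phi> m)"
    using dual_wtsD(2)[OF h(4,1,2)] by (cases "\<phi> m = 0") (simp_all add: pairing_simps)
  also have "\<dots> = qtr C M (tensor_J C M (dual C 1 M) (pure_tensor M (dual C 1 M) m \<phi>))"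
    by (simp add: MD.tensor_J_hom[OF h] tens_linear_scale[OF tens_linear_maps(4)] hom[OF \<phi>])
  finally show "qtr C (transport C M) (tensor_map (transport C M) (dual C troot (transport C M)) id (D_map C M) (pure_tensor M (dual C 1 M) m \<phi>))
      = qtr C M (tensor_J C M (dual C 1 M) (pure_tensor M (dual C 1 M) m \<phi>))" .
qed

end


section \<open>Coevaluations\<close>

context qv1_module
begin

lemma weight_basis_finite:
  assumes "weight_basis C M E"
  shows "finite E"
proof -
  obtain B where "finite B" "span B = vcar M" using weight_module by (auto simp: weight_module_def)
  moreover have "independent E" "E \<subseteq> span E" "span E = vcar M"
    using assms by (auto simp: weight_basis_def span_base)
  ultimately show ?thesis using independent_span_bound[of B E] by simp
qed

lemma weight_basis_carrier: "weight_basis C M E \<Longrightarrow> b \<in> E \<Longrightarrow> b \<in> vcar M"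
  using span_base[of b E] by (auto simp: weight_basis_def)

lemma basis_wt:
  assumes "weight_basis C M E" "b \<in> E"
  shows "basis_wt C M b \<in> Lat C" "b \<in> wts M (basis_wt C M b)"
proof -
  have "b \<noteq> 0" using assms dependent_zero by (auto simp: weight_basis_def)
  moreover obtain \<nu> where "\<nu> \<in> Lat C" "b \<in> wts M \<nu>" using assms by (auto simp: weight_basis_def)
  ultimately have "\<exists>!\<nu>. \<nu> \<in> Lat C \<and> b \<in> wts M \<nu>" using weight_unique by blast
  from theI'[OF this] show "basis_wt C M b \<in> Lat C" "b \<in> wts M (basis_wt C M b)"
    by (simp_all add: basis_wt_def)
qed

lemma dual_basis_dual_space:
  assumes "weight_basis C M E"
  shows "dual_basis M E b \<in> dual_space M"
  using assms unfolding weight_basis_def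
  by (auto simp: dual_space_def dual_basis_def representation_add representation_scale)
    (auto simp: representation_def)

lemma dual_basis_expand:
  assumes "weight_basis C M E" "m \<in> vcar M"
  shows "(\<Sum>b\<in>E. scl M (dual_basis M E b m) b) = m"
  using assms sum_representation_eq[of E m E] weight_basis_finite[OF assms(1)]
  by (simp add: weight_basis_def dual_basis_def)

text \<open>
  A vector of weight \<open>\<mu>\<close> equals its \<open>\<mu>\<close>-component, so by uniqueness of the expansion only basis
  vectors of weight \<open>\<mu>\<close> occur in it.
\<close>

lemma dual_basis_wt:
  assumes E: "weight_basis C M E" and b: "b \<in> E"
  shows "dual_basis M E b \<in> wts (dual C s M) (- basis_wt C M b)"
proof (rule dual_wtsI[OF dual_basis_dual_space[OF E]])
  fix \<mu> m assume \<mu>: "\<mu> \<in> Lat C" "m \<in> wts M \<mu>" and nz: "dual_basis M E b m \<noteq> 0"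
  have fin: "finite E" by (rule weight_basis_finite[OF E])
  have m: "m \<in> vcar M" by (rule wts_carrier[OF \<mu>])
  let ?f = "\<lambda>e. if e \<in> E \<and> basis_wt C M e = \<mu> then dual_basis M E e m else 0"
  have wl: "linear_on M (scl M) (wcomp C M \<mu>)" by (simp add: linear_on_def wcomp_add wcomp_scale)
  have "m = wcomp C M \<mu> (\<Sum>e\<in>E. scl M (dual_basis M E e m) e)"
    using dual_basis_expand[OF E m] wcomp_hom[OF \<mu>] by simp
  also have "\<dots> = (\<Sum>e\<in>E. scl M (dual_basis M E e m) (wcomp C M \<mu> e))"
    using weight_basis_carrier[OF E] by (subst linear_on_sum[OF wl]) (auto simp: wcomp_scale)
  also have "\<dots> = (\<Sum>e\<in>E. scl M (?f e) e)"
    by (intro sum.cong refl) (auto simp: wcomp_hom[OF basis_wt[OF E]])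
  also have "\<dots> = (\<Sum>e | ?f e \<noteq> 0. scl M (?f e) e)"
    using fin by (intro sum.mono_neutral_right) auto
  finally have "(\<Sum>e | ?f e \<noteq> 0. scl M (?f e) e) = m" by simp
  moreover have "finite {e. ?f e \<noteq> 0}" by (rule finite_subset[OF _ fin]) auto
  ultimately have "representation E m = ?f"
    using E m by (intro representation_eqI) (auto simp: weight_basis_def split: if_splits)
  from fun_cong[OF this, of b] have "dual_basis M E b m = ?f b" by (simp only: dual_basis_def)
  then show "\<mu> = - (- basis_wt C M b)" using nz by (auto split: if_splits)
qed

text \<open>
  Expand each vector of one basis in the other one and move the coefficients to the first argument,
  where they assemble to the dual vectors of the other basis.
\<close>

lemma contraction_basis_independent:
  assumes \<beta>: "bilinear_form (dual C 1 M) M \<beta>" and E: "weight_basis C M E" and E': "weight_basis C M E'"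
  shows "(\<Sum>b\<in>E. \<beta> (dual_basis M E b) b) = (\<Sum>e\<in>E'. \<beta> (dual_basis M E' e) e)"
proof -
  note lin1 = bilinear_form_linear_on(1)[OF \<beta>] and lin2 = bilinear_form_linear_on(2)[OF \<beta>, unfolded dual_simps]
  note cE = weight_basis_carrier[OF E] and cE' = weight_basis_carrier[OF E']
  note dE = dual_basis_dual_space[OF E] and dE' = dual_basis_dual_space[OF E']
  have "(\<Sum>b\<in>E. \<beta> (dual_basis M E b) b) = (\<Sum>b\<in>E. \<beta> (dual_basis M E b) (\<Sum>e\<in>E'. scl M (dual_basis M E' e b) e))"
    by (intro sum.cong refl) (simp add: dual_basis_expand[OF E' cE])
  also have "\<dots> = (\<Sum>b\<in>E. \<Sum>e\<in>E'. dual_basis M E' e b * \<beta> (dual_basis M E b) e)"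
    using cE' by (intro sum.cong refl) (simp add: linear_on_sum[OF lin2[OF dE]] linear_on_scale[OF lin2[OF dE]])
  also have "\<dots> = (\<Sum>e\<in>E'. \<Sum>b\<in>E. dual_basis M E' e b * \<beta> (dual_basis M E b) e)"
    by (rule sum.swap)
  also have "\<dots> = (\<Sum>e\<in>E'. \<beta> (\<Sum>b\<in>E. scl (dual C 1 M) (dual_basis M E' e b) (dual_basis M E b)) e)"
  proof (intro sum.cong refl)
    fix e assume "e \<in> E'"
    note l = lin1[OF cE'[OF this]]
    have "\<beta> (\<Sum>b\<in>E. scl (dual C 1 M) (dual_basis M E' e b) (dual_basis M E b)) e =
        (\<Sum>b\<in>E. \<beta> (scl (dual C 1 M) (dual_basis M E' e b) (dual_basis M E b)) e)"
      by (rule D.linear_on_sum[OF l]) (intro D.carrier_scale, simp add: dE)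
    also have "\<dots> = (\<Sum>b\<in>E. dual_basis M E' e b * \<beta> (dual_basis M E b) e)"
      by (intro sum.cong refl linear_on_scale[OF l]) (simp add: dE)
    finally show "(\<Sum>b\<in>E. dual_basis M E' e b * \<beta> (dual_basis M E b) e) =
        \<beta> (\<Sum>b\<in>E. scl (dual C 1 M) (dual_basis M E' e b) (dual_basis M E b)) e" by simp
  qed
  also have "\<dots> = (\<Sum>e\<in>E'. \<beta> (dual_basis M E' e) e)"
  proof (intro sum.cong refl arg_cong[where f = "\<lambda>\<phi>. \<beta> \<phi> e" for e])
    fix e
    have mem: "(\<Sum>b\<in>E. scl (dual C 1 M) (dual_basis M E' e b) (dual_basis M E b)) \<in> dual_space M"
      unfolding dual_simps(1)[of C 1 M, symmetric] by (intro D.carrier_sum D.carrier_scale) (simp add: dE)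
    show "(\<Sum>b\<in>E. scl (dual C 1 M) (dual_basis M E' e b) (dual_basis M E b)) = dual_basis M E' e"
    proof (rule dual_space_eqI[OF mem dE'])
      fix m assume m: "m \<in> vcar M"
      have "dual_basis M E' e m = dual_basis M E' e (\<Sum>b\<in>E. scl M (dual_basis M E b m) b)"
        by (simp add: dual_basis_expand[OF E m])
      also have "\<dots> = (\<Sum>b\<in>E. dual_basis M E b m * dual_basis M E' e b)"
        using cE by (simp add: linear_on_sum[OF dual_space_linear_on[OF dE']] linear_on_scale[OF dual_space_linear_on[OF dE']])
      finally show "(\<Sum>b\<in>E. scl (dual C 1 M) (dual_basis M E' e b) (dual_basis M E b)) m = dual_basis M E' e m"
        by (simp add: sum_fun_apply mult.commute)
    qed
  qed
  finally show ?thesis .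
qed

lemma transport_basis [simp]:
  "weight_basis C (transport C M) E = weight_basis C M E" "basis_wt C (transport C M) = basis_wt C M"
  "dual_basis (transport C M) = dual_basis M"
  by (simp_all add: weight_basis_def basis_wt_def dual_basis_def fun_eq_iff)

text \<open>
  The factors \<open>v\<^sub>\<lambda>\<^sup>2\<close> in the coevaluation are the eigenvalues of an operator on \<open>M\<close> that does not
  depend on the basis; composing the bilinear form with this operator turns the coevaluation into a
  plain contraction.
\<close>

lemma coev_basis_independent:
  assumes E: "weight_basis C M E" and E': "weight_basis C M E'"
  shows "coev C 1 M E c = coev C 1 M E' c"
proof
  fix B
  show "coev C 1 M E c B = coev C 1 M E' c B"
  proof (cases "bilinear_form (dual C 1 M) M B")
    case True
    let ?W = "wscale C M (\<lambda>\<nu>. (v_wt C \<nu>)\<^sup>2)"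
    have "bilinear_form (dual C 1 M) M (\<lambda>\<phi> m. B \<phi> (?W m))"
      using True wscale_lin_ops[of "\<lambda>\<nu>. (v_wt C \<nu>)\<^sup>2"]
      by (auto simp: bilinear_form_def lin_ops_def linear_on_def Pi_iff)
    note eq = contraction_basis_independent[OF this E E']
    have coev: "coev C 1 M F c B = c * (\<Sum>b\<in>F. B (dual_basis M F b) (?W b))" if F: "weight_basis C M F" for F
    proof -
      have "coev C 1 M F c B = c * (\<Sum>b\<in>F. (v_wt C (basis_wt C M b))\<^sup>2 * B (dual_basis M F b) b)"
        using True by (simp add: coev_def tscale_def pure_tensor_def sum_fun_apply)
      also have "(\<Sum>b\<in>F. (v_wt C (basis_wt C M b))\<^sup>2 * B (dual_basis M F b) b) = (\<Sum>b\<in>F. B (dual_basis M F b) (?W b))"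
      proof (intro sum.cong refl)
        fix b assume b: "b \<in> F"
        show "(v_wt C (basis_wt C M b))\<^sup>2 * B (dual_basis M F b) b = B (dual_basis M F b) (?W b)"
          using linear_on_scale[OF bilinear_form_linear_on(2)[OF True] weight_basis_carrier[OF F b]] dual_basis_dual_space[OF F]
          by (simp add: wscale_hom[OF basis_wt[OF F b]])
      qed
      finally show ?thesis .
    qed
    show ?thesis by (simp add: coev[OF E] coev[OF E'] eq)
  qed (simp add: coev_def tscale_def pure_tensor_def sum_fun_apply)
qed

lemma coqtr_basis_independent:
  assumes E: "weight_basis C M E" and E': "weight_basis C M E'"
  shows "coqtr C 1 M E c = coqtr C 1 M E' c"
proof
  fix B
  show "coqtr C 1 M E c B = coqtr C 1 M E' c B"
  proof (cases "bilinear_form M (dual C 1 M) B")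
    case True
    then have "bilinear_form (dual C 1 M) M (\<lambda>\<phi> m. B m \<phi>)" by (auto simp: bilinear_form_def)
    from contraction_basis_independent[OF this E E'] True show ?thesis
      by (simp add: coqtr_def tscale_def pure_tensor_def sum_fun_apply)
  qed (simp add: coqtr_def tscale_def pure_tensor_def sum_fun_apply)
qed

text \<open>
  The coevaluation tensors are defined from the spaces, their gradings and a basis, and these
  are unchanged by the transport.
\<close>

lemma coev_transport: "coev C troot (transport C M) E c = coev C 1 M E c"
  and coqtr_transport: "coqtr C troot (transport C M) E c = coqtr C 1 M E c"
  by (simp_all add: coev_def coqtr_def pure_tensor_dual_transport)

lemma tpow_cancel: "q \<in> exponents \<Longrightarrow> tscale (tpow C troot q) (tscale (tpow C troot (- q)) z) = z"
  "q \<in> exponents \<Longrightarrow> tscale (tpow C troot (- q)) (tscale (tpow C troot q) z) = z"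
  by (simp_all add: tpow_minus)

lemma D_map_dual_basis:
  assumes E: "weight_basis C M E" and b: "b \<in> E"
  shows "D_map C M (dual_basis M E b) =
    scl (dual C 1 M) (tpow C troot (- pairing C (basis_wt C M b) (basis_wt C M b))) (dual_basis M E b)"
  using D_map_hom[OF _ dual_basis_wt[OF E b]] basis_wt[OF E b] by (simp add: fun_eq_iff pairing_simps)

text \<open>
  On the summand of a basis vector of weight \<open>\<lambda>\<close>, both \<open>J\<close> and \<open>D\<^sub>M\<close> multiply by \<open>t\<close> to the power
  \<open>- \<langle>\<lambda>, \<lambda>\<rangle>\<close>, so the inverse of \<open>J\<close> undoes the effect of \<open>D\<^sub>M\<close>.
\<close>

lemma coev_comparison:
  assumes E: "weight_basis C M E"
  shows "tensor_map (dual C troot (transport C M)) (transport C M) (D_map C M) id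
    (tensor_J_inv C (dual C 1 M) M (coev C 1 M E c)) = coev C 1 M E c"
proof -
  let ?p = "\<lambda>b. pure_tensor (dual C 1 M) M (dual_basis M E b) b"
  let ?v = "\<lambda>b. (v_wt C (basis_wt C M b))\<^sup>2" and ?q = "\<lambda>b. pairing C (basis_wt C M b) (basis_wt C M b)"
  let ?x = "tscale c (\<Sum>b\<in>E. tscale (?v b) (tscale (tpow C troot (?q b)) (?p b)))"
  note dE = dual_basis_dual_space[OF E] and cE = weight_basis_carrier[OF E]
  have q: "?q b \<in> exponents" if "b \<in> E" for b using basis_wt[OF E that] by simp
  have x: "?x \<in> tensor_space (dual C 1 M) M"
    unfolding tensor_space_def
    by (intro tens.span_scale tens.span_sum)
      (use pure_tensor_in_tensor_space[of _ "dual C 1 M" _ M] dE cE in \<open>simp add: tensor_space_def\<close>)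
  have lin: "f ?x = tscale c (\<Sum>b\<in>E. tscale (?v b) (tscale (tpow C troot (?q b)) (f (?p b))))"
    if "tens_linear tscale f" for f :: "_ \<Rightarrow> ('m \<Rightarrow> kfield, 'm) tens"
    using that by (simp add: tens_linear_sum[OF that] tens_linear_scale[OF that] del: tens.scale_scale)
  have "tensor_J C (dual C 1 M) M ?x = coev C 1 M E c"
    unfolding lin[OF tens_linear_maps(2)] coev_def
  proof (intro arg_cong[where f = "tscale c"] sum.cong refl arg_cong[where f = "tscale (?v b)" for b])
    fix b assume b: "b \<in> E"
    have "tensor_J C (dual C 1 M) M (?p b) = tscale (tpow C troot (- ?q b)) (?p b)"
      using DM.tensor_J_hom[OF _ dual_basis_wt[OF E b] basis_wt[OF E b]] basis_wt(1)[OF E b] by (simp add: pairing_simps)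
    then show "tscale (tpow C troot (?q b)) (tensor_J C (dual C 1 M) M (?p b)) = ?p b"
      by (simp only: tpow_cancel q[OF b])
  qed
  then have "tensor_J_inv C (dual C 1 M) M (coev C 1 M E c) = ?x"
    by (rule DM.tensor_J_inv_eq[OF x])
  moreover have "tensor_map (dual C troot (transport C M)) (transport C M) (D_map C M) id ?x = coev C 1 M E c"
    unfolding lin[OF tens_linear_maps(1)] coev_def
  proof (intro arg_cong[where f = "tscale c"] sum.cong refl arg_cong[where f = "tscale (?v b)" for b])
    fix b assume b: "b \<in> E"
    have "tensor_map (dual C troot (transport C M)) (transport C M) (D_map C M) id (?p b) = tscale (tpow C troot (- ?q b)) (?p b)"
      unfolding tensor_map_D_id(1)[OF dE cE[OF b]] D_map_dual_basis[OF E b]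
      by (rule pure_tensor_bilinear(3)) (simp_all add: dE cE b)
    then show "tscale (tpow C troot (?q b)) (tensor_map (dual C troot (transport C M)) (transport C M) (D_map C M) id (?p b)) = ?p b"
      by (simp only: tpow_cancel q[OF b])
  qed
  ultimately show ?thesis by simp
qed

lemma coqtr_comparison:
  assumes E: "weight_basis C M E"
  shows "tensor_map (transport C M) (dual C troot (transport C M)) id (D_map C M)
    (tensor_J_inv C M (dual C 1 M) (coqtr C 1 M E c)) = coqtr C 1 M E c"
proof -
  let ?p = "\<lambda>b. pure_tensor M (dual C 1 M) b (dual_basis M E b)"
  let ?q = "\<lambda>b. pairing C (basis_wt C M b) (basis_wt C M b)"
  let ?x = "tscale c (\<Sum>b\<in>E. tscale (tpow C troot (?q b)) (?p b))"
  note dE = dual_basis_dual_space[OF E] and cE = weight_basis_carrier[OF E]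
  have q: "?q b \<in> exponents" if "b \<in> E" for b using basis_wt[OF E that] by simp
  have x: "?x \<in> tensor_space M (dual C 1 M)"
    unfolding tensor_space_def
    by (intro tens.span_scale tens.span_sum)
      (use pure_tensor_in_tensor_space[of _ M _ "dual C 1 M"] dE cE in \<open>simp add: tensor_space_def\<close>)
  have lin: "f ?x = tscale c (\<Sum>b\<in>E. tscale (tpow C troot (?q b)) (f (?p b)))"
    if "tens_linear tscale f" for f :: "_ \<Rightarrow> ('m, 'm \<Rightarrow> kfield) tens"
    using that by (simp add: tens_linear_sum[OF that] tens_linear_scale[OF that] del: tens.scale_scale)
  have "tensor_J C M (dual C 1 M) ?x = coqtr C 1 M E c"
    unfolding lin[OF tens_linear_maps(2)] coqtr_def
  proof (intro arg_cong[where f = "tscale c"] sum.cong refl)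
    fix b assume b: "b \<in> E"
    have "tensor_J C M (dual C 1 M) (?p b) = tscale (tpow C troot (- ?q b)) (?p b)"
      using MD.tensor_J_hom[OF basis_wt[OF E b] _ dual_basis_wt[OF E b]] basis_wt(1)[OF E b] by (simp add: pairing_simps)
    then show "tscale (tpow C troot (?q b)) (tensor_J C M (dual C 1 M) (?p b)) = ?p b"
      by (simp only: tpow_cancel q[OF b])
  qed
  then have "tensor_J_inv C M (dual C 1 M) (coqtr C 1 M E c) = ?x"
    by (rule MD.tensor_J_inv_eq[OF x])
  moreover have "tensor_map (transport C M) (dual C troot (transport C M)) id (D_map C M) ?x = coqtr C 1 M E c"
    unfolding lin[OF tens_linear_maps(1)] coqtr_def
  proof (intro arg_cong[where f = "tscale c"] sum.cong refl)
    fix b assume b: "b \<in> E"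
    have "tensor_map (transport C M) (dual C troot (transport C M)) id (D_map C M) (?p b) = tscale (tpow C troot (- ?q b)) (?p b)"
      unfolding tensor_map_D_id(2)[OF dE cE[OF b]] D_map_dual_basis[OF E b]
      by (rule pure_tensor_bilinear(4)) (simp_all add: dE cE b)
    then show "tscale (tpow C troot (?q b)) (tensor_map (transport C M) (dual C troot (transport C M)) id (D_map C M) (?p b)) = ?p b"
      by (simp only: tpow_cancel q[OF b])
  qed
  ultimately show ?thesis by simp
qed

end

theorem proposition3p6:
  fixes C :: "('i::finite) qdatum"
    and M :: "('i, 'm::ab_group_add) wmod"
  assumes "cartan_datum C" and "admissible_lattice C" and "common_denominator C"
    and "weight_module C 1 M"
  shows "qmodule_iso C troot (transport C (dual C 1 M)) (dual C troot (transport C M)) (D_map C M) \<and>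
    (\<forall>z \<in> tensor_space (transport C (dual C 1 M)) (transport C M).
       ev (tensor_map (dual C troot (transport C M)) (transport C M) (D_map C M) id z) =
       ev (tensor_J C (dual C 1 M) M z)) \<and>
    (\<forall>z \<in> tensor_space (transport C M) (transport C (dual C 1 M)).
       qtr C (transport C M)
         (tensor_map (transport C M) (dual C troot (transport C M)) id (D_map C M) z) =
       qtr C M (tensor_J C M (dual C 1 M) z)) \<and>
    (\<forall>\<E> \<E>'. weight_basis C (transport C M) \<E> \<longrightarrow> weight_basis C M \<E>' \<longrightarrow>
       (\<forall>c. coev C troot (transport C M) \<E> c =
         tensor_map (dual C troot (transport C M)) (transport C M) (D_map C M) id
           (tensor_J_inv C (dual C 1 M) M (coev C 1 M \<E>' c)))) \<and>
    (\<forall>\<E> \<E>'. weight_basis C (transport C M) \<E> \<longrightarrow> weight_basis C M \<E>' \<longrightarrow>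
       (\<forall>c. coqtr C troot (transport C M) \<E> c =
         tensor_map (transport C M) (dual C troot (transport C M)) id (D_map C M)
           (tensor_J_inv C M (dual C 1 M) (coqtr C 1 M \<E>' c))))"
proof -
  interpret quantum_lattice C using assms(2,3) by unfold_locales
  interpret qv1_module C M
    using weight_module_weight_space[OF quantum_lattice_axioms assms(4)] assms(4)
    by (simp add: qv1_module_def qv1_module_axioms_def)
  show ?thesis
  proof (intro conjI ballI allI impI)
    show "qmodule_iso C troot (transport C (dual C 1 M)) (dual C troot (transport C M)) (D_map C M)"
      by (rule D_map_iso)
  next
    fix z :: "('m \<Rightarrow> kfield, 'm) tens"
    assume "z \<in> tensor_space (transport C (dual C 1 M)) (transport C M)"
    then show "ev (tensor_map (dual C troot (transport C M)) (transport C M) (D_map C M) id z) =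
        ev (tensor_J C (dual C 1 M) M z)"
      unfolding tensor_space_transport by (rule ev_comparison)
  next
    fix z :: "('m, 'm \<Rightarrow> kfield) tens"
    assume "z \<in> tensor_space (transport C M) (transport C (dual C 1 M))"
    then show "qtr C (transport C M) (tensor_map (transport C M) (dual C troot (transport C M)) id (D_map C M) z) =
        qtr C M (tensor_J C M (dual C 1 M) z)"
      unfolding tensor_space_transport by (rule qtr_comparison)
  next
    fix \<E> \<E>' :: "'m set" and c
    assume "weight_basis C (transport C M) \<E>" and \<E>': "weight_basis C M \<E>'"
    then have \<E>: "weight_basis C M \<E>" by simp
    show "coev C troot (transport C M) \<E> c =
        tensor_map (dual C troot (transport C M)) (transport C M) (D_map C M) id
          (tensor_J_inv C (dual C 1 M) M (coev C 1 M \<E>' c))"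
      unfolding coev_transport coev_comparison[OF \<E>'] by (rule coev_basis_independent[OF \<E> \<E>'])
    show "coqtr C troot (transport C M) \<E> c =
        tensor_map (transport C M) (dual C troot (transport C M)) id (D_map C M)
          (tensor_J_inv C M (dual C 1 M) (coqtr C 1 M \<E>' c))"
      unfolding coqtr_transport coqtr_comparison[OF \<E>'] by (rule coqtr_basis_independent[OF \<E> \<E>'])
  qed
qed

end
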